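(* Let $m\ge 1$ be an integer, $\delta\in\mathbb{R}$ and $p,q\in\mathbb{N}=\{0,1,2,\dots\}$. If $p<q$, then $H(s\ell_{m+1},\mathcal{D}(\mathcal{S}^p_\delta(\mathbb{R}^m),\mathcal{S}^q_\delta(\mathbb{R}^m)))=0$. Otherwise, setting $n=p-q\ge 0$, the inclusion $$\mathcal{D}^n(\mathcal{S}^p_\delta(\mathbb{R}^m),\mathcal{S}^q_\delta(\mathbb{R}^m))\to\mathcal{D}(\mathcal{S}^p_\delta(\mathbb{R}^m),\mathcal{S}^q_\delta(\mathbb{R}^m))$$ induces an isomorphism in cohomology of $s\ell_{m+1}$.
   Context: $s\ell_{m+1}$ denotes the Lie subalgebra of the Lie algebra $Vect(\mathbb{R}^m)$ of smooth vector fields on $\mathbb{R}^m$ spanned by $\partial_i$, $x^j\partial_i$ and $x^jE$ ($1\le i,j\le m$), where $E=\sum_i x^i\partial_i$; it is isomorphic to $s\ell(m+1,\mathbb{R})$. $\mathcal{S}^k_\delta(\mathbb{R}^m)$ is the space of smooth symmetric $k$-contravariant tensor fields on $\mathbb{R}^m$ with values in the $\delta$-densities. It is identified with $C_\infty(\mathbb{R}^m,\vee^k\mathbb{R}^m)$, with Lie derivative $L_XP=X.P-\rho(DX)P+\delta\,\mathrm{tr}(DX)P$, where $X.P=\sum_i X^i\partial_iP$, $DX=(\partial_jX^i)$ and $\rho$ is the natural representation of $g\ell(m,\mathbb{R})$ on $\vee^k\mathbb{R}^m$. $\mathcal{D}^k(\mathcal{S}^p_\delta(\mathbb{R}^m),\mathcal{S}^q_\delta(\mathbb{R}^m))$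 is the space of linear differential operators of order $\le k$ (with smooth coefficients) from $\mathcal{S}^p_\delta(\mathbb{R}^m)$ into $\mathcal{S}^q_\delta(\mathbb{R}^m)$, and $\mathcal{D}(\mathcal{S}^p_\delta(\mathbb{R}^m),\mathcal{S}^q_\delta(\mathbb{R}^m))=\bigcup_k\mathcal{D}^k(\mathcal{S}^p_\delta(\mathbb{R}^m),\mathcal{S}^q_\delta(\mathbb{R}^m))$. On these spaces $X\in s\ell_{m+1}$ acts by $D\mapsto L_X\circ D-D\circ L_X$. $H(s\ell_{m+1},W)=\bigoplus_u H^u(s\ell_{m+1},W)$ is the Chevalley–Eilenberg cohomology of $s\ell_{m+1}$ with coefficients in the module $W$. *)

theory Defs
  imports
    "HOL-Analysis.Analysis"
    "HOL-Library.Multiset"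
    "HOL-Library.Function_Algebras"
    "HOL-Library.Set_Algebras"
begin

section \<open>Function spaces as real vector spaces\<close>

instantiation "fun" :: (type, real_vector) real_vector
begin

definition scaleR_fun_def: "a *\<^sub>R f = (\<lambda>x. a *\<^sub>R f x)"

instance
  by standard (simp_all add: scaleR_fun_def fun_eq_iff scaleR_add_right scaleR_add_left)

end


section \<open>Chevalley--Eilenberg cohomology\<close>

text \<open>
  A Lie algebra is given by a subspace \<open>g\<close> of a real vector space with a bracket \<open>br\<close>, a
  \<open>g\<close>-module by a subspace \<open>W\<close> of a real vector space with an action \<open>act\<close>.
  A cochain of degree \<open>u\<close> takes the list of its \<open>u\<close> arguments; it is extended by \<open>0\<close> to lists
  that have the wrong length or entries outside \<open>g\<close>, so that equality of cochains is equality
  of functions.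
\<close>

definition ce_cochains :: "'g::real_vector set \<Rightarrow> 'w::real_vector set \<Rightarrow> nat \<Rightarrow> ('g list \<Rightarrow> 'w) set" where
  "ce_cochains g W u =
    {c. (\<forall>Xs. length Xs = u \<and> set Xs \<subseteq> g \<longrightarrow> c Xs \<in> W) \<and>
        (\<forall>Xs. \<not> (length Xs = u \<and> set Xs \<subseteq> g) \<longrightarrow> c Xs = 0) \<and>
        (\<forall>Xs i a b Y Z. length Xs = u \<and> set Xs \<subseteq> g \<and> i < u \<and> Y \<in> g \<and> Z \<in> g \<longrightarrow>
            c (Xs[i := a *\<^sub>R Y + b *\<^sub>R Z]) = a *\<^sub>R c (Xs[i := Y]) + b *\<^sub>R c (Xs[i := Z])) \<and>
        (\<forall>Xs i j. length Xs = u \<and> set Xs \<subseteq> g \<and> i < j \<and> j < u \<and> Xs ! i = Xs ! j \<longrightarrow> c Xs = 0)}"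

text \<open>The list \<open>nths Xs (- {i})\<close> is \<open>Xs\<close> with its \<open>i\<close>-th entry omitted; indices start at \<open>0\<close>.\<close>

definition ce_diff ::
  "'g::real_vector set \<Rightarrow> ('g \<Rightarrow> 'g \<Rightarrow> 'g) \<Rightarrow> ('g \<Rightarrow> 'w \<Rightarrow> 'w::real_vector) \<Rightarrow> nat
    \<Rightarrow> ('g list \<Rightarrow> 'w) \<Rightarrow> ('g list \<Rightarrow> 'w)" where
  "ce_diff g br act u c = (\<lambda>Xs.
     if length Xs = Suc u \<and> set Xs \<subseteq> g then
       (\<Sum>i\<le>u. (-1) ^ i *\<^sub>R act (Xs ! i) (c (nths Xs (- {i})))) +
       (\<Sum>(i, j) \<in> {(i, j). i < j \<and> j \<le> u}.
          (-1) ^ (i + j) *\<^sub>R c (br (Xs ! i) (Xs ! j) # nths Xs (- {i, j})))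
     else 0)"

definition ce_cocycles ::
  "'g::real_vector set \<Rightarrow> ('g \<Rightarrow> 'g \<Rightarrow> 'g) \<Rightarrow> ('g \<Rightarrow> 'w \<Rightarrow> 'w::real_vector) \<Rightarrow> 'w set \<Rightarrow> nat
    \<Rightarrow> ('g list \<Rightarrow> 'w) set" where
  "ce_cocycles g br act W u = {c \<in> ce_cochains g W u. ce_diff g br act u c = 0}"

fun ce_coboundaries ::
  "'g::real_vector set \<Rightarrow> ('g \<Rightarrow> 'g \<Rightarrow> 'g) \<Rightarrow> ('g \<Rightarrow> 'w \<Rightarrow> 'w::real_vector) \<Rightarrow> 'w set \<Rightarrow> nat
    \<Rightarrow> ('g list \<Rightarrow> 'w) set" where
  "ce_coboundaries g br act W 0 = {0}"
| "ce_coboundaries g br act W (Suc u) = ce_diff g br act u ` ce_cochains g W u"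

definition ce_cohomology_deg ::
  "'g::real_vector set \<Rightarrow> ('g \<Rightarrow> 'g \<Rightarrow> 'g) \<Rightarrow> ('g \<Rightarrow> 'w \<Rightarrow> 'w::real_vector) \<Rightarrow> 'w set \<Rightarrow> nat
    \<Rightarrow> ('g list \<Rightarrow> 'w) set set" where
  "ce_cohomology_deg g br act W u =
     (\<lambda>c. c +o ce_coboundaries g br act W u) ` ce_cocycles g br act W u"

text \<open>
  The direct sum over all degrees consists of the families of classes that vanish in all but
  finitely many degrees. The class \<open>0\<close> of degree \<open>u\<close> is the set of coboundaries. Addition of
  classes is \<open>(+)\<close> on sets, taken degreewise.
\<close>

definition ce_cohomology ::
  "'g::real_vector set \<Rightarrow> ('g \<Rightarrow> 'g \<Rightarrow> 'g) \<Rightarrow> ('g \<Rightarrow> 'w \<Rightarrow> 'w::real_vector) \<Rightarrow> 'w set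
    \<Rightarrow> (nat \<Rightarrow> ('g list \<Rightarrow> 'w) set) set" where
  "ce_cohomology g br act W =
     {h. (\<forall>u. h u \<in> ce_cohomology_deg g br act W u) \<and>
         finite {u. h u \<noteq> ce_coboundaries g br act W u}}"

text \<open>Adding the coboundaries makes the multiple by the scalar \<open>0\<close> a full coset again.\<close>

definition ce_scale ::
  "'g::real_vector set \<Rightarrow> ('g \<Rightarrow> 'g \<Rightarrow> 'g) \<Rightarrow> ('g \<Rightarrow> 'w \<Rightarrow> 'w::real_vector) \<Rightarrow> 'w set
    \<Rightarrow> real \<Rightarrow> (nat \<Rightarrow> ('g list \<Rightarrow> 'w) set) \<Rightarrow> (nat \<Rightarrow> ('g list \<Rightarrow> 'w) set)" where
  "ce_scale g br act W a h = (\<lambda>u. (\<lambda>c. a *\<^sub>R c) ` h u + ce_coboundaries g br act W u)"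

text \<open>
  If \<open>W' \<subseteq> W\<close> is a submodule, with sets \<open>B' \<subseteq> B\<close> of coboundaries, then the map induced by the
  inclusion sends \<open>c + B'\<close> to \<open>c + B = (c + B') + B\<close>.
\<close>

definition ce_inclusion_map ::
  "'g::real_vector set \<Rightarrow> ('g \<Rightarrow> 'g \<Rightarrow> 'g) \<Rightarrow> ('g \<Rightarrow> 'w \<Rightarrow> 'w::real_vector) \<Rightarrow> 'w set
    \<Rightarrow> (nat \<Rightarrow> ('g list \<Rightarrow> 'w) set) \<Rightarrow> (nat \<Rightarrow> ('g list \<Rightarrow> 'w) set)" where
  "ce_inclusion_map g br act W h = (\<lambda>u. h u + ce_coboundaries g br act W u)"

definition ce_inclusion_iso ::
  "'g::real_vector set \<Rightarrow> ('g \<Rightarrow> 'g \<Rightarrow> 'g) \<Rightarrow> ('g \<Rightarrow> 'w \<Rightarrow> 'w::real_vector) \<Rightarrow> 'w set \<Rightarrow> 'w set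
    \<Rightarrow> bool" where
  "ce_inclusion_iso g br act W' W \<longleftrightarrow>
     W' \<subseteq> W \<and>
     (let H' = ce_cohomology g br act W'; H = ce_cohomology g br act W;
          \<Phi> = ce_inclusion_map g br act W
      in bij_betw \<Phi> H' H \<and>
         (\<forall>h\<in>H'. \<forall>k\<in>H'. \<Phi> (h + k) = \<Phi> h + \<Phi> k) \<and>
         (\<forall>a. \<forall>h\<in>H'. \<Phi> (ce_scale g br act W' a h) = ce_scale g br act W a (\<Phi> h)))"


section \<open>Smooth functions and the projective embedding of sl(m+1)\<close>

definition partial :: "'m::finite \<Rightarrow> (real^'m \<Rightarrow> 'b::real_normed_vector) \<Rightarrow> real^'m \<Rightarrow> 'b" where
  "partial i f x = frechet_derivative f (at x) (axis i 1)"

fun C_diff :: "nat \<Rightarrow> (real^'m::finite \<Rightarrow> real) \<Rightarrow> bool" where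
  "C_diff 0 f \<longleftrightarrow> continuous_on UNIV f"
| "C_diff (Suc k) f \<longleftrightarrow> (\<forall>x. f differentiable (at x)) \<and> (\<forall>i. C_diff k (partial i f))"

definition smooth :: "(real^'m::finite \<Rightarrow> real) \<Rightarrow> bool" where
  "smooth f \<longleftrightarrow> (\<forall>k. C_diff k f)"

type_synonym 'm vfield = "real^'m \<Rightarrow> real^'m"

definition along :: "'m::finite vfield \<Rightarrow> (real^'m \<Rightarrow> 'b::real_normed_vector) \<Rightarrow> real^'m \<Rightarrow> 'b" where
  "along X f x = (\<Sum>i\<in>UNIV. X x $ i *\<^sub>R partial i f x)"

definition lie_bracket :: "'m::finite vfield \<Rightarrow> 'm vfield \<Rightarrow> 'm vfield" where
  "lie_bracket X Y = (\<lambda>x. along X Y x - along Y X x)"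

definition coord_field :: "'m::finite \<Rightarrow> 'm vfield" where
  "coord_field i = (\<lambda>x. axis i 1)"

definition euler_field :: "'m::finite vfield" where
  "euler_field = (\<lambda>x. \<Sum>i\<in>UNIV. x $ i *\<^sub>R coord_field i x)"

definition sl_fields :: "'m::finite vfield set" where
  "sl_fields = span
     ({coord_field i | i. True} \<union>
      {\<lambda>x. x $ j *\<^sub>R coord_field i x | i j. True} \<union>
      {\<lambda>x. x $ j *\<^sub>R euler_field x | j. True})"


section \<open>Symmetric contravariant tensor fields with values in densities\<close>

text \<open>
  A \<open>k\<close>-contravariant tensor is given by its components, indexed by the lists of length \<open>k\<close> over
  the coordinate indices (and \<open>0\<close> on all other lists).
\<close>

type_synonym 'm tensor = "'m list \<Rightarrow> real"
type_synonym 'm tfield = "real^'m \<Rightarrow> 'm tensor"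

definition sym_tensors :: "nat \<Rightarrow> 'm tensor set" where
  "sym_tensors k =
     {T. (\<forall>I. length I \<noteq> k \<longrightarrow> T I = 0) \<and> (\<forall>I J. mset I = mset J \<longrightarrow> T I = T J)}"

definition sym_tensor_fields :: "nat \<Rightarrow> 'm::finite tfield set" where
  "sym_tensor_fields k =
     {P. (\<forall>x. P x \<in> sym_tensors k) \<and> (\<forall>I. smooth (\<lambda>x. P x I))}"

text \<open>
  The natural (derivation) representation of \<open>gl(m)\<close>; the rank of the tensor is the length of the
  index list, so one formula serves all ranks.
\<close>

definition gl_rep :: "real^'m^'m \<Rightarrow> 'm::finite tensor \<Rightarrow> 'm tensor" where
  "gl_rep A T = (\<lambda>I. \<Sum>r<length I. \<Sum>j\<in>UNIV. A $ (I ! r) $ j * T (I[r := j]))"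

text \<open>
  The density weight enters only here. The entry of \<open>jacobian X (at x)\<close> in row \<open>i\<close> and column \<open>j\<close>
  is the \<open>j\<close>-th partial derivative of the \<open>i\<close>-th component of \<open>X\<close>.
\<close>

definition lie_deriv :: "real \<Rightarrow> 'm::finite vfield \<Rightarrow> 'm tfield \<Rightarrow> 'm tfield" where
  "lie_deriv \<delta> X P = (\<lambda>x I.
     along X (\<lambda>y. P y I) x
     - gl_rep (jacobian X (at x)) (P x) I
     + \<delta> * trace (jacobian X (at x)) * P x I)"


section \<open>Differential operators\<close>

text \<open>
  The partial derivative belonging to a word of coordinate indices. Multi-indices of order at most
  \<open>k\<close> are represented by the words of length at most \<open>k\<close>.
\<close>

definition partials :: "'m::finite list \<Rightarrow> (real^'m \<Rightarrow> real) \<Rightarrow> real^'m \<Rightarrow> real" where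
  "partials \<alpha> f = foldr partial \<alpha> f"

text \<open>
  Operators are extended by \<open>0\<close> outside the tensor fields of rank \<open>p\<close>, so that equality of
  operators is equality of functions.
\<close>

definition diff_ops_le :: "nat \<Rightarrow> nat \<Rightarrow> nat \<Rightarrow> ('m::finite tfield \<Rightarrow> 'm tfield) set" where
  "diff_ops_le k p q =
     {D. (\<forall>P \<in> sym_tensor_fields p. D P \<in> sym_tensor_fields q) \<and>
         (\<forall>P. P \<notin> sym_tensor_fields p \<longrightarrow> D P = 0) \<and>
         (\<exists>A :: 'm list \<Rightarrow> real^'m \<Rightarrow> 'm list \<Rightarrow> 'm list \<Rightarrow> real.
            (\<forall>\<alpha> J I. smooth (\<lambda>x. A \<alpha> x J I)) \<and>
            (\<forall>P \<in> sym_tensor_fields p. \<forall>x J. length J = q \<longrightarrow>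
               D P x J = (\<Sum>\<alpha> | length \<alpha> \<le> k. \<Sum>I | length I = p.
                            A \<alpha> x J I * partials \<alpha> (\<lambda>y. P y I) x)))}"

definition diff_ops :: "nat \<Rightarrow> nat \<Rightarrow> ('m::finite tfield \<Rightarrow> 'm tfield) set" where
  "diff_ops p q = (\<Union>k. diff_ops_le k p q)"

definition op_action ::
  "real \<Rightarrow> nat \<Rightarrow> 'm::finite vfield \<Rightarrow> ('m tfield \<Rightarrow> 'm tfield) \<Rightarrow> ('m tfield \<Rightarrow> 'm tfield)" where
  "op_action \<delta> p X D = (\<lambda>P.
     if P \<in> sym_tensor_fields p then lie_deriv \<delta> X (D P) - D (lie_deriv \<delta> X P) else 0)"

end

(*
  Let n = p - q. Fix k > n and a cochain b of degree u with values in the operators of order at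
  most k, whose differential has values in order at most k - 1. Contract with the Euler field
  centred at the point x at which the operator is evaluated: h c = c(E, ...) - sum_i x_i c(d_i, ...).
  By Cartan's formula, d h + h d acts on the symbol of b by the scalar n - k, minus the derivation
  that replaces an argument X by the part T_x X of X that is quadratic around x. Since T_x is
  idempotent, that derivation has eigenvalues s = 0, ..., u, so d h + h d has only the nonzero
  eigenvalues n - k - s modulo lower order. Hence b is a coboundary modulo cochains of lower order.
  As cochains on a finite-dimensional algebra take values in operators of bounded order, iteration
  lowers the order of any cochain with differential of order at most n down to n (to nothing if
  n < 0), which gives both surjectivity and injectivity in cohomology.
*)
theory Submission
  imports Defs
begin

section \<open>Cartan calculus on Chevalley--Eilenberg cochains\<close>

text \<open>Centring makes the Euler field vanish where the operator is evaluated. So no coefficient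
  is differentiated, and arbitrary smooth coefficients do not disturb the eigenvalues. The price is
  that multiplication by \<open>x $ i\<close> does not commute with the differential: the derivative
  of \<open>x $ i\<close> along an argument \<open>X\<close> leaves extra terms. These terms decide
  the proof. Bracketing with the centred field has the eigenvalues -1, 0, 1 on the constant, linear
  and quadratic parts of \<open>X\<close> around the point; the extra terms add the constant part
  back, which turns -1 into 0. Hence every \<open>s\<close> is nonnegative, and n - k - s is
  negative as soon as k > n. The scalar n - k collects p from the argument, -q from the value and -1
  from each derivative; the density weight cancels, being the same on both sides. As the idempotent
  depends on the point, cochains are not split into eigencochains. Instead the product of N, N - 1,
  ..., N - u, where N is the derivation, is shown to annihilate them at each point separately, and
  is then read backwards modulo coboundaries and lower order.\<close>

lemma nths_omit_0: "nths (Y # Ys) (- {0}) = Ys"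
  by (simp add: nths_Cons) (simp add: Compl_eq nths_all)

lemma nths_omit_Suc: "nths (Y # Ys) (- {Suc i}) = Y # nths Ys (- {i})"
proof -
  have "{j. Suc j \<in> - {Suc i}} = - {i}" by auto
  then show ?thesis by (simp add: nths_Cons)
qed

lemma nths_omit_0_Suc: "nths (Y # Ys) (- {0, Suc j}) = nths Ys (- {j})"
proof -
  have "{k. Suc k \<in> - {0, Suc j}} = - {j}" by auto
  then show ?thesis by (simp add: nths_Cons)
qed

lemma nths_omit_Suc_Suc: "nths (Y # Ys) (- {Suc i, Suc j}) = Y # nths Ys (- {i, j})"
proof -
  have "{k. Suc k \<in> - {Suc i, Suc j}} = - {i, j}" by auto
  then show ?thesis by (simp add: nths_Cons)
qed

text \<open>The interior product. On lists it is plain consing, so the Cartan calculus runs by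
  recursion on the argument list and the signed sums of \<open>ce_diff\<close> rarely have to be
  opened.\<close>

definition ce_insert :: "'g \<Rightarrow> ('g list \<Rightarrow> 'w) \<Rightarrow> 'g list \<Rightarrow> 'w" where
  "ce_insert Y c = (\<lambda>Xs. c (Y # Xs))"

lemma ce_insert_apply [simp]: "ce_insert Y c Xs = c (Y # Xs)"
  by (simp add: ce_insert_def)

section \<open>Cochains and the insertion of a first argument\<close>

lemma ce_cochains_mono: "W \<subseteq> W' \<Longrightarrow> ce_cochains g W u \<subseteq> ce_cochains g W' u"
  unfolding ce_cochains_def by blast

lemma ce_cochains_outside:
  "c \<in> ce_cochains g W u \<Longrightarrow> \<not> (length Xs = u \<and> set Xs \<subseteq> g) \<Longrightarrow> c Xs = 0"
  unfolding ce_cochains_def by blast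

lemma ce_cochains_in:
  "c \<in> ce_cochains g W u \<Longrightarrow> length Xs = u \<Longrightarrow> set Xs \<subseteq> g \<Longrightarrow> c Xs \<in> W"
  unfolding ce_cochains_def by blast

lemma ce_cochains_lin:
  "c \<in> ce_cochains g W u \<Longrightarrow> length Xs = u \<Longrightarrow> set Xs \<subseteq> g \<Longrightarrow> i < u \<Longrightarrow> Y \<in> g \<Longrightarrow> Z \<in> g \<Longrightarrow>
    c (Xs[i := a *\<^sub>R Y + b *\<^sub>R Z]) = a *\<^sub>R c (Xs[i := Y]) + b *\<^sub>R c (Xs[i := Z])"
  unfolding ce_cochains_def by blast

lemma ce_cochains_alt:
  "c \<in> ce_cochains g W u \<Longrightarrow> length Xs = u \<Longrightarrow> set Xs \<subseteq> g \<Longrightarrow> i < j \<Longrightarrow> j < u \<Longrightarrow> Xs ! i = Xs ! j \<Longrightarrow>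
    c Xs = 0"
  unfolding ce_cochains_def by blast

lemma ce_cochains_subspace:
  assumes W: "subspace W" shows "subspace (ce_cochains g W u)"
proof -
  have comb: "(\<lambda>Xs. a *\<^sub>R c Xs + b *\<^sub>R c' Xs) \<in> ce_cochains g W u"
    if c: "c \<in> ce_cochains g W u" and c': "c' \<in> ce_cochains g W u" for a b c c'
    unfolding ce_cochains_def
  proof (intro CollectI conjI allI impI; (elim conjE)?)
    fix Xs assume "length Xs = u" "set Xs \<subseteq> g"
    then show "a *\<^sub>R c Xs + b *\<^sub>R c' Xs \<in> W"
      using ce_cochains_in[OF c] ce_cochains_in[OF c'] W by (simp add: subspace_add subspace_scale)
  next
    fix Xs assume "\<not> (length Xs = u \<and> set Xs \<subseteq> g)"
    then show "a *\<^sub>R c Xs + b *\<^sub>R c' Xs = 0"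
      using ce_cochains_outside[OF c] ce_cochains_outside[OF c'] by simp
  next
    fix Xs i r s Y Z
    assume "length Xs = u" "set Xs \<subseteq> g" "i < u" "Y \<in> g" "Z \<in> g"
    then show "a *\<^sub>R c (Xs[i := r *\<^sub>R Y + s *\<^sub>R Z]) + b *\<^sub>R c' (Xs[i := r *\<^sub>R Y + s *\<^sub>R Z])
        = r *\<^sub>R (a *\<^sub>R c (Xs[i := Y]) + b *\<^sub>R c' (Xs[i := Y]))
          + s *\<^sub>R (a *\<^sub>R c (Xs[i := Z]) + b *\<^sub>R c' (Xs[i := Z]))"
      by (simp add: ce_cochains_lin[OF c] ce_cochains_lin[OF c'] scaleR_add_right mult.commute)
  next
    fix Xs i j
    assume "length Xs = u" "set Xs \<subseteq> g" "i < j" "j < u" "Xs ! i = Xs ! j"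
    then show "a *\<^sub>R c Xs + b *\<^sub>R c' Xs = 0"
      using ce_cochains_alt[OF c] ce_cochains_alt[OF c'] by simp
  qed
  show ?thesis
    unfolding subspace_def
  proof (intro conjI ballI allI)
    show "0 \<in> ce_cochains g W u"
      unfolding ce_cochains_def by (simp add: W subspace_0)
    show "c + c' \<in> ce_cochains g W u" if "c \<in> ce_cochains g W u" "c' \<in> ce_cochains g W u" for c c'
      using comb[OF that, of 1 1] by (simp add: plus_fun_def)
    show "a *\<^sub>R c \<in> ce_cochains g W u" if "c \<in> ce_cochains g W u" for a c
      using comb[OF that that, of a 0] by (simp add: scaleR_fun_def)
  qed
qed

lemma ce_cochains_0_iff: "c \<in> ce_cochains g W 0 \<longleftrightarrow> c [] \<in> W \<and> (\<forall>Xs. Xs \<noteq> [] \<longrightarrow> c Xs = 0)"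
  unfolding ce_cochains_def by auto

text \<open>With the converse \<open>ce_cochains_SucI\<close>, this reduces the properties of a
  cochain of degree \<open>Suc u\<close> to those of its insertions, which have degree
  \<open>u\<close>. Inductions on the degree rest on it.\<close>

lemma ce_cochains_SucD:
  assumes c: "c \<in> ce_cochains g W (Suc u)"
  shows "c [] = 0"
    and "Y \<notin> g \<Longrightarrow> ce_insert Y c = 0"
    and "Y \<in> g \<Longrightarrow> ce_insert Y c \<in> ce_cochains g W u"
    and "subspace g \<Longrightarrow> Y \<in> g \<Longrightarrow> Z \<in> g \<Longrightarrow>
          ce_insert (a *\<^sub>R Y + b *\<^sub>R Z) c = a *\<^sub>R ce_insert Y c + b *\<^sub>R ce_insert Z c"
    and "Y \<in> g \<Longrightarrow> ce_insert Y (ce_insert Y c) = 0"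
proof -
  show "c [] = 0" using ce_cochains_outside[OF c] by simp
  show "ce_insert Y c = 0" if "Y \<notin> g"
    using ce_cochains_outside[OF c] that by (simp add: fun_eq_iff)
  show "ce_insert Y c \<in> ce_cochains g W u" if Y: "Y \<in> g"
    unfolding ce_cochains_def
  proof (intro CollectI conjI allI impI; (elim conjE)?)
    fix Xs assume "length Xs = u" "set Xs \<subseteq> g"
    then show "ce_insert Y c Xs \<in> W" using ce_cochains_in[OF c, of "Y # Xs"] Y by simp
  next
    fix Xs assume "\<not> (length Xs = u \<and> set Xs \<subseteq> g)"
    then show "ce_insert Y c Xs = 0" using ce_cochains_outside[OF c, of "Y # Xs"] Y by simp
  next
    fix Xs i a b Y' Z
    assume "length Xs = u" "set Xs \<subseteq> g" "i < u" "Y' \<in> g" "Z \<in> g"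
    then show "ce_insert Y c (Xs[i := a *\<^sub>R Y' + b *\<^sub>R Z])
        = a *\<^sub>R ce_insert Y c (Xs[i := Y']) + b *\<^sub>R ce_insert Y c (Xs[i := Z])"
      using ce_cochains_lin[OF c, of "Y # Xs" "Suc i" Y' Z a b] Y by simp
  next
    fix Xs i j
    assume "length Xs = u" "set Xs \<subseteq> g" "i < j" "j < u" "Xs ! i = Xs ! j"
    then show "ce_insert Y c Xs = 0"
      using ce_cochains_alt[OF c, of "Y # Xs" "Suc i" "Suc j"] Y by simp
  qed
  show "ce_insert (a *\<^sub>R Y + b *\<^sub>R Z) c = a *\<^sub>R ce_insert Y c + b *\<^sub>R ce_insert Z c"
    if g: "subspace g" and YZ: "Y \<in> g" "Z \<in> g"
  proof
    fix Xs
    show "ce_insert (a *\<^sub>R Y + b *\<^sub>R Z) c Xs = (a *\<^sub>R ce_insert Y c + b *\<^sub>R ce_insert Z c) Xs"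
    proof (cases "length Xs = u \<and> set Xs \<subseteq> g")
      case True
      then show ?thesis
        using ce_cochains_lin[OF c, of "Y # Xs" 0 Y Z a b] YZ by (simp add: scaleR_fun_def)
    next
      case False
      then show ?thesis
        using ce_cochains_outside[OF c] by (simp add: scaleR_fun_def)
    qed
  qed
  show "ce_insert Y (ce_insert Y c) = 0" if "Y \<in> g"
  proof
    fix Xs
    show "ce_insert Y (ce_insert Y c) Xs = 0 Xs"
    proof (cases "length (Y # Y # Xs) = Suc u \<and> set Xs \<subseteq> g")
      case True
      then show ?thesis
        using ce_cochains_alt[OF c, of "Y # Y # Xs" 0 1] that by simp
    next
      case False
      then show ?thesis
        using ce_cochains_outside[OF c] by simp
    qed
  qed
qed

text \<open>Polarisation: alternation is expanded at \<open>(Y + Z) # (Y + Z) # Xs\<close>. For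
  \<open>u = 0\<close> both lists are too long, and both values are the default 0.\<close>

lemma ce_insert_swap:
  assumes g: "subspace g" and c: "c \<in> ce_cochains g W (Suc u)" and YZ: "Y \<in> g" "Z \<in> g"
  shows "c (Y # Z # Xs) = - c (Z # Y # Xs)"
proof (cases u)
  case 0
  then show ?thesis using ce_cochains_outside[OF c] by simp
next
  case (Suc v)
  have S: "Y + Z \<in> g" using g YZ by (simp add: subspace_add)
  have lin: "c ((Y + Z) # Ys) = c (Y # Ys) + c (Z # Ys)" for Ys
    using fun_cong[OF ce_cochains_SucD(4)[OF c g YZ, of 1 1], of Ys] by simp
  have lin': "c (U # (Y + Z) # Ys) = c (U # Y # Ys) + c (U # Z # Ys)" if "U \<in> g" for U Ys
    using fun_cong[OF ce_cochains_SucD(4)[OF ce_cochains_SucD(3)[OF c that, unfolded Suc] g YZ, of 1 1], of Ys]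
    by simp
  have sq: "c (U # U # Ys) = 0" if "U \<in> g" for U Ys
    using fun_cong[OF ce_cochains_SucD(5)[OF c that], of Ys] by simp
  have "c ((Y + Z) # (Y + Z) # Xs) = 0" by (rule sq[OF S])
  then have "c (Y # Z # Xs) + c (Z # Y # Xs) = 0"
    by (simp add: lin lin'[OF YZ(1)] lin'[OF YZ(2)] sq[OF YZ(1)] sq[OF YZ(2)])
  then show ?thesis by (simp only: eq_neg_iff_add_eq_0)
qed

text \<open>Alternation is asked only for the first two slots: a repetition inside the tail is
  covered by the insertions, and one between the head and a later slot is brought into a tail by a
  transposition.\<close>

lemma ce_cochains_SucI:
  assumes g: "subspace g" and c0: "c [] = 0"
    and out: "\<And>Y. Y \<notin> g \<Longrightarrow> ce_insert Y c = 0"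
    and ins: "\<And>Y. Y \<in> g \<Longrightarrow> ce_insert Y c \<in> ce_cochains g W u"
    and lin: "\<And>a b Y Z. Y \<in> g \<Longrightarrow> Z \<in> g \<Longrightarrow>
          ce_insert (a *\<^sub>R Y + b *\<^sub>R Z) c = a *\<^sub>R ce_insert Y c + b *\<^sub>R ce_insert Z c"
    and alt: "\<And>Y. Y \<in> g \<Longrightarrow> ce_insert Y (ce_insert Y c) = 0"
  shows "c \<in> ce_cochains g W (Suc u)"
  unfolding ce_cochains_def
proof (intro CollectI conjI allI impI; (elim conjE)?)
  fix Xs assume "length Xs = Suc u" "set Xs \<subseteq> g"
  then show "c Xs \<in> W" using ce_cochains_in[OF ins] by (cases Xs) auto
next
  fix Xs assume A: "\<not> (length Xs = Suc u \<and> set Xs \<subseteq> g)"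
  show "c Xs = 0"
  proof (cases Xs)
    case Nil
    then show ?thesis using c0 by simp
  next
    case (Cons Y Ys)
    show ?thesis
    proof (cases "Y \<in> g")
      case True
      then show ?thesis using ce_cochains_outside[OF ins, of Y Ys] A Cons by auto
    next
      case False
      then show ?thesis using out[of Y] Cons by (simp add: fun_eq_iff)
    qed
  qed
next
  fix Xs i a b Y Z
  assume A: "length Xs = Suc u" "set Xs \<subseteq> g" "i < Suc u" "Y \<in> g" "Z \<in> g"
  then obtain U Us where Xs: "Xs = U # Us" "length Us = u" "U \<in> g" "set Us \<subseteq> g"
    by (cases Xs) auto
  show "c (Xs[i := a *\<^sub>R Y + b *\<^sub>R Z]) = a *\<^sub>R c (Xs[i := Y]) + b *\<^sub>R c (Xs[i := Z])"
  proof (cases i)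
    case 0
    then show ?thesis using Xs lin[OF A(4,5), of a b] by (simp add: fun_eq_iff scaleR_fun_def)
  next
    case (Suc j)
    then show ?thesis using Xs A ce_cochains_lin[OF ins[of U], of Us j Y Z a b] by simp
  qed
next
  fix Xs i j
  assume A: "length Xs = Suc u" "set Xs \<subseteq> g" "i < j" "j < Suc u" "Xs ! i = Xs ! j"
  then obtain U Us where Xs: "Xs = U # Us" "length Us = u" "U \<in> g" "set Us \<subseteq> g"
    by (cases Xs) auto
  obtain j' where j: "j = Suc j'" using A by (cases j) auto
  show "c Xs = 0"
  proof (cases i)
    case (Suc i')
    then show ?thesis using Xs A j ce_cochains_alt[OF ins[of U], of Us i' j'] by simp
  next
    case i: 0
    then obtain V Vs where Us: "Us = V # Vs" "V \<in> g" "set Vs \<subseteq> g" using Xs j A by (cases Us) auto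
    show ?thesis
    proof (cases j')
      case 0
      then show ?thesis using alt[of U] Xs i j A Us by (simp add: fun_eq_iff)
    next
      case (Suc k)
      \<comment> \<open>The entry \<open>U\<close> recurs beyond the second slot. Polarisation
        exchanges \<open>U\<close> and \<open>V\<close>, after which both copies are arguments of
        \<open>ce_insert V c\<close>.\<close>
      have S: "U + V \<in> g" using g Xs Us by (simp add: subspace_add)
      have L: "c ((U + V) # Ys) = c (U # Ys) + c (V # Ys)" for Ys
        using fun_cong[OF lin[OF Xs(3) Us(2), of 1 1], of Ys] by simp
      have u: "u = Suc (length Vs)" using Xs(2) Us(1) by simp
      have L': "c (T # (U + V) # Ys) = c (T # U # Ys) + c (T # V # Ys)" if "T \<in> g" for T Ys
        using fun_cong[OF ce_cochains_SucD(4)[OF ins[OF that, unfolded u] g Xs(3) Us(2), of 1 1], of Ys]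
        by simp
      have sq: "c (T # T # Ys) = 0" if "T \<in> g" for T Ys
        using fun_cong[OF alt[OF that], of Ys] by simp
      have "c ((U + V) # (U + V) # Vs) = 0" by (rule sq[OF S])
      then have "c (U # V # Vs) + c (V # U # Vs) = 0"
        by (simp add: L L'[OF Xs(3)] L'[OF Us(2)] sq[OF Xs(3)] sq[OF Us(2)])
      then have "c (U # V # Vs) = - c (V # U # Vs)"
        by (simp only: eq_neg_iff_add_eq_0)
      moreover have "c (V # U # Vs) = 0"
      proof -
        have "U = Vs ! k" using A(5) by (simp add: Xs(1) Us(1) i j Suc)
        moreover have "Suc k < u" using A(4) j Suc by simp
        ultimately show ?thesis
          using ce_cochains_alt[OF ins[OF Us(2)], of "U # Vs" 0 "Suc k"] Xs(3) Us(3) u by simp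
      qed
      ultimately show ?thesis by (simp add: Xs(1) Us(1))
    qed
  qed
qed

text \<open>Moving \<open>Z\<close> past the \<open>i\<close> arguments before it costs
  \<open>(-1) ^ i\<close>. This translates the sums of the differential, which put an entry in
  front, into derivations that replace an argument in place.\<close>

lemma ce_update_eq_move:
  assumes g: "subspace g"
  shows "c \<in> ce_cochains g W u \<Longrightarrow> length Xs = u \<Longrightarrow> set Xs \<subseteq> g \<Longrightarrow> i < u \<Longrightarrow> Z \<in> g \<Longrightarrow>
    c (Xs[i := Z]) = (-1) ^ i *\<^sub>R c (Z # nths Xs (- {i}))"
proof (induction i arbitrary: c u Xs)
  case 0
  then show ?case by (cases Xs) (auto simp: nths_omit_0)
next
  case (Suc i)
  then obtain Y Ys where Xs: "Xs = Y # Ys" "Y \<in> g" "set Ys \<subseteq> g" "u = Suc (length Ys)"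
    by (cases Xs) auto
  have c: "c \<in> ce_cochains g W (Suc (length Ys))" using Suc.prems(1) Xs(4) by simp
  have i: "i < length Ys" using Suc.prems(4) Xs(4) by simp
  have "ce_insert Y c (Ys[i := Z]) = (-1) ^ i *\<^sub>R ce_insert Y c (Z # nths Ys (- {i}))"
    by (rule Suc.IH[OF ce_cochains_SucD(3)[OF c Xs(2)] refl Xs(3) i Suc.prems(5)])
  then have "c (Y # Ys[i := Z]) = (-1) ^ i *\<^sub>R c (Y # Z # nths Ys (- {i}))"
    by (simp only: ce_insert_apply)
  also have "c (Y # Z # nths Ys (- {i})) = - c (Z # Y # nths Ys (- {i}))"
    by (rule ce_insert_swap[OF g c Xs(2) Suc.prems(5)])
  finally show ?case by (simp add: Xs nths_omit_Suc)
qed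

declare ce_insert_apply [simp del]

text \<open>The axioms are relativised to \<open>g\<close> and \<open>W\<close> because Lie brackets
  and Lie derivatives of fields that are not differentiable need not satisfy any of these
  laws.\<close>

locale ce_module =
  fixes g :: "'g::real_vector set" and br :: "'g \<Rightarrow> 'g \<Rightarrow> 'g"
    and act :: "'g \<Rightarrow> 'w \<Rightarrow> 'w::real_vector" and W :: "'w set"
  assumes g_subspace: "subspace g"
    and br_closed: "X \<in> g \<Longrightarrow> Y \<in> g \<Longrightarrow> br X Y \<in> g"
    and br_lin: "X \<in> g \<Longrightarrow> Y \<in> g \<Longrightarrow> Z \<in> g \<Longrightarrow> br (a *\<^sub>R X + b *\<^sub>R Y) Z = a *\<^sub>R br X Z + b *\<^sub>R br Y Z"
    and br_antisym: "X \<in> g \<Longrightarrow> Y \<in> g \<Longrightarrow> br X Y = - br Y X"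
    and jacobi: "X \<in> g \<Longrightarrow> Y \<in> g \<Longrightarrow> Z \<in> g \<Longrightarrow> br (br X Y) Z = br X (br Y Z) - br Y (br X Z)"
    and W_subspace: "subspace W"
    and act_closed: "X \<in> g \<Longrightarrow> w \<in> W \<Longrightarrow> act X w \<in> W"
    and act_lin_left: "X \<in> g \<Longrightarrow> Y \<in> g \<Longrightarrow> w \<in> W \<Longrightarrow>
          act (a *\<^sub>R X + b *\<^sub>R Y) w = a *\<^sub>R act X w + b *\<^sub>R act Y w"
    and act_lin: "X \<in> g \<Longrightarrow> w \<in> W \<Longrightarrow> w' \<in> W \<Longrightarrow>
          act X (a *\<^sub>R w + b *\<^sub>R w') = a *\<^sub>R act X w + b *\<^sub>R act X w'"
    and act_br: "X \<in> g \<Longrightarrow> Y \<in> g \<Longrightarrow> w \<in> W \<Longrightarrow>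
          act (br X Y) w = act X (act Y w) - act Y (act X w)"
begin

abbreviation "C \<equiv> ce_cochains g W"
abbreviation "d \<equiv> ce_diff g br act"
abbreviation "B \<equiv> ce_coboundaries g br act W"
abbreviation "ins \<equiv> ce_insert"

lemma g_comb: "X \<in> g \<Longrightarrow> Y \<in> g \<Longrightarrow> a *\<^sub>R X + b *\<^sub>R Y \<in> g"
  using g_subspace by (simp add: subspace_add subspace_scale)

lemma C_subspace: "subspace (C u)"
  using W_subspace by (rule ce_cochains_subspace)

lemmas C_0 = subspace_0[OF C_subspace] and C_add = subspace_add[OF C_subspace]
  and C_diff = subspace_diff[OF C_subspace] and C_scale = subspace_scale[OF C_subspace]

lemma br_self: "X \<in> g \<Longrightarrow> br X X = 0"
  using br_antisym[of X X] by (simp add: eq_neg_iff_add_eq_0 flip: scaleR_2)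

lemma br_lin_right:
  assumes "X \<in> g" "Y \<in> g" "Z \<in> g"
  shows "br X (a *\<^sub>R Y + b *\<^sub>R Z) = a *\<^sub>R br X Y + b *\<^sub>R br X Z"
  using assms by (simp add: br_antisym[of X] br_lin g_comb)

lemma act_0: assumes "X \<in> g" shows "act X 0 = 0"
  using act_lin[OF assms subspace_0[OF W_subspace] subspace_0[OF W_subspace], of 0 0] by simp

lemma ins_simps [simp]:
  "ins Y (c + c') = ins Y c + ins Y c'" "ins Y (c - c') = ins Y c - ins Y c'"
  "ins Y (a *\<^sub>R c) = a *\<^sub>R ins Y c" "ins Y 0 = 0" "ins Y (- c) = - ins Y c"
  by (simp_all add: ce_insert_def fun_eq_iff scaleR_fun_def)

text \<open>The principle behind the inductions below: identities between cochains are checked after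
  inserting one argument, where the degree has dropped.\<close>

lemma ce_ext: "c [] = c' [] \<Longrightarrow> (\<And>Y. ins Y c = ins Y c') \<Longrightarrow> c = c'"
proof
  fix Xs
  assume "c [] = c' []" "\<And>Y. ins Y c = ins Y c'"
  then show "c Xs = c' Xs"
    by (cases Xs) (simp_all add: ce_insert_def fun_eq_iff)
qed

lemma ins_0 [simp]: "c \<in> C 0 \<Longrightarrow> ins Y c = 0"
  by (simp add: ce_insert_def ce_cochains_0_iff fun_eq_iff)

lemmas C_Nil = ce_cochains_SucD(1)
  and ins_C = ce_cochains_SucD(3) and ins_lin = ce_cochains_SucD(4)[OF _ g_subspace]
  and ins_ins = ce_cochains_SucD(5)

lemma ins_anti:
  assumes "c \<in> C (Suc u)" "Y \<in> g" "Z \<in> g" shows "ins Y (ins Z c) = - ins Z (ins Y c)"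
  by (rule ext) (simp add: ce_insert_def ce_insert_swap[OF g_subspace assms(1,3,2)])

text \<open>The recursion is the commutation rule
  \<open>ins Z (L Y c) = L Y (ins Z c) - ins (br Y Z) c\<close> taken as a definition. The test
  \<open>Z \<in> g\<close> keeps the value 0 on lists with entries outside \<open>g\<close>.\<close>

primrec lie :: "'g \<Rightarrow> 'g list \<Rightarrow> ('g list \<Rightarrow> 'w) \<Rightarrow> 'w" where
  "lie Y [] = (\<lambda>c. act Y (c []))"
| "lie Y (Z # Zs) = (\<lambda>c. if Z \<in> g then lie Y Zs (ins Z c) - c (br Y Z # Zs) else 0)"

definition L :: "'g \<Rightarrow> ('g list \<Rightarrow> 'w) \<Rightarrow> 'g list \<Rightarrow> 'w" where
  "L Y c = (\<lambda>Xs. lie Y Xs c)"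

lemma L_Nil [simp]: "L Y c [] = act Y (c [])"
  by (simp add: L_def)

lemma ins_L: "Z \<in> g \<Longrightarrow> ins Z (L Y c) = L Y (ins Z c) - ins (br Y Z) c"
  by (simp add: L_def ce_insert_def fun_eq_iff)

lemma ins_L_out: "Z \<notin> g \<Longrightarrow> ins Z (L Y c) = 0"
  by (simp add: L_def ce_insert_def fun_eq_iff)

lemma L_0: assumes "Y \<in> g" shows "L Y 0 = 0"
proof
  fix Xs show "L Y 0 Xs = 0 Xs"
    using assms by (induction Xs) (simp_all add: L_def act_0)
qed

lemma L_lin:
  assumes Y: "Y \<in> g"
  shows "c \<in> C u \<Longrightarrow> c' \<in> C u \<Longrightarrow> L Y (a *\<^sub>R c + b *\<^sub>R c') = a *\<^sub>R L Y c + b *\<^sub>R L Y c'"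
proof (induction u arbitrary: c c')
  case 0
  show ?case
  proof (rule ce_ext)
    show "L Y (a *\<^sub>R c + b *\<^sub>R c') [] = (a *\<^sub>R L Y c + b *\<^sub>R L Y c') []"
      using 0 Y by (simp add: scaleR_fun_def act_lin ce_cochains_0_iff)
    show "ins Z (L Y (a *\<^sub>R c + b *\<^sub>R c')) = ins Z (a *\<^sub>R L Y c + b *\<^sub>R L Y c')" for Z
      using 0 Y by (cases "Z \<in> g") (simp_all add: ins_L ins_L_out L_0)
  qed
next
  case (Suc u)
  show ?case
  proof (rule ce_ext)
    show "L Y (a *\<^sub>R c + b *\<^sub>R c') [] = (a *\<^sub>R L Y c + b *\<^sub>R L Y c') []"
      using Suc.prems Y by (simp add: scaleR_fun_def C_Nil act_0)
    show "ins Z (L Y (a *\<^sub>R c + b *\<^sub>R c')) = ins Z (a *\<^sub>R L Y c + b *\<^sub>R L Y c')" for Z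
    proof (cases "Z \<in> g")
      case Z: True
      have "L Y (a *\<^sub>R ins Z c + b *\<^sub>R ins Z c') = a *\<^sub>R L Y (ins Z c) + b *\<^sub>R L Y (ins Z c')"
        by (rule Suc.IH) (use Suc.prems Z in \<open>simp_all add: ins_C\<close>)
      then show ?thesis using Z by (simp add: ins_L algebra_simps)
    qed (simp add: ins_L_out)
  qed
qed

lemma L_diff: "Y \<in> g \<Longrightarrow> c \<in> C u \<Longrightarrow> c' \<in> C u \<Longrightarrow> L Y (c - c') = L Y c - L Y c'"
  using L_lin[of Y c u c' 1 "-1"] by simp

lemma L_C:
  assumes Y: "Y \<in> g"
  shows "c \<in> C u \<Longrightarrow> L Y c \<in> C u"
proof (induction u arbitrary: c)
  case 0
  have "ins Z (L Y c) = 0" for Z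
    using 0 Y by (cases "Z \<in> g") (simp_all add: ins_L ins_L_out L_0)
  then have "L Y c (Z # Zs) = 0" for Z Zs
    by (simp add: ce_insert_def fun_eq_iff)
  then show ?case
    using 0 Y by (auto simp: ce_cochains_0_iff act_closed neq_Nil_conv)
next
  case (Suc u)
  show ?case
  proof (rule ce_cochains_SucI[OF g_subspace])
    show "L Y c [] = 0" using Suc.prems Y by (simp add: C_Nil act_0)
    show "ins Z (L Y c) = 0" if "Z \<notin> g" for Z using that by (rule ins_L_out)
    show "ins Z (L Y c) \<in> C u" if "Z \<in> g" for Z
      using that Suc Y by (simp add: ins_L C_diff ins_C br_closed)
    show "ins (a *\<^sub>R Z + b *\<^sub>R Z') (L Y c) = a *\<^sub>R ins Z (L Y c) + b *\<^sub>R ins Z' (L Y c)"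
      if Z: "Z \<in> g" "Z' \<in> g" for a b Z Z'
      using Z Y Suc.prems
      by (simp add: ins_L g_comb ins_lin[OF Suc.prems] br_lin_right br_closed
          L_lin[OF Y ins_C ins_C, OF Suc.prems _ Suc.prems] algebra_simps)
    \<comment> \<open>The two terms that contain \<open>br Y Z\<close> cancel because insertions
      anticommute.\<close>
    show "ins Z (ins Z (L Y c)) = 0" if Z: "Z \<in> g" for Z
      using Z Y Suc.prems
      by (simp add: ins_L ins_ins L_0 ins_anti[OF Suc.prems, of "br Y Z" Z] br_closed)
  qed
qed

lemma L_lin_left:
  assumes XY: "X \<in> g" "Y \<in> g"
  shows "c \<in> C u \<Longrightarrow> L (a *\<^sub>R X + b *\<^sub>R Y) c = a *\<^sub>R L X c + b *\<^sub>R L Y c"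
proof (induction u arbitrary: c)
  case 0
  show ?case
  proof (rule ce_ext)
    show "L (a *\<^sub>R X + b *\<^sub>R Y) c [] = (a *\<^sub>R L X c + b *\<^sub>R L Y c) []"
      using 0 XY by (simp add: scaleR_fun_def act_lin_left ce_cochains_0_iff)
    show "ins Z (L (a *\<^sub>R X + b *\<^sub>R Y) c) = ins Z (a *\<^sub>R L X c + b *\<^sub>R L Y c)" for Z
      using 0 XY by (cases "Z \<in> g") (simp_all add: ins_L ins_L_out L_0 g_comb)
  qed
next
  case (Suc u)
  show ?case
  proof (rule ce_ext)
    show "L (a *\<^sub>R X + b *\<^sub>R Y) c [] = (a *\<^sub>R L X c + b *\<^sub>R L Y c) []"
      using Suc.prems XY by (simp add: scaleR_fun_def C_Nil act_0 g_comb)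
    show "ins Z (L (a *\<^sub>R X + b *\<^sub>R Y) c) = ins Z (a *\<^sub>R L X c + b *\<^sub>R L Y c)" for Z
    proof (cases "Z \<in> g")
      case Z: True
      have "L (a *\<^sub>R X + b *\<^sub>R Y) (ins Z c) = a *\<^sub>R L X (ins Z c) + b *\<^sub>R L Y (ins Z c)"
        by (rule Suc.IH[OF ins_C[OF Suc.prems Z]])
      then show ?thesis
        using Z XY ins_lin[OF Suc.prems, of "br X Z" "br Y Z" a b]
        by (simp add: ins_L br_lin br_closed algebra_simps)
    qed (simp add: ins_L_out)
  qed
qed

lemma L_br:
  assumes XY: "X \<in> g" "Y \<in> g"
  shows "c \<in> C u \<Longrightarrow> L (br X Y) c = L X (L Y c) - L Y (L X c)"
proof (induction u arbitrary: c)
  case 0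
  show ?case
  proof (rule ce_ext)
    show "L (br X Y) c [] = (L X (L Y c) - L Y (L X c)) []"
      using 0 XY by (simp add: act_br ce_cochains_0_iff)
    show "ins Z (L (br X Y) c) = ins Z (L X (L Y c) - L Y (L X c))" for Z
      using 0 XY by (simp add: L_C br_closed)
  qed
next
  case (Suc u)
  note c = Suc.prems
  show ?case
  proof (rule ce_ext)
    show "L (br X Y) c [] = (L X (L Y c) - L Y (L X c)) []"
      using c XY by (simp add: C_Nil act_0 br_closed)
    show "ins Z (L (br X Y) c) = ins Z (L X (L Y c) - L Y (L X c))" for Z
    proof (cases "Z \<in> g")
      case Z: True
      \<comment> \<open>The two middle terms are together symmetric in \<open>U\<close> and
        \<open>V\<close> and drop out of the commutator; the last terms are matched by the Jacobi
        identity.\<close>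
      have 1: "ins Z (L U (L V c)) = L U (L V (ins Z c)) - L U (ins (br V Z) c) - L V (ins (br U Z) c)
          + ins (br V (br U Z)) c" if UV: "U \<in> g" "V \<in> g" for U V
        using UV Z c by (simp add: ins_L br_closed L_diff[of _ _ u] L_C ins_C)
      have "ins (br (br X Y) Z) c = ins (br X (br Y Z)) c - ins (br Y (br X Z)) c"
        using ins_lin[OF c, of "br X (br Y Z)" "br Y (br X Z)" 1 "-1"] XY Z
        by (simp add: jacobi br_closed)
      moreover have "L (br X Y) (ins Z c) = L X (L Y (ins Z c)) - L Y (L X (ins Z c))"
        by (rule Suc.IH[OF ins_C[OF c Z]])
      ultimately show ?thesis
        using XY Z by (simp add: ins_L[of Z "br X Y"] 1)
    qed (simp add: ins_L_out)
  qed
qed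

text \<open>The recursion unrolled. Each bracket is moved to the front, the form in which it occurs
  in \<open>ce_diff\<close>.\<close>

lemma L_sum:
  "c \<in> C u \<Longrightarrow> length Xs = u \<Longrightarrow> set Xs \<subseteq> g \<Longrightarrow> Y \<in> g \<Longrightarrow>
    L Y c Xs = act Y (c Xs) - (\<Sum>j<u. (-1) ^ j *\<^sub>R c (br Y (Xs ! j) # nths Xs (- {j})))"
proof (induction u arbitrary: c Xs)
  case 0
  then show ?case by simp
next
  case (Suc u)
  then obtain Z Zs where Xs: "Xs = Z # Zs" "Z \<in> g" "set Zs \<subseteq> g" "length Zs = u"
    by (cases Xs) auto
  have "L Y c Xs = L Y (ins Z c) Zs - c (br Y Z # Zs)"
    using fun_cong[OF ins_L[OF Xs(2), of Y c], of Zs] Xs by (simp add: ce_insert_def)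
  also have "L Y (ins Z c) Zs = act Y (c Xs) -
      (\<Sum>j<u. (-1) ^ j *\<^sub>R c (Z # br Y (Zs ! j) # nths Zs (- {j})))"
    using Suc.IH[OF ins_C[OF Suc.prems(1) Xs(2)] Xs(4,3) Suc.prems(4)] Xs by (simp add: ce_insert_def)
  also have "(\<Sum>j<u. (-1) ^ j *\<^sub>R c (Z # br Y (Zs ! j) # nths Zs (- {j})))
      = (\<Sum>j<u. (-1) ^ Suc j *\<^sub>R c (br Y (Zs ! j) # Z # nths Zs (- {j})))"
  proof (rule sum.cong[OF refl])
    fix j assume "j \<in> {..<u}"
    then have "Zs ! j \<in> g" using Xs by auto
    then show "(-1) ^ j *\<^sub>R c (Z # br Y (Zs ! j) # nths Zs (- {j}))
      = (-1) ^ Suc j *\<^sub>R c (br Y (Zs ! j) # Z # nths Zs (- {j}))"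
      using ce_insert_swap[OF g_subspace Suc.prems(1) Xs(2), of "br Y (Zs ! j)"] Suc.prems(4)
      by (simp add: br_closed)
  qed
  finally show ?case
    by (simp only: sum.lessThan_Suc_shift Xs(1) nths_omit_Suc nths_omit_0 nth_Cons_Suc nth_Cons_0
        power_0 scaleR_one diff_diff_eq add.commute)
qed

section \<open>The differential and its commutation rules\<close>

lemma d_out: "\<not> (length Xs = Suc u \<and> set Xs \<subseteq> g) \<Longrightarrow> d u c Xs = 0"
  by (simp only: ce_diff_def if_False)

lemma d_Nil [simp]: "d u c [] = 0"
  by (simp add: d_out)

lemma ins_d_out: "Y \<notin> g \<Longrightarrow> ins Y (d u c) = 0"
  by (simp add: ce_insert_def fun_eq_iff d_out)

lemma ins_d_0:
  assumes c: "c \<in> C 0" and Y: "Y \<in> g" shows "ins Y (d 0 c) = L Y c"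
proof
  fix Xs
  have e: "{(i::nat, j). i < j \<and> j = 0} = {}" by auto
  show "ins Y (d 0 c) Xs = L Y c Xs"
  proof (cases Xs)
    case Nil
    then show ?thesis using Y by (simp add: ce_insert_def ce_diff_def nths_omit_0 e)
  next
    case (Cons Z Zs)
    then show ?thesis using ce_cochains_outside[OF L_C[OF Y c], of Xs] by (simp add: ce_insert_def d_out)
  qed
qed

text \<open>Cartan's formula, read as a recursion for the differential along the argument list.\<close>

lemma ins_d_Suc:
  assumes c: "c \<in> C (Suc u)" and Y: "Y \<in> g"
  shows "ins Y (d (Suc u) c) = L Y c - d u (ins Y c)"
proof
  fix Xs
  show "ins Y (d (Suc u) c) Xs = (L Y c - d u (ins Y c)) Xs"
  proof (cases "length Xs = Suc u \<and> set Xs \<subseteq> g")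
    case False
    then show ?thesis
      using ce_cochains_outside[OF L_C[OF Y c], of Xs] by (auto simp: ce_insert_def d_out)
  next
    case True
    then have Xs: "length Xs = Suc u" "set Xs \<subseteq> g" by auto
    have nth: "Xs ! i \<in> g" if "i \<le> u" for i using Xs that by (metis le_imp_less_Suc nth_mem subsetD)
    let ?P = "\<lambda>u. {(i::nat, j). i < j \<and> j \<le> u}"
    let ?Z = "\<lambda>(i, j). (-1) ^ (i + j) *\<^sub>R c (br ((Y # Xs) ! i) ((Y # Xs) ! j) # nths (Y # Xs) (- {i, j}))"
    have fin: "finite (?P u)" for u
      by (rule finite_subset[of _ "{..u} \<times> {..u}"]) auto
    \<comment> \<open>Pairs are sorted by whether they contain index 0, the slot of
      \<open>Y\<close>. Those that do complete \<open>L Y c\<close>. The others rebuild the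
      differential of \<open>ins Y c\<close>, with opposite sign since \<open>Y\<close> stands
      behind the bracket.\<close>
    have P: "?P (Suc u) = (\<lambda>j. (0, Suc j)) ` {..u} \<union> (\<lambda>(i, j). (Suc i, Suc j)) ` ?P u"
    proof (rule set_eqI)
      fix x :: "nat \<times> nat"
      obtain i j where x: "x = (i, j)" by (cases x)
      show "x \<in> ?P (Suc u) \<longleftrightarrow> x \<in> (\<lambda>j. (0, Suc j)) ` {..u} \<union> (\<lambda>(i, j). (Suc i, Suc j)) ` ?P u"
        unfolding x by (cases i; cases j) (auto simp: image_iff)
    qed
    have "sum ?Z (?P (Suc u)) = sum ?Z ((\<lambda>j. (0, Suc j)) ` {..u}) + sum ?Z ((\<lambda>(i, j). (Suc i, Suc j)) ` ?P u)"
      unfolding P by (rule sum.union_disjoint) (use fin in auto)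
    also have "sum ?Z ((\<lambda>j. (0, Suc j)) ` {..u}) = (\<Sum>j\<le>u. ?Z (0, Suc j))"
      by (subst sum.reindex) (auto simp: inj_on_def)
    also have "\<dots> = - (\<Sum>j\<le>u. (-1) ^ j *\<^sub>R c (br Y (Xs ! j) # nths Xs (- {j})))"
      by (simp add: nths_omit_0_Suc sum_negf)
    also have "sum ?Z ((\<lambda>(i, j). (Suc i, Suc j)) ` ?P u) = (\<Sum>x\<in>?P u. ?Z (case x of (i, j) \<Rightarrow> (Suc i, Suc j)))"
      by (subst sum.reindex) (auto simp: inj_on_def)
    also have "\<dots> = (\<Sum>(i, j)\<in>?P u. - ((-1) ^ (i + j) *\<^sub>R ins Y c (br (Xs ! i) (Xs ! j) # nths Xs (- {i, j}))))"
    proof (rule sum.cong[OF refl])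
      fix x assume "x \<in> ?P u"
      then obtain i j where x: "x = (i, j)" "i < j" "j \<le> u" by auto
      have "c (br (Xs ! i) (Xs ! j) # Y # nths Xs (- {i, j})) = - c (Y # br (Xs ! i) (Xs ! j) # nths Xs (- {i, j}))"
        using ce_insert_swap[OF g_subspace c br_closed Y] nth[of i] nth[of j] x by simp
      then show "?Z (case x of (i, j) \<Rightarrow> (Suc i, Suc j))
          = (case x of (i, j) \<Rightarrow> - ((-1) ^ (i + j) *\<^sub>R ins Y c (br (Xs ! i) (Xs ! j) # nths Xs (- {i, j}))))"
        by (simp add: ce_insert_def x nths_omit_Suc_Suc)
    qed
    finally have Z: "sum ?Z (?P (Suc u)) = - (\<Sum>j\<le>u. (-1) ^ j *\<^sub>R c (br Y (Xs ! j) # nths Xs (- {j})))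
      - (\<Sum>(i, j)\<in>?P u. (-1) ^ (i + j) *\<^sub>R ins Y c (br (Xs ! i) (Xs ! j) # nths Xs (- {i, j})))"
      by (simp add: case_prod_unfold sum_negf)
    have A: "(\<Sum>i\<le>Suc u. (-1) ^ i *\<^sub>R act ((Y # Xs) ! i) (c (nths (Y # Xs) (- {i}))))
      = act Y (c Xs) - (\<Sum>i\<le>u. (-1) ^ i *\<^sub>R act (Xs ! i) (ins Y c (nths Xs (- {i}))))"
      by (simp only: sum.atMost_Suc_shift nths_omit_0 nths_omit_Suc nth_Cons_Suc nth_Cons_0
          power_0 scaleR_one power_Suc ce_insert_apply mult_minus1 scaleR_minus_left sum_negf diff_conv_add_uminus)
    have "ins Y (d (Suc u) c) Xs = (\<Sum>i\<le>Suc u. (-1) ^ i *\<^sub>R act ((Y # Xs) ! i) (c (nths (Y # Xs) (- {i}))))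
        + sum ?Z (?P (Suc u))"
      using Xs Y by (simp add: ce_insert_def ce_diff_def)
    also have "\<dots> = (act Y (c Xs) - (\<Sum>j<Suc u. (-1) ^ j *\<^sub>R c (br Y (Xs ! j) # nths Xs (- {j}))))
        - ((\<Sum>i\<le>u. (-1) ^ i *\<^sub>R act (Xs ! i) (ins Y c (nths Xs (- {i}))))
         + (\<Sum>(i, j)\<in>?P u. (-1) ^ (i + j) *\<^sub>R ins Y c (br (Xs ! i) (Xs ! j) # nths Xs (- {i, j}))))"
      unfolding A Z lessThan_Suc_atMost by (simp add: algebra_simps)
    also have "\<dots> = (L Y c - d u (ins Y c)) Xs"
      using L_sum[OF c Xs Y] Xs by (simp add: ce_insert_def ce_diff_def)
    finally show ?thesis .
  qed
qed

lemma d_lin: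
  "c \<in> C u \<Longrightarrow> c' \<in> C u \<Longrightarrow> d u (a *\<^sub>R c + b *\<^sub>R c') = a *\<^sub>R d u c + b *\<^sub>R d u c'"
proof (induction u arbitrary: c c')
  case 0
  have eq: "ins Y (d 0 (a *\<^sub>R c + b *\<^sub>R c')) = ins Y (a *\<^sub>R d 0 c + b *\<^sub>R d 0 c')" for Y
  proof (cases "Y \<in> g")
    case Y: True
    have "a *\<^sub>R c + b *\<^sub>R c' \<in> C 0" by (intro C_add C_scale 0)
    from ins_d_0[OF this Y] show ?thesis
      by (simp only: ins_d_0[OF 0(1) Y] ins_d_0[OF 0(2) Y] L_lin[OF Y 0] ins_simps)
  qed (simp add: ins_d_out)
  show ?case by (rule ce_ext[OF _ eq]) (simp add: scaleR_fun_def)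
next
  case (Suc u)
  have eq: "ins Y (d (Suc u) (a *\<^sub>R c + b *\<^sub>R c')) = ins Y (a *\<^sub>R d (Suc u) c + b *\<^sub>R d (Suc u) c')" for Y
  proof (cases "Y \<in> g")
    case Y: True
    have "d u (a *\<^sub>R ins Y c + b *\<^sub>R ins Y c') = a *\<^sub>R d u (ins Y c) + b *\<^sub>R d u (ins Y c')"
      by (rule Suc.IH) (use Suc.prems Y in \<open>simp_all add: ins_C\<close>)
    have "a *\<^sub>R c + b *\<^sub>R c' \<in> C (Suc u)" by (intro C_add C_scale Suc.prems)
    from ins_d_Suc[OF this Y] show ?thesis
      by (simp only: \<open>d u _ = _\<close> ins_d_Suc[OF Suc.prems(1) Y] ins_d_Suc[OF Suc.prems(2) Y]
          L_lin[OF Y Suc.prems] ins_simps) (simp add: algebra_simps)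
  qed (simp add: ins_d_out)
  show ?case by (rule ce_ext[OF _ eq]) (simp add: scaleR_fun_def)
qed

lemma d_add: "c \<in> C u \<Longrightarrow> c' \<in> C u \<Longrightarrow> d u (c + c') = d u c + d u c'"
  using d_lin[of c u c' 1 1] by simp

lemma d_diff: "c \<in> C u \<Longrightarrow> c' \<in> C u \<Longrightarrow> d u (c - c') = d u c - d u c'"
  using d_lin[of c u c' 1 "-1"] by simp

lemma d_scale: "c \<in> C u \<Longrightarrow> d u (a *\<^sub>R c) = a *\<^sub>R d u c"
  using d_lin[of c u c a 0] by simp

lemma d_0: "d u 0 = 0"
  using d_scale[OF C_0, of u 0] by simp

lemma d_C: "c \<in> C u \<Longrightarrow> d u c \<in> C (Suc u)"
proof (induction u arbitrary: c)
  case 0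
  show ?case
  proof (rule ce_cochains_SucI[OF g_subspace])
    show "ins (a *\<^sub>R Y + b *\<^sub>R Z) (d 0 c) = a *\<^sub>R ins Y (d 0 c) + b *\<^sub>R ins Z (d 0 c)"
      if "Y \<in> g" "Z \<in> g" for a b Y Z
      using that 0 by (simp add: ins_d_0 g_comb L_lin_left)
  qed (use 0 in \<open>simp_all add: ins_d_out ins_d_0 L_C\<close>)
next
  case (Suc u)
  note c = Suc.prems
  show ?case
  proof (rule ce_cochains_SucI[OF g_subspace])
    show "ins (a *\<^sub>R Y + b *\<^sub>R Z) (d (Suc u) c) = a *\<^sub>R ins Y (d (Suc u) c) + b *\<^sub>R ins Z (d (Suc u) c)"
      if "Y \<in> g" "Z \<in> g" for a b Y Z
      using that c by (simp add: ins_d_Suc g_comb L_lin_left[of _ _ _ "Suc u"] ins_lin[OF c]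
          d_lin[OF ins_C[OF c] ins_C[OF c]] algebra_simps)
    show "ins Y (d (Suc u) c) \<in> C (Suc u)" if "Y \<in> g" for Y
      using that c by (simp add: ins_d_Suc C_diff L_C Suc.IH ins_C)
    show "ins Y (ins Y (d (Suc u) c)) = 0" if Y: "Y \<in> g" for Y
    proof -
      have z: "ins 0 c = 0"
        using ins_lin[OF c Y Y, of 0 0] by simp
      \<comment> \<open>Cartan's formula for \<open>ins Y c\<close>, whose own insertion of
        \<open>Y\<close> is zero. Up to sign only \<open>ins (br Y Y) c\<close> is then left, and
        \<open>br Y Y = 0\<close>.\<close>
      have "ins Y (d u (ins Y c)) = L Y (ins Y c)"
      proof (cases u)
        case 0
        then show ?thesis using ins_C[OF c Y] Y by (simp add: ins_d_0)
      next
        case (Suc v)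
        then show ?thesis using ins_C[OF c Y] Y by (simp add: ins_d_Suc ins_ins[OF c] d_0)
      qed
      then show ?thesis
        using Y c by (simp add: ins_d_Suc ins_L br_self z)
    qed
  qed (simp_all add: ins_d_out)
qed

text \<open>After inserting \<open>X\<close>, Cartan's formula on both sides leaves
  \<open>L_br\<close> for \<open>Y\<close> and \<open>X\<close> and the same claim for
  \<open>ins X c\<close>, one degree lower.\<close>

lemma d_L: assumes Y: "Y \<in> g" shows "c \<in> C u \<Longrightarrow> d u (L Y c) = L Y (d u c)"
proof (induction u arbitrary: c)
  case 0
  have eq: "ins X (d 0 (L Y c)) = ins X (L Y (d 0 c))" for X
  proof (cases "X \<in> g")
    case True
    then show ?thesis
      using 0 Y by (simp add: ins_d_0 L_C ins_L br_closed L_br[of Y X c 0])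
  qed (simp add: ins_d_out ins_L_out)
  show ?case by (rule ce_ext[OF _ eq]) (simp add: act_0 Y)
next
  case (Suc u)
  note c = Suc.prems
  have eq: "ins X (d (Suc u) (L Y c)) = ins X (L Y (d (Suc u) c))" for X
  proof (cases "X \<in> g")
    case X: True
    have "ins X (d (Suc u) (L Y c)) = L X (L Y c) - d u (L Y (ins X c) - ins (br Y X) c)"
      using X Y c by (simp add: ins_d_Suc L_C ins_L)
    also have "\<dots> = L X (L Y c) - L Y (d u (ins X c)) + d u (ins (br Y X) c)"
      using X Y c by (simp add: d_diff[of _ u] L_C ins_C br_closed Suc.IH)
    finally show ?thesis
      using X Y c by (simp add: ins_d_Suc ins_L br_closed L_br[of Y X c "Suc u"]
          L_diff[of _ _ "Suc u"] L_C ins_C d_C)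
  qed (simp add: ins_d_out ins_L_out)
  show ?case by (rule ce_ext[OF _ eq]) (simp add: act_0 Y)
qed

text \<open>Cartan's formula turns the insertion of \<open>X\<close> into
  \<open>L X (d c) - d (L X c) + d (d (ins X c))\<close>, degrees omitted. The first two terms
  cancel by \<open>d_L\<close>; the third is the induction hypothesis.\<close>

lemma d_d: "c \<in> C u \<Longrightarrow> d (Suc u) (d u c) = 0"
proof (induction u arbitrary: c)
  case 0
  have eq: "ins X (d (Suc 0) (d 0 c)) = ins X 0" for X
    using 0 by (cases "X \<in> g") (simp_all add: ins_d_out ins_d_Suc d_C ins_d_0 d_L)
  show ?case by (rule ce_ext[OF _ eq]) (simp)
next
  case (Suc u)
  note c = Suc.prems
  have eq: "ins X (d (Suc (Suc u)) (d (Suc u) c)) = ins X 0" for X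
  proof (cases "X \<in> g")
    case X: True
    have "ins X (d (Suc (Suc u)) (d (Suc u) c)) = L X (d (Suc u) c) - d (Suc u) (L X c - d u (ins X c))"
      using X c by (simp add: ins_d_Suc d_C)
    also have "\<dots> = d (Suc u) (d u (ins X c))"
      using X c by (simp add: d_diff[of _ "Suc u"] L_C d_C ins_C d_L)
    also have "\<dots> = 0" using Suc.IH[OF ins_C[OF c X]] .
    finally show ?thesis by simp
  qed (simp add: ins_d_out)
  show ?case by (rule ce_ext[OF _ eq]) (simp)
qed

text \<open>The Leibniz rule \<open>d (f c) = f d c + df \<and> c\<close> in abstract form:
  \<open>\<mu>\<close> will be multiplication by a coordinate function and \<open>\<nu> X\<close>
  multiplication by its derivative along \<open>X\<close>.\<close>

lemma d_smul:
  assumes c: "c \<in> C u" and Xs: "length Xs = Suc u" "set Xs \<subseteq> g"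
    and \<mu>: "\<And>X w. X \<in> g \<Longrightarrow> w \<in> W \<Longrightarrow> act X (\<mu> w) = \<mu> (act X w) + \<nu> X w"
    and lin: "linear \<mu>"
  shows "d u (\<mu> \<circ> c) Xs = \<mu> (d u c Xs) + (\<Sum>i\<le>u. (-1) ^ i *\<^sub>R \<nu> (Xs ! i) (c (nths Xs (- {i}))))"
proof -
  have nth: "Xs ! i \<in> g" if "i \<le> u" for i using Xs that by (metis le_imp_less_Suc nth_mem subsetD)
  have W: "c Ys \<in> W" for Ys
    using ce_cochains_in[OF c, of Ys] ce_cochains_outside[OF c, of Ys] subspace_0[OF W_subspace]
    by (cases "length Ys = u \<and> set Ys \<subseteq> g") auto
  have "(\<Sum>i\<le>u. (-1) ^ i *\<^sub>R act (Xs ! i) (\<mu> (c (nths Xs (- {i})))))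
    = (\<Sum>i\<le>u. (-1) ^ i *\<^sub>R \<mu> (act (Xs ! i) (c (nths Xs (- {i})))) + (-1) ^ i *\<^sub>R \<nu> (Xs ! i) (c (nths Xs (- {i}))))"
    by (rule sum.cong[OF refl]) (simp add: \<mu> nth W scaleR_add_right)
  then show ?thesis
    using Xs by (simp add: ce_diff_def linear_add[OF lin] linear_sum[OF lin] linear_scale[OF lin]
        case_prod_unfold sum.distrib)
qed

lemma B_C: "b \<in> B u \<Longrightarrow> b \<in> C u"
  by (cases u) (auto simp: C_0 d_C)

lemma B_cocycle: "b \<in> B u \<Longrightarrow> d u b = 0"
  by (cases u) (auto simp: d_0 d_d)

lemma B_subspace: "subspace (B u)"
proof (cases u)
  case 0
  then show ?thesis by (simp add: subspace_def)
next
  case (Suc v)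
  show ?thesis unfolding subspace_def Suc ce_coboundaries.simps
  proof (intro conjI ballI allI)
    show "0 \<in> d v ` C v" using d_0 C_0 by (metis image_eqI)
    show "x + y \<in> d v ` C v" if "x \<in> d v ` C v" "y \<in> d v ` C v" for x y
      using that by (auto simp: d_add[symmetric] C_add)
    show "a *\<^sub>R x \<in> d v ` C v" if "x \<in> d v ` C v" for a x
      using that by (auto simp: d_scale[symmetric] C_scale)
  qed
qed

end

section \<open>Calculus of smooth functions\<close>

lemma partial_eqI: "(f has_derivative f') (at x) \<Longrightarrow> partial i f x = f' (axis i 1)"
  by (simp add: partial_def frechet_derivative_at[symmetric])

lemma partial_const: "partial i (\<lambda>x. c) = (\<lambda>x. 0)"
  by (rule ext, rule partial_eqI) (rule has_derivative_const)

lemma partial_coord: "partial i (\<lambda>x. x $ j) = (\<lambda>x. if i = j then 1 else 0)"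
proof
  fix x :: "real^'a"
  have "((\<lambda>x. x $ j) has_derivative (\<lambda>x. x $ j)) (at x)"
    by (rule bounded_linear_imp_has_derivative) (rule bounded_linear_vec_nth)
  from partial_eqI[OF this] show "partial i (\<lambda>x. x $ j) x = (if i = j then 1 else 0)"
    by (simp add: axis_def)
qed

lemma partial_add_at:
  assumes "f differentiable (at x)" "g differentiable (at x)"
  shows "partial i (\<lambda>x. f x + g x) x = partial i f x + partial i g x"
  unfolding partial_def using assms
  by (simp add: frechet_derivative_at[OF has_derivative_add, OF assms[unfolded frechet_derivative_works], symmetric])

lemma partial_mult_at:
  fixes f g :: "real^'m::finite \<Rightarrow> real"
  assumes "f differentiable (at x)" "g differentiable (at x)"
  shows "partial i (\<lambda>x. f x * g x) x = f x * partial i g x + partial i f x * g x"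
  unfolding partial_def using assms
  by (simp add: frechet_derivative_at[OF has_derivative_mult, OF assms[unfolded frechet_derivative_works], symmetric])

lemma C_diff_SucD: "C_diff (Suc k) f \<Longrightarrow> C_diff k f"
  by (induction k arbitrary: f)
    (auto intro: differentiable_imp_continuous_on simp: differentiable_on_def intro: differentiable_at_withinI)

lemma C_diff_const: "C_diff k (\<lambda>x. c)"
  by (induction k arbitrary: c) (simp_all add: partial_const)

lemma C_diff_coord: "C_diff k (\<lambda>x. x $ j)"
proof (cases k)
  case 0
  then show ?thesis by (simp add: continuous_on_component)
next
  case (Suc l)
  have "(\<lambda>x::real^'a. x $ j) differentiable (at x)" for x
    using bounded_linear_imp_differentiable[OF bounded_linear_vec_nth] .
  then show ?thesis
    using Suc C_diff_const[of l 0] C_diff_const[of l 1] by (auto simp: partial_coord)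
qed

lemma C_diff_add: "C_diff k f \<Longrightarrow> C_diff k g \<Longrightarrow> C_diff k (\<lambda>x. f x + g x)"
proof (induction k arbitrary: f g)
  case (Suc k)
  have "partial i (\<lambda>x. f x + g x) = (\<lambda>x. partial i f x + partial i g x)" for i
    using Suc.prems by (intro ext partial_add_at) simp_all
  then show ?case using Suc by simp
qed (simp add: continuous_on_add)

lemma C_diff_mult: "C_diff k f \<Longrightarrow> C_diff k g \<Longrightarrow> C_diff k (\<lambda>x. f x * g x)"
proof (induction k arbitrary: f g)
  case (Suc k)
  have "partial i (\<lambda>x. f x * g x) = (\<lambda>x. f x * partial i g x + partial i f x * g x)" for i
    using Suc.prems by (intro ext partial_mult_at) simp_all
  moreover have "C_diff k f" "C_diff k g" using Suc.prems C_diff_SucD by blast+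
  ultimately show ?case using Suc.prems by (simp add: Suc.IH C_diff_add)
qed (simp add: continuous_on_mult)

lemma smooth_const [simp]: "smooth (\<lambda>x. c)"
  by (simp add: smooth_def C_diff_const)

lemma smooth_coord [simp]: "smooth (\<lambda>x. x $ j)"
  by (simp add: smooth_def C_diff_coord)

lemma smooth_add: "smooth f \<Longrightarrow> smooth g \<Longrightarrow> smooth (\<lambda>x. f x + g x)"
  by (simp add: smooth_def C_diff_add)

lemma smooth_mult: "smooth f \<Longrightarrow> smooth g \<Longrightarrow> smooth (\<lambda>x. f x * g x)"
  by (simp add: smooth_def C_diff_mult)

lemma smooth_cmult: "smooth f \<Longrightarrow> smooth (\<lambda>x. c * f x)"
  by (rule smooth_mult) simp_all

lemma smooth_diff: "smooth f \<Longrightarrow> smooth g \<Longrightarrow> smooth (\<lambda>x. f x - g x)"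
  using smooth_add[of f "\<lambda>x. (-1) * g x"] smooth_cmult[of g "-1"] by simp

lemma smooth_sum: "(\<And>i. i \<in> I \<Longrightarrow> smooth (f i)) \<Longrightarrow> smooth (\<lambda>x. \<Sum>i\<in>I. f i x)"
  by (induction I rule: infinite_finite_induct) (simp_all add: smooth_add)

lemma smooth_partial: "smooth f \<Longrightarrow> smooth (partial i f)"
  unfolding smooth_def by (metis C_diff.simps(2))

lemma smooth_differentiable: "smooth f \<Longrightarrow> f differentiable (at x)"
  unfolding smooth_def by (metis C_diff.simps(2))

lemma smooth_continuous: "smooth f \<Longrightarrow> continuous_on UNIV f"
  unfolding smooth_def by (metis C_diff.simps(1))

lemma partial_add: "smooth f \<Longrightarrow> smooth g \<Longrightarrow> partial i (\<lambda>x. f x + g x) = (\<lambda>x. partial i f x + partial i g x)"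
  by (intro ext partial_add_at smooth_differentiable)

lemma partial_mult: "smooth f \<Longrightarrow> smooth g \<Longrightarrow>
    partial i (\<lambda>x. f x * g x) = (\<lambda>x. f x * partial i g x + partial i f x * g x)"
  by (intro ext partial_mult_at smooth_differentiable)

lemma partial_cmult: "smooth f \<Longrightarrow> partial i (\<lambda>x. c * f x) = (\<lambda>x. c * partial i f x)"
  by (simp add: partial_mult partial_const)

lemma partial_diff: "smooth f \<Longrightarrow> smooth g \<Longrightarrow> partial i (\<lambda>x. f x - g x) = (\<lambda>x. partial i f x - partial i g x)"
  using partial_add[of f "\<lambda>x. (-1) * g x" i] partial_cmult[of g i "-1"] smooth_cmult[of g "-1"] by simp

lemma partial_sum: "(\<And>i. i \<in> I \<Longrightarrow> smooth (f i)) \<Longrightarrow>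
    partial j (\<lambda>x. \<Sum>i\<in>I. f i x) = (\<lambda>x. \<Sum>i\<in>I. partial j (f i) x)"
  by (induction I rule: infinite_finite_induct) (simp_all add: partial_const partial_add smooth_sum)

section \<open>Symmetry of second partial derivatives\<close>

lemma DERIV_partial:
  fixes f :: "real^'m::finite \<Rightarrow> real"
  assumes "smooth f"
  shows "((\<lambda>t. f (y + t *\<^sub>R axis j 1)) has_real_derivative partial j f (y + t *\<^sub>R axis j 1)) (at t)"
proof -
  let ?f' = "frechet_derivative f (at (y + t *\<^sub>R axis j 1))"
  have f: "(f has_derivative ?f') (at (y + t *\<^sub>R axis j 1))"
    using smooth_differentiable[OF assms] frechet_derivative_works by blast
  have "((\<lambda>t. y + t *\<^sub>R axis j 1) has_derivative (\<lambda>h. h *\<^sub>R axis j 1)) (at t)"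
    by (auto intro!: derivative_eq_intros)
  from has_derivative_compose[OF this f]
  have "((\<lambda>t. f (y + t *\<^sub>R axis j 1)) has_derivative (\<lambda>h. ?f' (h *\<^sub>R axis j 1))) (at t)" .
  also have "(\<lambda>h. ?f' (h *\<^sub>R axis j 1)) = (\<lambda>h. partial j f (y + t *\<^sub>R axis j 1) * h)"
    using linear_scale[OF has_derivative_linear[OF f]] by (simp add: partial_def fun_eq_iff)
  finally show ?thesis by (simp add: has_field_derivative_def)
qed

text \<open>The mean value theorem, first in direction \<open>i\<close> for a difference in
  direction \<open>j\<close>, then in direction \<open>j\<close>. The difference on the left is
  symmetric in \<open>i\<close> and \<open>j\<close>, which \<open>partial_commute\<close>
  exploits.\<close>

lemma second_difference:
  fixes f :: "real^'m::finite \<Rightarrow> real"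
  assumes f: "smooth f" and h: "0 < h"
  obtains s t where "0 < s" "s < h" "0 < t" "t < h"
    "f (x + h *\<^sub>R axis i 1 + h *\<^sub>R axis j 1) - f (x + h *\<^sub>R axis i 1) - f (x + h *\<^sub>R axis j 1) + f x
      = h * h * partial j (partial i f) (x + s *\<^sub>R axis i 1 + t *\<^sub>R axis j 1)"
proof -
  let ?i = "axis i (1::real)" and ?j = "axis j (1::real)"
  define \<phi> where "\<phi> s = f ((x + h *\<^sub>R ?j) + s *\<^sub>R ?i) - f (x + s *\<^sub>R ?i)" for s
  have "(\<phi> has_real_derivative partial i f ((x + h *\<^sub>R ?j) + s *\<^sub>R ?i) - partial i f (x + s *\<^sub>R ?i)) (at s)" for s
    unfolding \<phi>_def by (intro derivative_intros DERIV_partial f)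
  then obtain s where s: "0 < s" "s < h"
    "\<phi> h - \<phi> 0 = (h - 0) * (partial i f ((x + h *\<^sub>R ?j) + s *\<^sub>R ?i) - partial i f (x + s *\<^sub>R ?i))"
    using MVT2[OF h, of \<phi> "\<lambda>s. partial i f ((x + h *\<^sub>R ?j) + s *\<^sub>R ?i) - partial i f (x + s *\<^sub>R ?i)"] by blast
  let ?\<psi> = "\<lambda>t. partial i f ((x + s *\<^sub>R ?i) + t *\<^sub>R ?j)"
  have "(?\<psi> has_real_derivative partial j (partial i f) ((x + s *\<^sub>R ?i) + t *\<^sub>R ?j)) (at t)" for t
    by (intro DERIV_partial smooth_partial f)
  then obtain t where t: "0 < t" "t < h"
    "?\<psi> h - ?\<psi> 0 = (h - 0) * partial j (partial i f) ((x + s *\<^sub>R ?i) + t *\<^sub>R ?j)"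
    using MVT2[OF h, of ?\<psi> "\<lambda>t. partial j (partial i f) ((x + s *\<^sub>R ?i) + t *\<^sub>R ?j)"] by blast
  have "\<phi> h - \<phi> 0 = h * (h * partial j (partial i f) ((x + s *\<^sub>R ?i) + t *\<^sub>R ?j))"
    using s(3) t(3) by (simp add: add_ac)
  then show ?thesis
    using that[OF s(1,2) t(1,2)] by (simp add: \<phi>_def add_ac)
qed

text \<open>Schwarz's theorem. One second difference, computed in both orders, makes a value of each
  mixed derivative near \<open>x\<close> equal to a value of the other near \<open>x\<close>;
  continuity does the rest.\<close>

lemma partial_commute:
  fixes f :: "real^'m::finite \<Rightarrow> real"
  assumes f: "smooth f"
  shows "partial i (partial j f) = partial j (partial i f)"
proof (rule ext, rule ccontr)
  fix x
  let ?F = "partial i (partial j f)" and ?G = "partial j (partial i f)"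
  assume ne: "?F x \<noteq> ?G x"
  \<comment> \<open>Half the distance: a value within \<open>e\<close> of the first number cannot
    equal a value within \<open>e\<close> of the second.\<close>
  define e where "e = dist (?F x) (?G x) / 2"
  have e: "e > 0" using ne by (simp add: e_def)
  have cont: "isCont ?F x" "isCont ?G x"
    using f smooth_continuous[OF smooth_partial[OF smooth_partial]] continuous_on_eq_continuous_at[OF open_UNIV] by blast+
  obtain r where r: "r > 0" "\<And>y. dist y x < r \<Longrightarrow> dist (?F y) (?F x) < e"
    using cont(1) e unfolding continuous_at_eps_delta by blast
  obtain r' where r': "r' > 0" "\<And>y. dist y x < r' \<Longrightarrow> dist (?G y) (?G x) < e"
    using cont(2) e unfolding continuous_at_eps_delta by blast
  \<comment> \<open>Both intermediate points lie at distance less than \<open>2 * h\<close> from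
    \<open>x\<close>, hence inside both radii.\<close>
  define h where "h = min r r' / 2"
  have h: "h > 0" "2 * h \<le> r" "2 * h \<le> r'" using r r' by (auto simp: h_def)
  have near: "dist (x + s *\<^sub>R axis a 1 + t *\<^sub>R axis b 1) x < 2 * h"
    if "0 < s" "s < h" "0 < t" "t < h" for s t and a b :: 'm
  proof -
    have "dist (x + s *\<^sub>R axis a 1 + t *\<^sub>R axis b 1) x = norm (s *\<^sub>R axis a (1::real) + t *\<^sub>R axis b 1)"
      by (simp add: dist_norm add.assoc)
    also have "\<dots> \<le> norm (s *\<^sub>R axis a (1::real)) + norm (t *\<^sub>R axis b (1::real))" by (rule norm_triangle_ineq)
    finally show ?thesis using that by (simp add: norm_axis_1)
  qed
  obtain s t where st: "0 < s" "s < h" "0 < t" "t < h"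
    "f (x + h *\<^sub>R axis i 1 + h *\<^sub>R axis j 1) - f (x + h *\<^sub>R axis i 1) - f (x + h *\<^sub>R axis j 1) + f x
      = h * h * ?G (x + s *\<^sub>R axis i 1 + t *\<^sub>R axis j 1)"
    using second_difference[OF f h(1)] by blast
  obtain s' t' where st': "0 < s'" "s' < h" "0 < t'" "t' < h"
    "f (x + h *\<^sub>R axis j 1 + h *\<^sub>R axis i 1) - f (x + h *\<^sub>R axis j 1) - f (x + h *\<^sub>R axis i 1) + f x
      = h * h * ?F (x + s' *\<^sub>R axis j 1 + t' *\<^sub>R axis i 1)"
    using second_difference[OF f h(1)] by blast
  have "f (x + h *\<^sub>R axis j 1 + h *\<^sub>R axis i 1) = f (x + h *\<^sub>R axis i 1 + h *\<^sub>R axis j 1)"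
    by (simp add: add_ac)
  then have "h * h * ?G (x + s *\<^sub>R axis i 1 + t *\<^sub>R axis j 1) = h * h * ?F (x + s' *\<^sub>R axis j 1 + t' *\<^sub>R axis i 1)"
    using st(5) st'(5) by linarith
  then have "?G (x + s *\<^sub>R axis i 1 + t *\<^sub>R axis j 1) = ?F (x + s' *\<^sub>R axis j 1 + t' *\<^sub>R axis i 1)"
    using h by simp
  moreover have "dist (?G (x + s *\<^sub>R axis i 1 + t *\<^sub>R axis j 1)) (?G x) < e"
    using r'(2) near[OF st(1-4), of i j] h by simp
  moreover have "dist (?F (x + s' *\<^sub>R axis j 1 + t' *\<^sub>R axis i 1)) (?F x) < e"
    using r(2) near[OF st'(1-4), of j i] h by simp
  ultimately have "dist (?F x) (?G x) < e + e"
    by (metis dist_commute dist_triangle_less_add)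
  then show False by (simp add: e_def)
qed

section \<open>Smooth vector fields\<close>

definition smooth_field :: "'m::finite vfield \<Rightarrow> bool" where
  "smooth_field X \<longleftrightarrow> (\<forall>i. smooth (\<lambda>x. X x $ i))"

lemma smooth_fieldD: "smooth_field X \<Longrightarrow> smooth (\<lambda>x. X x $ i)"
  by (simp add: smooth_field_def)

lemma along_real: "along X f x = (\<Sum>i\<in>UNIV. X x $ i * partial i f x)" for f :: "real^'m::finite \<Rightarrow> real"
  by (simp add: along_def)

lemma along_smooth: "smooth_field X \<Longrightarrow> smooth f \<Longrightarrow> smooth (along X f)"
  unfolding along_real[abs_def] by (intro smooth_sum smooth_mult smooth_fieldD smooth_partial)

lemma along_add: "smooth f \<Longrightarrow> smooth g \<Longrightarrow> along X (\<lambda>x. f x + g x) x = along X f x + along X g x"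
  by (simp add: along_real partial_add sum.distrib algebra_simps)

lemma along_diff: "smooth f \<Longrightarrow> smooth g \<Longrightarrow> along X (\<lambda>x. f x - g x) x = along X f x - along X g x"
  by (simp add: along_real partial_diff sum_subtractf algebra_simps)

lemma along_mult: "smooth f \<Longrightarrow> smooth g \<Longrightarrow>
    along X (\<lambda>x. f x * g x) x = f x * along X g x + along X f x * g x"
  by (simp add: along_real partial_mult sum.distrib sum_distrib_left sum_distrib_right algebra_simps)

lemma along_const: "along X (\<lambda>x. c) x = (0::real)"
  by (simp add: along_real partial_const)

lemma along_cmult: "smooth f \<Longrightarrow> along X (\<lambda>x. c * f x) x = c * along X f x"
  by (simp add: along_mult along_const)

lemma along_sum: "(\<And>i. i \<in> I \<Longrightarrow> smooth (f i)) \<Longrightarrow>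
    along X (\<lambda>x. \<Sum>i\<in>I. f i x) x = (\<Sum>i\<in>I. along X (f i) x)"
  by (induction I rule: infinite_finite_induct) (simp_all add: along_const along_add smooth_sum)

lemma smooth_field_has_derivative:
  assumes "smooth_field X"
  shows "(X has_derivative (\<lambda>h. \<chi> i. frechet_derivative (\<lambda>y. X y $ i) (at x) h)) (at x)"
proof (subst has_derivative_componentwise_within, intro ballI)
  fix b :: "real^'a" assume "b \<in> Basis"
  then obtain i where b: "b = axis i 1" by (auto simp: Basis_vec_def)
  have "(\<lambda>y. X y $ i) differentiable (at x)"
    using assms by (intro smooth_differentiable smooth_fieldD)
  then show "((\<lambda>y. X y \<bullet> b) has_derivative (\<lambda>h. (\<chi> i. frechet_derivative (\<lambda>y. X y $ i) (at x) h) \<bullet> b)) (at x)"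
    by (simp add: b inner_axis frechet_derivative_works)
qed

lemma jacobian_partial:
  assumes "smooth_field X" shows "jacobian X (at x) $ i $ j = partial j (\<lambda>y. X y $ i) x"
  unfolding jacobian_def matrix_def partial_def
  by (simp flip: frechet_derivative_at[OF smooth_field_has_derivative[OF assms, of x]])

lemma along_component:
  assumes "smooth_field Y" shows "along X Y x $ i = along X (\<lambda>y. Y y $ i) x"
  unfolding along_def partial_def
  by (simp flip: frechet_derivative_at[OF smooth_field_has_derivative[OF assms, of x]])

lemma lie_bracket_component:
  assumes "smooth_field X" "smooth_field Y"
  shows "lie_bracket X Y x $ i = along X (\<lambda>y. Y y $ i) x - along Y (\<lambda>y. X y $ i) x"
  by (simp add: lie_bracket_def along_component assms)

lemma smooth_field_lie_bracket: "smooth_field X \<Longrightarrow> smooth_field Y \<Longrightarrow> smooth_field (lie_bracket X Y)"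
  unfolding smooth_field_def[of "lie_bracket X Y"]
  by (simp add: lie_bracket_component smooth_diff along_smooth[unfolded along_def[abs_def]] along_smooth smooth_fieldD)

text \<open>The second-order parts of the two compositions agree by \<open>partial_commute\<close>,
  so the commutator is again of first order, with the components of the bracket as
  coefficients.\<close>

lemma along_lie_bracket:
  assumes X: "smooth_field X" and Y: "smooth_field Y" and f: "smooth f"
  shows "along (lie_bracket X Y) f x = along X (along Y f) x - along Y (along X f) x"
proof -
  have XY: "along X (along Y f) x = (\<Sum>j\<in>UNIV. along X (\<lambda>y. Y y $ j) x * partial j f x)
      + (\<Sum>i\<in>UNIV. \<Sum>j\<in>UNIV. X x $ i * Y x $ j * partial i (partial j f) x)"
    if X: "smooth_field X" and Y: "smooth_field Y" for X Y
  proof -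
    have "along X (along Y f) x = (\<Sum>j\<in>UNIV. along X (\<lambda>y. Y y $ j * partial j f y) x)"
      unfolding along_real[of Y f, abs_def]
      using f Y by (intro along_sum smooth_mult smooth_fieldD smooth_partial)
    also have "\<dots> = (\<Sum>j\<in>UNIV. along X (\<lambda>y. Y y $ j) x * partial j f x) + (\<Sum>j\<in>UNIV. Y x $ j * along X (partial j f) x)"
      using f Y by (simp add: along_mult smooth_fieldD smooth_partial sum.distrib)
    also have "(\<Sum>j\<in>UNIV. Y x $ j * along X (partial j f) x)
        = (\<Sum>i\<in>UNIV. \<Sum>j\<in>UNIV. X x $ i * Y x $ j * partial i (partial j f) x)"
      unfolding along_real sum_distrib_left by (subst sum.swap) (simp add: mult_ac)
    finally show ?thesis .
  qed
  have "(\<Sum>i\<in>UNIV. \<Sum>j\<in>UNIV. X x $ i * Y x $ j * partial i (partial j f) x)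
      = (\<Sum>i\<in>UNIV. \<Sum>j\<in>UNIV. Y x $ i * X x $ j * partial i (partial j f) x)"
    by (subst sum.swap) (simp add: partial_commute[OF f] mult_ac)
  then show ?thesis
    unfolding XY[OF X Y] XY[OF Y X]
    by (simp add: along_real[of "lie_bracket X Y"] lie_bracket_component[OF X Y] left_diff_distrib sum_subtractf)
qed

text \<open>By \<open>along_lie_bracket\<close>, each component is the Jacobi identity for
  commutators of the derivations \<open>along X\<close>.\<close>

lemma lie_bracket_jacobi:
  fixes X Y Z :: "'m::finite vfield"
  assumes X: "smooth_field X" and Y: "smooth_field Y" and Z: "smooth_field Z"
  shows "lie_bracket (lie_bracket X Y) Z = lie_bracket X (lie_bracket Y Z) - lie_bracket Y (lie_bracket X Z)"
proof (rule ext, simp only: vec_eq_iff, rule allI)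
  fix x :: "real^'m" and i :: 'm
  note s = smooth_field_lie_bracket
  note sm = along_smooth smooth_fieldD
  have comp: "(\<lambda>y. lie_bracket X Y y $ i) = (\<lambda>y. along X (\<lambda>y. Y y $ i) y - along Y (\<lambda>y. X y $ i) y)"
    if "smooth_field X" "smooth_field Y" for X Y
    using that by (simp add: lie_bracket_component)
  show "lie_bracket (lie_bracket X Y) Z x $ i
      = (lie_bracket X (lie_bracket Y Z) - lie_bracket Y (lie_bracket X Z)) x $ i"
    using X Y Z
    by (simp add: lie_bracket_component s along_lie_bracket smooth_fieldD comp along_diff sm)
qed

section \<open>The projective algebra in coordinates\<close>

text \<open>The parameters are the components of the grading of sl(m+1): constant, linear and
  quadratic fields. Closure under brackets and the splitting around a point become linear algebra in
  them.\<close>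

definition quad_field :: "real^'m \<Rightarrow> real^'m^'m \<Rightarrow> real^'m \<Rightarrow> 'm::finite vfield" where
  "quad_field v A w = (\<lambda>x. v + A *v x + (w \<bullet> x) *\<^sub>R x)"

lemma scaleR_fun_apply: "(a *\<^sub>R f) x = a *\<^sub>R f x"
  by (simp add: scaleR_fun_def)

lemma sum_fun_apply: "(\<Sum>i\<in>I. f i) x = (\<Sum>i\<in>I. f i x)"
  by (induction I rule: infinite_finite_induct) simp_all

lemma euler_field_eq: "euler_field = (\<lambda>x. x)"
  by (rule ext) (simp add: euler_field_def coord_field_def basis_expansion flip: scalar_mult_eq_scaleR)

lemma quad_field_add: "quad_field v A w + quad_field v' A' w' = quad_field (v + v') (A + A') (w + w')"
  by (rule ext) (simp add: quad_field_def matrix_vector_mult_add_rdistrib inner_add_left algebra_simps)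

lemma quad_field_scale: "a *\<^sub>R quad_field v A w = quad_field (a *\<^sub>R v) (a *\<^sub>R A) (a *\<^sub>R w)"
  by (rule ext) (simp add: quad_field_def scaleR_fun_def algebra_simps scaleR_matrix_vector_assoc)

lemma quad_field_0: "quad_field 0 0 0 = 0"
  by (rule ext) (simp add: quad_field_def)

lemma sl_fields_eq: "sl_fields = {quad_field v A w | v A w. True}" (is "_ = ?Q")
proof
  show "sl_fields \<subseteq> ?Q"
    unfolding sl_fields_def
  proof (rule span_minimal)
    have c: "coord_field i = quad_field (axis i 1) 0 0" for i :: 'a
      by (rule ext) (simp add: coord_field_def quad_field_def)
    have l: "(\<lambda>x. x $ j *\<^sub>R coord_field i x) = quad_field 0 (\<chi> k l. if k = i \<and> l = j then 1 else 0) 0" for i j :: 'a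
      by (rule ext) (auto simp: coord_field_def quad_field_def vec_eq_iff axis_def matrix_vector_mult_def
          if_distrib if_distribR cong: if_cong)
    have q: "(\<lambda>x. x $ j *\<^sub>R euler_field x) = quad_field 0 0 (axis j 1)" for j :: 'a
      by (rule ext) (simp add: euler_field_eq quad_field_def inner_axis inner_commute)
    show "{coord_field i |i. True} \<union> {\<lambda>x. x $ j *\<^sub>R coord_field i x |i j. True}
        \<union> {\<lambda>x. x $ j *\<^sub>R euler_field x |j. True} \<subseteq> ?Q"
      unfolding l q unfolding c by blast
    show "subspace ?Q"
      unfolding subspace_def
    proof (intro conjI ballI allI)
      show "0 \<in> ?Q" using quad_field_0 by (metis (mono_tags, lifting) mem_Collect_eq)
      show "X + Y \<in> ?Q" if "X \<in> ?Q" "Y \<in> ?Q" for X Y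
        using that quad_field_add by blast
      show "a *\<^sub>R X \<in> ?Q" if "X \<in> ?Q" for a X
        using that quad_field_scale by blast
    qed
  qed
next
  show "?Q \<subseteq> sl_fields"
  proof clarify
    fix v :: "real^'a" and A w
    have "quad_field v A w = (\<Sum>i\<in>UNIV. v $ i *\<^sub>R coord_field i)
      + (\<Sum>i\<in>UNIV. \<Sum>j\<in>UNIV. A $ i $ j *\<^sub>R (\<lambda>x. x $ j *\<^sub>R coord_field i x))
      + (\<Sum>j\<in>UNIV. w $ j *\<^sub>R (\<lambda>x. x $ j *\<^sub>R euler_field x))"
    proof (rule ext)
      fix x
      have "(\<Sum>i\<in>UNIV. v $ i *\<^sub>R axis i (1::real)) = v"
        by (simp add: basis_expansion flip: scalar_mult_eq_scaleR)
      moreover have "(\<Sum>i\<in>UNIV. \<Sum>j\<in>UNIV. A $ i $ j *\<^sub>R x $ j *\<^sub>R axis i (1::real)) = A *v x"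
      proof -
        have "(\<Sum>i\<in>UNIV. \<Sum>j\<in>UNIV. A $ i $ j *\<^sub>R x $ j *\<^sub>R axis i (1::real))
          = (\<Sum>i\<in>UNIV. (A *v x) $ i *\<^sub>R axis i 1)"
          by (simp add: matrix_vector_mult_def scaleR_sum_left)
        also have "\<dots> = A *v x" by (simp add: basis_expansion flip: scalar_mult_eq_scaleR)
        finally show ?thesis .
      qed
      moreover have "(\<Sum>j\<in>UNIV. w $ j *\<^sub>R x $ j *\<^sub>R x) = (w \<bullet> x) *\<^sub>R x"
        by (simp add: inner_vec_def scaleR_sum_left)
      ultimately show "quad_field v A w x = ((\<Sum>i\<in>UNIV. v $ i *\<^sub>R coord_field i)
        + (\<Sum>i\<in>UNIV. \<Sum>j\<in>UNIV. A $ i $ j *\<^sub>R (\<lambda>x. x $ j *\<^sub>R coord_field i x))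
        + (\<Sum>j\<in>UNIV. w $ j *\<^sub>R (\<lambda>x. x $ j *\<^sub>R euler_field x))) x"
        by (simp add: sum_fun_apply quad_field_def scaleR_fun_def coord_field_def euler_field_eq)
    qed
    also have "\<dots> \<in> sl_fields"
      unfolding sl_fields_def
      by (intro span_add span_sum span_scale span_base) auto
    finally show "quad_field v A w \<in> sl_fields" .
  qed
qed

lemma smooth_field_quad: "smooth_field (quad_field v A w)"
  unfolding smooth_field_def quad_field_def
  by (auto simp: matrix_vector_mult_def inner_vec_def intro!: smooth_add smooth_sum smooth_mult)

lemma smooth_field_sl: "X \<in> sl_fields \<Longrightarrow> smooth_field X"
  by (auto simp: sl_fields_eq smooth_field_quad)

lemma along_quad_field: "along X (quad_field v A w) x = A *v X x + (w \<bullet> X x) *\<^sub>R x + (w \<bullet> x) *\<^sub>R X x"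
proof -
  define f' where "f' = (\<lambda>h. A *v h + (w \<bullet> h) *\<^sub>R x + (w \<bullet> x) *\<^sub>R h)"
  have A: "((\<lambda>x. A *v x) has_derivative (\<lambda>h. A *v h)) (at x)"
    by (rule bounded_linear_imp_has_derivative) (rule matrix_vector_mul_bounded_linear)
  have d: "(quad_field v A w has_derivative f') (at x)"
    unfolding quad_field_def f'_def by (rule derivative_eq_intros A refl | simp add: algebra_simps)+
  have "along X (quad_field v A w) x = (\<Sum>i\<in>UNIV. X x $ i *\<^sub>R f' (axis i 1))"
    by (simp only: along_def partial_eqI[OF d])
  also have "\<dots> = f' (\<Sum>i\<in>UNIV. X x $ i *\<^sub>R axis i 1)"
    using has_derivative_linear[OF d] by (simp only: linear_sum linear_scale)
  also have "(\<Sum>i\<in>UNIV. X x $ i *\<^sub>R axis i 1) = X x"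
    by (simp add: basis_expansion flip: scalar_mult_eq_scaleR)
  finally show ?thesis by (simp add: f'_def)
qed

text \<open>Quadratic fields commute, since the cubic terms of the two directional derivatives
  agree. The multiple of \<open>mat 1\<close> and the outer products come from bracketing constant
  with quadratic fields.\<close>

lemma lie_bracket_quad:
  "lie_bracket (quad_field v A w) (quad_field v' A' w')
    = quad_field (A' *v v - A *v v')
       (A' ** A - A ** A' + (w' \<bullet> v - w \<bullet> v') *\<^sub>R mat 1 + (\<chi> i j. v $ i * w' $ j) - (\<chi> i j. v' $ i * w $ j))
       (w' v* A - w v* A')"
proof
  fix x
  have o: "(\<chi> i j. v $ i * w $ j) *v x = (w \<bullet> x) *\<^sub>R v" for v w :: "real^'a"
    by (simp add: vec_eq_iff matrix_vector_mult_def inner_vec_def sum_distrib_left mult_ac)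
  have m: "y \<bullet> (w v* A) = w \<bullet> (A *v y)" for w y and A :: "real^'a^'a"
    by (metis inner_commute dot_lmul_matrix)
  show "lie_bracket (quad_field v A w) (quad_field v' A' w') x
    = quad_field (A' *v v - A *v v')
       (A' ** A - A ** A' + (w' \<bullet> v - w \<bullet> v') *\<^sub>R mat 1 + (\<chi> i j. v $ i * w' $ j) - (\<chi> i j. v' $ i * w $ j))
       (w' v* A - w v* A') x"
    unfolding lie_bracket_def along_quad_field
    by (simp add: quad_field_def o matrix_vector_mult_add_rdistrib matrix_vector_mult_diff_rdistrib
        matrix_vector_right_distrib matrix_vector_mult_scaleR scaleR_matrix_vector_assoc[symmetric]
        matrix_vector_mul_assoc[symmetric] inner_add_right inner_diff_left dot_lmul_matrix m
        algebra_simps)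
qed

lemma lie_bracket_sl: "X \<in> sl_fields \<Longrightarrow> Y \<in> sl_fields \<Longrightarrow> lie_bracket X Y \<in> sl_fields"
  unfolding sl_fields_eq using lie_bracket_quad by blast

lemma euler_field_quad: "euler_field = quad_field 0 (mat 1) 0"
  by (rule ext) (simp add: euler_field_eq quad_field_def)

lemma coord_field_quad: "coord_field i = quad_field (axis i 1) 0 0"
  by (rule ext) (simp add: coord_field_def quad_field_def)

lemma euler_field_sl: "euler_field \<in> sl_fields"
  unfolding sl_fields_eq euler_field_quad by blast

lemma coord_field_sl: "coord_field i \<in> sl_fields"
  unfolding sl_fields_eq coord_field_quad by blast

lemma subspace_sl: "subspace sl_fields"
  by (simp add: sl_fields_def)

lemma lie_bracket_lin:
  assumes "X \<in> sl_fields" "Y \<in> sl_fields" "Z \<in> sl_fields"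
  shows "lie_bracket (a *\<^sub>R X + b *\<^sub>R Y) Z = a *\<^sub>R lie_bracket X Z + b *\<^sub>R lie_bracket Y Z"
proof
  fix x
  obtain v A w v' A' w' v'' A'' w''
    where e: "X = quad_field v A w" "Y = quad_field v' A' w'" "Z = quad_field v'' A'' w''"
    using assms by (auto simp: sl_fields_eq)
  have XY: "a *\<^sub>R X + b *\<^sub>R Y = quad_field (a *\<^sub>R v + b *\<^sub>R v') (a *\<^sub>R A + b *\<^sub>R A') (a *\<^sub>R w + b *\<^sub>R w')"
    by (simp add: e quad_field_scale quad_field_add)
  have "along Z (a *\<^sub>R X + b *\<^sub>R Y) x = a *\<^sub>R along Z X x + b *\<^sub>R along Z Y x"
    unfolding XY unfolding e along_quad_field
    by (simp add: matrix_vector_mult_add_rdistrib scaleR_matrix_vector_assoc[symmetric] inner_add_left algebra_simps)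
  moreover have "along (a *\<^sub>R X + b *\<^sub>R Y) Z x = a *\<^sub>R along X Z x + b *\<^sub>R along Y Z x"
    by (simp add: along_def scaleR_fun_def scaleR_sum_right sum.distrib algebra_simps)
  ultimately show "lie_bracket (a *\<^sub>R X + b *\<^sub>R Y) Z x = (a *\<^sub>R lie_bracket X Z + b *\<^sub>R lie_bracket Y Z) x"
    by (simp add: lie_bracket_def scaleR_fun_def algebra_simps)
qed

lemma lie_bracket_antisym: "lie_bracket X Y = - lie_bracket Y X"
  by (rule ext) (simp add: lie_bracket_def)

text \<open>
  The part of a field that is quadratic around the point \<open>x\<close>, written through brackets because
  this is how the homotopy produces it.
\<close>

definition quad_part :: "real^'m \<Rightarrow> 'm::finite vfield \<Rightarrow> 'm vfield" where
  "quad_part x X = lie_bracket euler_field X - (\<Sum>i\<in>UNIV. x $ i *\<^sub>R lie_bracket (coord_field i) X)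
     + (\<Sum>i\<in>UNIV. X x $ i *\<^sub>R coord_field i)"

text \<open>The bracket with the Euler field centred at \<open>x\<close> multiplies the constant,
  linear and quadratic parts around \<open>x\<close> by -1, 0 and 1. The last sum in
  \<open>quad_part\<close>, the value of the field at \<open>x\<close>, adds the constant part back,
  so only the quadratic part survives.\<close>

lemma quad_part_quad: "quad_part x (quad_field v A w) = (\<lambda>y. (w \<bullet> (y - x)) *\<^sub>R (y - x))"
proof
  fix y
  let ?X = "quad_field v A w"
  have exp: "(\<Sum>i\<in>UNIV. z $ i *\<^sub>R axis i (1::real)) = z" for z :: "real^'a"
    by (simp add: basis_expansion flip: scalar_mult_eq_scaleR)
  let ?f = "\<lambda>h. A *v h + (w \<bullet> h) *\<^sub>R y + (w \<bullet> y) *\<^sub>R h"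
  have lin: "linear ?f"
    by (rule linearI) (simp_all add: matrix_vector_right_distrib inner_add_right matrix_vector_mult_scaleR algebra_simps)
  have c: "lie_bracket (coord_field i) ?X y = ?f (axis i 1)" for i
    unfolding lie_bracket_def coord_field_quad along_quad_field by (simp add: quad_field_def)
  have "(\<Sum>i\<in>UNIV. x $ i *\<^sub>R lie_bracket (coord_field i) ?X y) = ?f (\<Sum>i\<in>UNIV. x $ i *\<^sub>R axis i 1)"
    unfolding c by (simp only: linear_sum[OF lin] linear_scale[OF lin])
  then have 1: "(\<Sum>i\<in>UNIV. x $ i *\<^sub>R lie_bracket (coord_field i) ?X y) = ?f x"
    by (simp only: exp)
  have 2: "lie_bracket euler_field ?X y = - v + (w \<bullet> y) *\<^sub>R y"
    unfolding lie_bracket_def euler_field_quad along_quad_field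
    by (simp add: quad_field_def algebra_simps)
  have 3: "(\<Sum>i\<in>UNIV. ?X x $ i *\<^sub>R coord_field i y) = ?X x"
    by (simp add: coord_field_def exp)
  show "quad_part x ?X y = (w \<bullet> (y - x)) *\<^sub>R (y - x)"
    unfolding quad_part_def
    by (simp add: sum_fun_apply scaleR_fun_def 1 2 3)
      (simp add: quad_field_def inner_diff_right algebra_simps)
qed

lemma quad_part_sl: "X \<in> sl_fields \<Longrightarrow> quad_part x X \<in> sl_fields"
  unfolding quad_part_def
  by (intro subspace_add[OF subspace_sl] subspace_diff[OF subspace_sl] subspace_sum[OF subspace_sl]
      subspace_scale[OF subspace_sl] lie_bracket_sl euler_field_sl coord_field_sl)

text \<open>Re-expansion around the origin. The coefficient \<open>w\<close> is unchanged, and by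
  \<open>quad_part_quad\<close> it alone determines the quadratic part; idempotence follows.\<close>

lemma quad_part_quad_field:
  "quad_part x (quad_field v A w) = quad_field ((w \<bullet> x) *\<^sub>R x) (- (w \<bullet> x) *\<^sub>R mat 1 - (\<chi> i j. x $ i * w $ j)) w"
proof
  fix y
  have o: "(\<chi> i j. x $ i * w $ j) *v y = (w \<bullet> y) *\<^sub>R x"
    by (simp add: vec_eq_iff matrix_vector_mult_def inner_vec_def sum_distrib_left mult_ac)
  have n: "(- M) *v y = - (M *v y)" for M :: "real^'a^'a"
    by (simp add: vec_eq_iff matrix_vector_mult_def sum_negf)
  show "quad_part x (quad_field v A w) y
      = quad_field ((w \<bullet> x) *\<^sub>R x) (- (w \<bullet> x) *\<^sub>R mat 1 - (\<chi> i j. x $ i * w $ j)) w y"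
    unfolding quad_part_quad unfolding quad_field_def matrix_vector_mult_diff_rdistrib o
    by (simp add: n scaleR_matrix_vector_assoc[symmetric] inner_diff_right algebra_simps)
qed

lemma quad_part_idem:
  assumes "X \<in> sl_fields" shows "quad_part x (quad_part x X) = quad_part x X"
proof -
  obtain v A w where X: "X = quad_field v A w" using assms by (auto simp: sl_fields_eq)
  obtain v' A' where Y: "quad_part x X = quad_field v' A' w"
    unfolding X quad_part_quad_field by blast
  have "quad_part x (quad_part x X) = quad_part x (quad_field v' A' w)" by (simp only: Y)
  also have "\<dots> = quad_part x X" by (simp only: X quad_part_quad)
  finally show ?thesis .
qed

lemma quad_part_diff:
  assumes "X \<in> sl_fields" shows "quad_part x (X - quad_part x X) = 0"
proof -
  obtain v A w where X: "X = quad_field v A w" using assms by (auto simp: sl_fields_eq)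
  obtain v' A' where Y: "quad_part x X = quad_field v' A' w"
    unfolding X quad_part_quad_field by blast
  have "X - quad_part x X = quad_field v A w + (-1) *\<^sub>R quad_field v' A' w"
    unfolding Y by (simp add: X)
  also have "\<dots> = quad_field (v + - v') (A + - A') 0"
    unfolding quad_field_scale quad_field_add by simp
  finally have e: "X - quad_part x X = quad_field (v + - v') (A + - A') 0" .
  show ?thesis unfolding e quad_part_quad by (simp add: fun_eq_iff)
qed

section \<open>Lie derivatives of tensor fields\<close>

lemma gl_rep_add: "gl_rep A (\<lambda>I. S I + T I) I = gl_rep A S I + gl_rep A T I"
  by (simp add: gl_rep_def sum.distrib algebra_simps)

lemma gl_rep_diff: "gl_rep A (\<lambda>I. S I - T I) I = gl_rep A S I - gl_rep A T I"
  by (simp add: gl_rep_def sum_subtractf algebra_simps)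

lemma gl_rep_cmult: "gl_rep A (\<lambda>I. c * T I) I = c * gl_rep A T I"
  by (simp add: gl_rep_def sum_distrib_left mult_ac)

lemma gl_rep_add_left: "gl_rep (A + B) T I = gl_rep A T I + gl_rep B T I"
  by (simp add: gl_rep_def sum.distrib algebra_simps)

lemma gl_rep_diff_left: "gl_rep (A - B) T I = gl_rep A T I - gl_rep B T I"
  by (simp add: gl_rep_def sum_subtractf algebra_simps)

lemma gl_rep_cmult_left: "gl_rep (c *\<^sub>R A) T I = c * gl_rep A T I"
  by (simp add: gl_rep_def sum_distrib_left mult_ac)

lemma gl_rep_mat_1: "gl_rep (mat 1) T I = real (length I) * T I"
proof -
  have "(\<Sum>j\<in>UNIV. mat 1 $ (I ! r) $ j * T (I[r := j])) = T I" for r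
    by (simp add: mat_def if_distrib if_distribR cong: if_cong)
  then show ?thesis by (simp add: gl_rep_def)
qed

text \<open>In a product of two derivations, the terms that act on different slots are the same in
  either order and cancel; those that act twice on one slot give the matrix product.\<close>

lemma gl_rep_commutator:
  "gl_rep A (gl_rep B T) I - gl_rep B (gl_rep A T) I = gl_rep (A ** B - B ** A) T I"
proof -
  let ?n = "length I"
  define off where "off A B r s = (\<Sum>j\<in>UNIV. \<Sum>l\<in>UNIV. A $ (I ! r) $ j * (B $ (I ! s) $ l * T (I[r := j, s := l])))"
    for A B :: "real^'a^'a" and r s
  have AB: "gl_rep A (gl_rep B T) I = gl_rep (A ** B) T I + (\<Sum>r<?n. \<Sum>s\<in>{..<?n} - {r}. off A B r s)"
    for A B
  proof -
    have "(\<Sum>j\<in>UNIV. A $ (I ! r) $ j * gl_rep B T (I[r := j]))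
        = (\<Sum>j\<in>UNIV. (A ** B) $ (I ! r) $ j * T (I[r := j])) + (\<Sum>s\<in>{..<?n} - {r}. off A B r s)"
      if r: "r < ?n" for r
    proof -
      have "gl_rep B T (I[r := j]) = (\<Sum>l\<in>UNIV. B $ j $ l * T (I[r := l]))
          + (\<Sum>s\<in>{..<?n} - {r}. \<Sum>l\<in>UNIV. B $ (I ! s) $ l * T (I[r := j, s := l]))" for j
        unfolding gl_rep_def using r by (simp add: sum.remove[of _ r])
      then have "(\<Sum>j\<in>UNIV. A $ (I ! r) $ j * gl_rep B T (I[r := j]))
          = (\<Sum>j\<in>UNIV. \<Sum>l\<in>UNIV. A $ (I ! r) $ j * (B $ j $ l * T (I[r := l])))
          + (\<Sum>j\<in>UNIV. \<Sum>s\<in>{..<?n} - {r}. \<Sum>l\<in>UNIV. A $ (I ! r) $ j * (B $ (I ! s) $ l * T (I[r := j, s := l])))"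
        by (simp add: distrib_left sum.distrib sum_distrib_left)
      also have "(\<Sum>j\<in>UNIV. \<Sum>l\<in>UNIV. A $ (I ! r) $ j * (B $ j $ l * T (I[r := l])))
          = (\<Sum>l\<in>UNIV. (A ** B) $ (I ! r) $ l * T (I[r := l]))"
        by (subst sum.swap) (simp add: matrix_matrix_mult_def sum_distrib_right sum_distrib_left mult_ac)
      also have "(\<Sum>j\<in>UNIV. \<Sum>s\<in>{..<?n} - {r}. \<Sum>l\<in>UNIV. A $ (I ! r) $ j * (B $ (I ! s) $ l * T (I[r := j, s := l])))
          = (\<Sum>s\<in>{..<?n} - {r}. off A B r s)"
        unfolding off_def by (rule sum.swap)
      finally show ?thesis .
    qed
    then show ?thesis by (simp add: gl_rep_def[of A] gl_rep_def[of "A ** B"] sum.distrib)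
  qed
  have swap: "off A B r s = off B A s r" if "r \<noteq> s" for r s
    unfolding off_def using that by (subst sum.swap) (simp add: list_update_swap mult_ac)
  \<comment> \<open>Off-diagonal sums become sums over a full square with 0 on the diagonal, so that
    the order of summation can be exchanged.\<close>
  have drop: "(\<Sum>s\<in>{..<?n} - {r}. h s) = (\<Sum>s<?n. if r = s then 0 else h s)" for h :: "nat \<Rightarrow> real" and r
    by (rule sum.mono_neutral_cong_left) auto
  have "(\<Sum>r<?n. \<Sum>s<?n. if r = s then 0 else off A B r s) = (\<Sum>r<?n. \<Sum>s<?n. if r = s then 0 else off B A r s)"
    by (subst sum.swap) (intro sum.cong refl, simp add: swap)
  then show ?thesis by (simp add: AB gl_rep_diff_left drop)
qed

text \<open>The value is rewritten as a sum over the multiset of indices, with an arbitrary word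
  chosen for each updated multiset. It then visibly depends on \<open>mset I\<close> only.\<close>

lemma gl_rep_sym_tensors:
  assumes T: "T \<in> sym_tensors k" shows "gl_rep A T \<in> sym_tensors k"
proof -
  have sym: "T I = T J" if "mset I = mset J" for I J
    using T that unfolding sym_tensors_def by blast
  have ms: "gl_rep A T I = (\<Sum>a\<in>#mset I. \<Sum>j\<in>UNIV. A $ a $ j * T (SOME J. mset J = add_mset j (mset I - {#a#})))"
    for I
  proof -
    let ?F = "\<lambda>a. \<Sum>j\<in>UNIV. A $ a $ j * T (SOME J. mset J = add_mset j (mset I - {#a#}))"
    have "T (I[r := j]) = T (SOME J. mset J = add_mset j (mset I - {#I ! r#}))" if "r < length I" for r j
    proof (rule sym)
      have "mset (SOME J. mset J = add_mset j (mset I - {#I ! r#})) = add_mset j (mset I - {#I ! r#})"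
        using mset_update[OF that] by (rule someI)
      then show "mset (I[r := j]) = mset (SOME J. mset J = add_mset j (mset I - {#I ! r#}))"
        by (simp only: mset_update[OF that])
    qed
    then have "gl_rep A T I = (\<Sum>r<length I. ?F (I ! r))"
      unfolding gl_rep_def by (intro sum.cong refl) simp
    also have "\<dots> = sum_list (map ?F I)"
      unfolding sum_list_sum_nth atLeast0LessThan length_map by (intro sum.cong refl) simp
    finally show ?thesis by (simp only: sum_mset_sum_list[symmetric] mset_map)
  qed
  have "gl_rep A T I = gl_rep A T J" if "mset I = mset J" for I J
    by (simp only: ms that)
  moreover have "gl_rep A T I = 0" if "length I \<noteq> k" for I
    using T that unfolding sym_tensors_def gl_rep_def by simp
  ultimately show ?thesis unfolding sym_tensors_def by blast
qed

section \<open>The Lie derivative as a representation of smooth vector fields\<close>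

lemma sym_tensor_fields_smooth: "P \<in> sym_tensor_fields p \<Longrightarrow> smooth (\<lambda>x. P x I)"
  by (simp add: sym_tensor_fields_def)

lemma gl_rep_smooth:
  assumes "\<And>i j. smooth (\<lambda>x. A x $ i $ j)" "\<And>I. smooth (\<lambda>x. P x I)"
  shows "smooth (\<lambda>x. gl_rep (A x) (P x) I)"
  unfolding gl_rep_def by (intro smooth_sum smooth_mult assms)

lemma smooth_jacobian: "smooth_field X \<Longrightarrow> smooth (\<lambda>x. jacobian X (at x) $ i $ j)"
  by (simp add: jacobian_partial smooth_partial smooth_fieldD)

lemma smooth_trace_jacobian: "smooth_field X \<Longrightarrow> smooth (\<lambda>x. trace (jacobian X (at x)))"
  unfolding trace_def by (intro smooth_sum smooth_jacobian)

lemma smooth_lie_deriv: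
  assumes X: "smooth_field X" and P: "\<And>I. smooth (\<lambda>x. P x I)"
  shows "smooth (\<lambda>x. lie_deriv \<delta> X P x I)"
  unfolding lie_deriv_def
  by (intro smooth_add smooth_diff smooth_mult along_smooth X P gl_rep_smooth smooth_jacobian smooth_trace_jacobian smooth_const)

lemma sym_tensorsI:
  "(\<And>I. length I \<noteq> k \<Longrightarrow> T I = 0) \<Longrightarrow> (\<And>I J. mset I = mset J \<Longrightarrow> T I = T J) \<Longrightarrow> T \<in> sym_tensors k"
  unfolding sym_tensors_def by blast

lemma sym_tensorsD:
  assumes "T \<in> sym_tensors k"
  shows "length I \<noteq> k \<Longrightarrow> T I = 0" and "mset I = mset J \<Longrightarrow> T I = T J"
  using assms unfolding sym_tensors_def by blast+

lemma subspace_sym_tensors: "subspace (sym_tensors k)"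
  unfolding subspace_def
proof (intro conjI ballI allI)
  show "0 \<in> sym_tensors k" by (rule sym_tensorsI) simp_all
  show "S + T \<in> sym_tensors k" if S: "S \<in> sym_tensors k" and T: "T \<in> sym_tensors k" for S T
  proof (rule sym_tensorsI)
    show "(S + T) I = 0" if "length I \<noteq> k" for I
      using sym_tensorsD(1)[OF S that] sym_tensorsD(1)[OF T that] by simp
    show "(S + T) I = (S + T) J" if "mset I = mset J" for I J
      using sym_tensorsD(2)[OF S that] sym_tensorsD(2)[OF T that] by simp
  qed
  show "c *\<^sub>R T \<in> sym_tensors k" if T: "T \<in> sym_tensors k" for c T
  proof (rule sym_tensorsI)
    show "(c *\<^sub>R T) I = 0" if "length I \<noteq> k" for I
      using sym_tensorsD(1)[OF T that] by (simp add: scaleR_fun_apply)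
    show "(c *\<^sub>R T) I = (c *\<^sub>R T) J" if "mset I = mset J" for I J
      using sym_tensorsD(2)[OF T that] by (simp add: scaleR_fun_apply)
  qed
qed

lemma lie_deriv_sym_tensor_fields:
  assumes X: "smooth_field X" and P: "P \<in> sym_tensor_fields p"
  shows "lie_deriv \<delta> X P \<in> sym_tensor_fields p"
proof -
  have sm: "smooth (\<lambda>x. P x I)" for I using P by (rule sym_tensor_fields_smooth)
  have T: "P x \<in> sym_tensors p" for x using P by (simp add: sym_tensor_fields_def)
  have "(\<lambda>I. along X (\<lambda>y. P y I) x) \<in> sym_tensors p" for x
  proof -
    have "(\<lambda>y. P y I) = (\<lambda>y. 0)" if "length I \<noteq> p" for I
      using T that unfolding sym_tensors_def by blast
    then have "along X (\<lambda>y. P y I) x = 0" if "length I \<noteq> p" for I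
      using that by (simp add: along_const)
    moreover have "(\<lambda>y. P y I) = (\<lambda>y. P y J)" if "mset I = mset J" for I J
      using T that unfolding sym_tensors_def by blast
    then have "along X (\<lambda>y. P y I) x = along X (\<lambda>y. P y J) x" if "mset I = mset J" for I J
      using that by (intro arg_cong[of _ _ "\<lambda>f. along X f x"])
    ultimately show ?thesis unfolding sym_tensors_def by blast
  qed
  moreover have "lie_deriv \<delta> X P x = (\<lambda>I. along X (\<lambda>y. P y I) x) - gl_rep (jacobian X (at x)) (P x)
      + (\<delta> * trace (jacobian X (at x))) *\<^sub>R P x" for x
    by (simp add: lie_deriv_def fun_eq_iff scaleR_fun_def)
  ultimately have "lie_deriv \<delta> X P x \<in> sym_tensors p" for x
    by (simp only:) (intro subspace_add[OF subspace_sym_tensors] subspace_diff[OF subspace_sym_tensors]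
        subspace_scale[OF subspace_sym_tensors] gl_rep_sym_tensors T)
  then show ?thesis
    using smooth_lie_deriv[OF X, of P] sm by (simp add: sym_tensor_fields_def)
qed

lemma along_gl_rep:
  assumes A: "\<And>i j. smooth (\<lambda>x. A x $ i $ j)" and P: "\<And>I. smooth (\<lambda>x. P x I)"
  shows "along X (\<lambda>y. gl_rep (A y) (P y) I) x = gl_rep (\<chi> i j. along X (\<lambda>y. A y $ i $ j) x) (P x) I
    + gl_rep (A x) (\<lambda>I. along X (\<lambda>y. P y I) x) I"
  unfolding gl_rep_def
  by (simp add: along_sum along_mult smooth_sum smooth_mult A P sum.distrib)

text \<open>The Leibniz rule for \<open>partial j\<close> of \<open>along X\<close>: the first-order
  products form the matrix products, and in the other terms \<open>partial_commute\<close> moves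
  \<open>partial j\<close> past \<open>along X\<close>.\<close>

lemma jacobian_lie_bracket:
  assumes X: "smooth_field X" and Y: "smooth_field Y"
  shows "jacobian (lie_bracket X Y) (at x) = jacobian Y (at x) ** jacobian X (at x) - jacobian X (at x) ** jacobian Y (at x)
    + (\<chi> i j. along X (\<lambda>y. jacobian Y (at y) $ i $ j) x) - (\<chi> i j. along Y (\<lambda>y. jacobian X (at y) $ i $ j) x)"
proof -
  have 1: "partial j (along X (\<lambda>y. Y y $ i)) x
      = (\<Sum>k\<in>UNIV. partial k (\<lambda>y. Y y $ i) x * partial j (\<lambda>y. X y $ k) x) + along X (partial j (\<lambda>y. Y y $ i)) x"
    if X: "smooth_field X" and Y: "smooth_field Y" for X Y :: "'a vfield" and i j
  proof -
    have "partial j (along X (\<lambda>y. Y y $ i)) x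
      = (\<Sum>k\<in>UNIV. X x $ k * partial j (partial k (\<lambda>y. Y y $ i)) x + partial j (\<lambda>y. X y $ k) x * partial k (\<lambda>y. Y y $ i) x)"
      unfolding along_real[abs_def] using X Y
      by (simp add: partial_sum partial_mult smooth_mult smooth_partial smooth_fieldD)
    then show ?thesis
      using Y by (simp add: along_real sum.distrib mult_ac partial_commute[OF smooth_fieldD, of Y j])
  qed
  have c: "(\<lambda>y. lie_bracket X Y y $ i) = (\<lambda>y. along X (\<lambda>y. Y y $ i) y - along Y (\<lambda>y. X y $ i) y)" for i
    by (simp add: lie_bracket_component X Y)
  have "jacobian (lie_bracket X Y) (at x) $ i $ j =
      partial j (along X (\<lambda>y. Y y $ i)) x - partial j (along Y (\<lambda>y. X y $ i)) x" for i j
    by (simp add: jacobian_partial smooth_field_lie_bracket X Y c partial_diff along_smooth smooth_fieldD)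
  then show ?thesis
    by (simp add: vec_eq_iff 1 X Y jacobian_partial matrix_matrix_mult_def)
qed

text \<open>Terms symmetric in \<open>X\<close> and \<open>Y\<close> cancel. The others are matched
  by \<open>along_lie_bracket\<close>, \<open>gl_rep_commutator\<close> and
  \<open>jacobian_lie_bracket\<close>. A commutator of Jacobians has trace 0, so the density term
  only meets derivatives of Jacobians.\<close>

lemma lie_deriv_lie_bracket:
  assumes X: "smooth_field X" and Y: "smooth_field Y" and P: "\<And>I. smooth (\<lambda>x. P x I)"
  shows "lie_deriv \<delta> (lie_bracket X Y) P = lie_deriv \<delta> X (lie_deriv \<delta> Y P) - lie_deriv \<delta> Y (lie_deriv \<delta> X P)"
proof (intro ext)
  fix x I
  let ?J = "\<lambda>X. jacobian X (at x)" and ?d = "\<lambda>X I. along X (\<lambda>y. P y I) x"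
  let ?DJ = "\<lambda>X Y. \<chi> i j. along X (\<lambda>y. jacobian Y (at y) $ i $ j) x"
  have XY: "lie_deriv \<delta> X (lie_deriv \<delta> Y P) x I = along X (along Y (\<lambda>y. P y I)) x
      - gl_rep (?DJ X Y) (P x) I - gl_rep (?J Y) (?d X) I
      + \<delta> * trace (?DJ X Y) * P x I + \<delta> * trace (?J Y) * ?d X I
      - gl_rep (?J X) (?d Y) I + gl_rep (?J X) (gl_rep (?J Y) (P x)) I - \<delta> * trace (?J Y) * gl_rep (?J X) (P x) I
      + \<delta> * trace (?J X) * (?d Y I - gl_rep (?J Y) (P x) I + \<delta> * trace (?J Y) * P x I)"
    if X: "smooth_field X" and Y: "smooth_field Y" for X Y
  proof -
    have tr: "along X (\<lambda>y. trace (jacobian Y (at y))) x = trace (?DJ X Y)"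
      unfolding trace_def using Y by (simp add: along_sum smooth_jacobian)
    have sm: "smooth (along Y (\<lambda>y. P y I))" "smooth (\<lambda>y. gl_rep (jacobian Y (at y)) (P y) I)"
      "smooth (\<lambda>y. trace (jacobian Y (at y)))" for I
      by (intro along_smooth gl_rep_smooth smooth_jacobian smooth_trace_jacobian X Y P)+
    have 1: "along X (\<lambda>y. lie_deriv \<delta> Y P y I) x = along X (along Y (\<lambda>y. P y I)) x
      - (gl_rep (?DJ X Y) (P x) I + gl_rep (?J Y) (?d X) I)
      + (\<delta> * trace (?J Y) * ?d X I + \<delta> * trace (?DJ X Y) * P x I)"
      unfolding lie_deriv_def
      by (simp add: along_add along_diff along_mult along_cmult smooth_diff smooth_mult smooth_cmult sm P
          along_gl_rep along_const smooth_jacobian Y tr)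
    have 2: "gl_rep (?J X) (lie_deriv \<delta> Y P x) I
      = gl_rep (?J X) (?d Y) I - gl_rep (?J X) (gl_rep (?J Y) (P x)) I + \<delta> * trace (?J Y) * gl_rep (?J X) (P x) I"
      unfolding lie_deriv_def by (simp only: gl_rep_add gl_rep_diff gl_rep_cmult)
    show ?thesis
      unfolding lie_deriv_def[of \<delta> X "lie_deriv \<delta> Y P"] 1 2
      by (simp add: lie_deriv_def)
  qed
  have "trace (?J Y ** ?J X) = trace (?J X ** ?J Y)" by (rule trace_mul_sym)
  then have tr: "trace (jacobian (lie_bracket X Y) (at x)) = trace (?DJ X Y) - trace (?DJ Y X)"
    by (simp add: jacobian_lie_bracket X Y trace_add trace_sub)
  have rep: "gl_rep (jacobian (lie_bracket X Y) (at x)) (P x) I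
      = gl_rep (?J Y) (gl_rep (?J X) (P x)) I - gl_rep (?J X) (gl_rep (?J Y) (P x)) I
        + gl_rep (?DJ X Y) (P x) I - gl_rep (?DJ Y X) (P x) I"
    by (simp add: jacobian_lie_bracket X Y gl_rep_add_left gl_rep_diff_left[of _ "?DJ Y X"] gl_rep_commutator)
  show "lie_deriv \<delta> (lie_bracket X Y) P x I
    = (lie_deriv \<delta> X (lie_deriv \<delta> Y P) - lie_deriv \<delta> Y (lie_deriv \<delta> X P)) x I"
    by (simp add: XY X Y lie_deriv_def[of \<delta> "lie_bracket X Y"] along_lie_bracket P tr rep algebra_simps)
qed

lemma lie_deriv_lin:
  assumes P: "\<And>I. smooth (\<lambda>x. P x I)" and Q: "\<And>I. smooth (\<lambda>x. Q x I)"
  shows "lie_deriv \<delta> X (a *\<^sub>R P + b *\<^sub>R Q) = a *\<^sub>R lie_deriv \<delta> X P + b *\<^sub>R lie_deriv \<delta> X Q"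
proof (intro ext)
  fix x I
  have "gl_rep A ((a *\<^sub>R P + b *\<^sub>R Q) x) I = a * gl_rep A (P x) I + b * gl_rep A (Q x) I" for A
    unfolding gl_rep_cmult[symmetric] gl_rep_add[symmetric]
    by (rule arg_cong[of _ _ "\<lambda>T. gl_rep A T I"]) (simp add: fun_eq_iff scaleR_fun_def)
  then show "lie_deriv \<delta> X (a *\<^sub>R P + b *\<^sub>R Q) x I = (a *\<^sub>R lie_deriv \<delta> X P + b *\<^sub>R lie_deriv \<delta> X Q) x I"
    using P Q by (simp add: lie_deriv_def scaleR_fun_def along_add along_cmult smooth_cmult algebra_simps)
qed

lemma lie_deriv_lin_left:
  assumes X: "smooth_field X" and Y: "smooth_field Y"
  shows "lie_deriv \<delta> (a *\<^sub>R X + b *\<^sub>R Y) P = a *\<^sub>R lie_deriv \<delta> X P + b *\<^sub>R lie_deriv \<delta> Y P"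
proof (intro ext)
  fix x I
  have "smooth_field (a *\<^sub>R X + b *\<^sub>R Y)"
    using X Y by (simp add: smooth_field_def scaleR_fun_def smooth_add smooth_cmult)
  then have J: "jacobian (a *\<^sub>R X + b *\<^sub>R Y) (at x) = a *\<^sub>R jacobian X (at x) + b *\<^sub>R jacobian Y (at x)"
    using X Y by (simp add: vec_eq_iff jacobian_partial scaleR_fun_def partial_add partial_cmult smooth_cmult smooth_fieldD)
  have "along (a *\<^sub>R X + b *\<^sub>R Y) f x = a * along X f x + b * along Y f x" for f :: "real^'a \<Rightarrow> real"
    by (simp add: along_real scaleR_fun_def sum.distrib sum_distrib_left algebra_simps)
  moreover have "trace (c *\<^sub>R A) = c * trace A" for c and A :: "real^'a^'a"
    by (simp add: trace_def sum_distrib_left)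
  ultimately show "lie_deriv \<delta> (a *\<^sub>R X + b *\<^sub>R Y) P x I = (a *\<^sub>R lie_deriv \<delta> X P + b *\<^sub>R lie_deriv \<delta> Y P) x I"
    by (simp add: lie_deriv_def J gl_rep_add_left gl_rep_cmult_left trace_add scaleR_fun_apply algebra_simps)
qed

lemma lie_deriv_mult:
  assumes f: "smooth f" and P: "\<And>I. smooth (\<lambda>x. P x I)"
  shows "lie_deriv \<delta> X (\<lambda>x I. f x * P x I) = (\<lambda>x I. f x * lie_deriv \<delta> X P x I + along X f x * P x I)"
  by (intro ext) (simp add: lie_deriv_def along_mult f P gl_rep_cmult algebra_simps)

section \<open>Differential operators\<close>

lemma partials_Nil [simp]: "partials [] f = f"
  by (simp add: partials_def)

lemma partials_Cons [simp]: "partials (a # \<alpha>) f = partial a (partials \<alpha> f)"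
  by (simp add: partials_def)

lemma smooth_partials: "smooth f \<Longrightarrow> smooth (partials \<alpha> f)"
  by (induction \<alpha>) (simp_all add: smooth_partial)

lemma partials_partial: "smooth f \<Longrightarrow> partials \<alpha> (partial i f) = partial i (partials \<alpha> f)"
  by (induction \<alpha>) (simp_all add: partial_commute smooth_partials)

lemma partials_add: "smooth f \<Longrightarrow> smooth g \<Longrightarrow>
    partials \<alpha> (\<lambda>x. f x + g x) = (\<lambda>x. partials \<alpha> f x + partials \<alpha> g x)"
  by (induction \<alpha>) (simp_all add: partial_add smooth_partials)

lemma partials_diff: "smooth f \<Longrightarrow> smooth g \<Longrightarrow>
    partials \<alpha> (\<lambda>x. f x - g x) = (\<lambda>x. partials \<alpha> f x - partials \<alpha> g x)"
  by (induction \<alpha>) (simp_all add: partial_diff smooth_partials)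

lemma partials_cmult: "smooth f \<Longrightarrow> partials \<alpha> (\<lambda>x. c * f x) = (\<lambda>x. c * partials \<alpha> f x)"
  by (induction \<alpha>) (simp_all add: partial_cmult smooth_partials)

lemma partials_0: "partials \<alpha> (\<lambda>x. 0) = (\<lambda>x. 0)"
  by (induction \<alpha>) (simp_all add: partial_const)

text \<open>Each partial derivative passes the Euler field at the cost of itself, as the commutator
  of \<open>partial a\<close> with \<open>along euler_field\<close> is \<open>partial a\<close>. The
  term with \<open>length \<alpha>\<close> is how the order of an operator enters its
  eigenvalue.\<close>

lemma partials_euler:
  assumes f: "smooth f"
  shows "partials \<alpha> (along euler_field f) = (\<lambda>x. (\<Sum>i\<in>UNIV. x $ i * partial i (partials \<alpha> f) x) + real (length \<alpha>) * partials \<alpha> f x)"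
proof (induction \<alpha>)
  case Nil
  then show ?case by (simp add: along_real[abs_def] euler_field_eq)
next
  case (Cons a \<alpha>)
  have sm: "smooth (partials \<alpha> f)" "smooth (partial i (partials \<alpha> f))" for i
    using f by (simp_all add: smooth_partials smooth_partial)
  have "partials (a # \<alpha>) (along euler_field f) = (\<lambda>x. (\<Sum>i\<in>UNIV. x $ i * partial a (partial i (partials \<alpha> f)) x
      + (if a = i then 1 else 0) * partial i (partials \<alpha> f) x) + real (length \<alpha>) * partial a (partials \<alpha> f) x)"
    by (simp add: Cons partial_add partial_sum partial_mult partial_cmult partial_const partial_coord sm smooth_sum smooth_mult smooth_cmult)
  also have "\<dots> = (\<lambda>x. (\<Sum>i\<in>UNIV. x $ i * partial i (partials (a # \<alpha>) f) x) + real (length (a # \<alpha>)) * partials (a # \<alpha>) f x)"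
  proof
    fix x
    have "(\<Sum>i\<in>UNIV. (if a = i then 1 else 0) * partial i (partials \<alpha> f) x) = partial a (partials \<alpha> f) x"
      by (simp add: if_distrib if_distribR cong: if_cong)
    then show "(\<Sum>i\<in>UNIV. x $ i * partial a (partial i (partials \<alpha> f)) x
        + (if a = i then 1 else 0) * partial i (partials \<alpha> f) x) + real (length \<alpha>) * partial a (partials \<alpha> f) x
      = (\<Sum>i\<in>UNIV. x $ i * partial i (partials (a # \<alpha>) f) x) + real (length (a # \<alpha>)) * partials (a # \<alpha>) f x"
      by (simp add: sum.distrib partial_commute[OF sm(1), of a] distrib_right)
  qed
  finally show ?case .
qed

lemma finite_words: "finite {\<alpha> :: 'm::finite list. length \<alpha> \<le> k}" "finite {\<alpha> :: 'm::finite list. length \<alpha> = k}"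
  using finite_lists_length_le[of "UNIV :: 'm set" k] finite_lists_length_eq[of "UNIV :: 'm set" k] by simp_all

text \<open>A scalar-valued differential operator of order at most \<open>k\<close>, not a
  differential form. A single component of a tensor operator, or one summand of it, need not extend
  to an operator with symmetric values, so the closure properties are proved at this level.\<close>

definition diff_form :: "nat \<Rightarrow> nat \<Rightarrow> ('m::finite tfield \<Rightarrow> real^'m \<Rightarrow> real) \<Rightarrow> bool" where
  "diff_form k p Q \<longleftrightarrow> (\<exists>A :: 'm list \<Rightarrow> real^'m \<Rightarrow> 'm list \<Rightarrow> real. (\<forall>\<alpha> I. smooth (\<lambda>x. A \<alpha> x I)) \<and>
     (\<forall>P \<in> sym_tensor_fields p. \<forall>x. Q P x =
        (\<Sum>\<alpha> | length \<alpha> \<le> k. \<Sum>I | length I = p. A \<alpha> x I * partials \<alpha> (\<lambda>y. P y I) x)))"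

lemma diff_formI:
  assumes "\<And>\<alpha> I. smooth (\<lambda>x. A \<alpha> x I)"
    and "\<And>P x. P \<in> sym_tensor_fields p \<Longrightarrow>
       Q P x = (\<Sum>\<alpha> | length \<alpha> \<le> k. \<Sum>I | length I = p. A \<alpha> x I * partials \<alpha> (\<lambda>y. P y I) x)"
  shows "diff_form k p Q"
  unfolding diff_form_def by (intro exI[of _ A] conjI allI ballI assms)

lemma diff_ops_coeffs:
  assumes "D \<in> diff_ops_le k p q"
  shows "\<exists>A :: 'm list \<Rightarrow> real^'m::finite \<Rightarrow> 'm list \<Rightarrow> 'm list \<Rightarrow> real. (\<forall>\<alpha> J I. smooth (\<lambda>x. A \<alpha> x J I)) \<and>
      (\<forall>P \<in> sym_tensor_fields p. \<forall>x J. length J = q \<longrightarrow>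
        D P x J = (\<Sum>\<alpha> | length \<alpha> \<le> k. \<Sum>I | length I = p. A \<alpha> x J I * partials \<alpha> (\<lambda>y. P y I) x))"
  using assms unfolding diff_ops_le_def mem_Collect_eq by (elim conjE)

lemma diff_ops_leD:
  assumes D: "D \<in> diff_ops_le k p q"
  shows "P \<in> sym_tensor_fields p \<Longrightarrow> D P \<in> sym_tensor_fields q"
    and "P \<notin> sym_tensor_fields p \<Longrightarrow> D P = 0"
    and "length J = q \<Longrightarrow> diff_form k p (\<lambda>P x. D P x J)"
proof -
  show "P \<in> sym_tensor_fields p \<Longrightarrow> D P \<in> sym_tensor_fields q" "P \<notin> sym_tensor_fields p \<Longrightarrow> D P = 0"
    using D unfolding diff_ops_le_def mem_Collect_eq by (elim conjE, simp)+
  obtain A where A0: "(\<forall>\<alpha> J I. smooth (\<lambda>x. A \<alpha> x J I)) \<and>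
      (\<forall>P \<in> sym_tensor_fields p. \<forall>x J. length J = q \<longrightarrow>
        D P x J = (\<Sum>\<alpha> | length \<alpha> \<le> k. \<Sum>I | length I = p. A \<alpha> x J I * partials \<alpha> (\<lambda>y. P y I) x))"
    using diff_ops_coeffs[OF D] by (rule exE)
  note A = A0[THEN conjunct1, rule_format] A0[THEN conjunct2, rule_format]
  show "length J = q \<Longrightarrow> diff_form k p (\<lambda>P x. D P x J)"
    by (rule diff_formI[of "\<lambda>\<alpha> x I. A \<alpha> x J I"]) (rule A | assumption)+
qed

lemma diff_ops_leI:
  fixes D :: "'m::finite tfield \<Rightarrow> 'm tfield"
  assumes D: "\<And>P. P \<in> sym_tensor_fields p \<Longrightarrow> D P \<in> sym_tensor_fields q"
    and out: "\<And>P. P \<notin> sym_tensor_fields p \<Longrightarrow> D P = 0"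
    and form: "\<And>J. length J = q \<Longrightarrow> diff_form k p (\<lambda>P x. D P x J)"
  shows "D \<in> diff_ops_le k p q"
proof -
  have "\<forall>J. \<exists>A :: 'm list \<Rightarrow> real^'m \<Rightarrow> 'm list \<Rightarrow> real. length J = q \<longrightarrow> (\<forall>\<alpha> I. smooth (\<lambda>x. A \<alpha> x I)) \<and> (\<forall>P \<in> sym_tensor_fields p. \<forall>x. D P x J =
        (\<Sum>\<alpha> | length \<alpha> \<le> k. \<Sum>I | length I = p. A \<alpha> x I * partials \<alpha> (\<lambda>y. P y I) x))"
    using form unfolding diff_form_def by simp
  from choice[OF this] obtain A where A: "\<forall>J. length J = q \<longrightarrow> (\<forall>\<alpha> I. smooth (\<lambda>x. A J \<alpha> x I)) \<and> (\<forall>P \<in> sym_tensor_fields p. \<forall>x. D P x J =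
        (\<Sum>\<alpha> | length \<alpha> \<le> k. \<Sum>I | length I = p. A J \<alpha> x I * partials \<alpha> (\<lambda>y. P y I) x))"
    by (rule exE)
  \<comment> \<open>The coefficients are chosen for each component \<open>J\<close> separately. For
    \<open>J\<close> of other lengths nothing is known about the choice, but smoothness is demanded
    there too, hence the value 0.\<close>
  let ?A = "\<lambda>\<alpha> x J I. if length J = q then A J \<alpha> x I else 0"
  have sm: "smooth (\<lambda>x. ?A \<alpha> x J I)" for \<alpha> J I
    using A by (cases "length J = q") simp_all
  have eq: "D P x J = (\<Sum>\<alpha> | length \<alpha> \<le> k. \<Sum>I | length I = p. ?A \<alpha> x J I * partials \<alpha> (\<lambda>y. P y I) x)"
    if "P \<in> sym_tensor_fields p" "length J = q" for P x J
    using A[rule_format, OF that(2), THEN conjunct2, rule_format, OF that(1)] that(2) by simp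
  have "\<exists>A :: 'm list \<Rightarrow> real^'m \<Rightarrow> 'm list \<Rightarrow> 'm list \<Rightarrow> real. (\<forall>\<alpha> J I. smooth (\<lambda>x. A \<alpha> x J I)) \<and>
      (\<forall>P \<in> sym_tensor_fields p. \<forall>x J. length J = q \<longrightarrow>
        D P x J = (\<Sum>\<alpha> | length \<alpha> \<le> k. \<Sum>I | length I = p. A \<alpha> x J I * partials \<alpha> (\<lambda>y. P y I) x))"
    by (intro exI[of _ ?A] conjI allI ballI impI sm eq)
  then show ?thesis
    unfolding diff_ops_le_def mem_Collect_eq by (intro conjI ballI allI impI D out)
qed

lemma diff_form_cong:
  "(\<And>P x. P \<in> sym_tensor_fields p \<Longrightarrow> Q P x = Q' P x) \<Longrightarrow> diff_form k p Q' \<Longrightarrow> diff_form k p Q"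
  unfolding diff_form_def by simp

lemma diff_form_0: "diff_form k p (\<lambda>P x. 0)"
  by (rule diff_formI[of "\<lambda>\<alpha> x I. 0"]) simp_all

lemma diff_form_add:
  assumes Q: "diff_form k p Q" and Q': "diff_form k p Q'" shows "diff_form k p (\<lambda>P x. Q P x + Q' P x)"
proof -
  obtain A where A0: "(\<forall>\<alpha> I. smooth (\<lambda>x. A \<alpha> x I)) \<and>
      (\<forall>P \<in> sym_tensor_fields p. \<forall>x. Q P x = (\<Sum>\<alpha> | length \<alpha> \<le> k. \<Sum>I | length I = p. A \<alpha> x I * partials \<alpha> (\<lambda>y. P y I) x))"
    using Q unfolding diff_form_def by (rule exE)
  note A = A0[THEN conjunct1, rule_format] A0[THEN conjunct2, rule_format]
  obtain A' where A'0: "(\<forall>\<alpha> I. smooth (\<lambda>x. A' \<alpha> x I)) \<and>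
      (\<forall>P \<in> sym_tensor_fields p. \<forall>x. Q' P x = (\<Sum>\<alpha> | length \<alpha> \<le> k. \<Sum>I | length I = p. A' \<alpha> x I * partials \<alpha> (\<lambda>y. P y I) x))"
    using Q' unfolding diff_form_def by (rule exE)
  note A' = A'0[THEN conjunct1, rule_format] A'0[THEN conjunct2, rule_format]
  show ?thesis
    by (rule diff_formI[of "\<lambda>\<alpha> x I. A \<alpha> x I + A' \<alpha> x I"])
      (simp_all add: A A' smooth_add sum.distrib distrib_right)
qed

lemma diff_form_mult:
  assumes f: "smooth f" and Q: "diff_form k p Q" shows "diff_form k p (\<lambda>P x. f x * Q P x)"
proof -
  obtain A where A0: "(\<forall>\<alpha> I. smooth (\<lambda>x. A \<alpha> x I)) \<and>
      (\<forall>P \<in> sym_tensor_fields p. \<forall>x. Q P x = (\<Sum>\<alpha> | length \<alpha> \<le> k. \<Sum>I | length I = p. A \<alpha> x I * partials \<alpha> (\<lambda>y. P y I) x))"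
    using Q unfolding diff_form_def by (rule exE)
  note A = A0[THEN conjunct1, rule_format] A0[THEN conjunct2, rule_format]
  show ?thesis
    by (rule diff_formI[of "\<lambda>\<alpha> x I. f x * A \<alpha> x I"])
      (simp_all add: A f smooth_mult sum_distrib_left mult.assoc)
qed

lemma diff_form_diff:
  assumes "diff_form k p Q" "diff_form k p Q'" shows "diff_form k p (\<lambda>P x. Q P x - Q' P x)"
  using diff_form_add[OF assms(1) diff_form_mult[OF smooth_const[of "-1"] assms(2)]] by simp

lemma diff_form_sum:
  "(\<And>i. i \<in> S \<Longrightarrow> diff_form k p (Q i)) \<Longrightarrow> diff_form k p (\<lambda>P x. \<Sum>i\<in>S. Q i P x)"
  by (induction S rule: infinite_finite_induct) (simp_all add: diff_form_0 diff_form_add)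

lemma diff_form_mono:
  assumes "diff_form k p Q" "k \<le> l" shows "diff_form l p Q"
proof -
  obtain A where A0: "(\<forall>\<alpha> I. smooth (\<lambda>x. A \<alpha> x I)) \<and>
      (\<forall>P \<in> sym_tensor_fields p. \<forall>x. Q P x = (\<Sum>\<alpha> | length \<alpha> \<le> k. \<Sum>I | length I = p. A \<alpha> x I * partials \<alpha> (\<lambda>y. P y I) x))"
    using assms(1) unfolding diff_form_def by (rule exE)
  note A = A0[THEN conjunct1, rule_format] A0[THEN conjunct2, rule_format]
  let ?A = "\<lambda>\<alpha> x I. if length \<alpha> \<le> k then A \<alpha> x I else 0"
  have sm: "smooth (\<lambda>x. ?A \<alpha> x I)" for \<alpha> I using A(1) by (cases "length \<alpha> \<le> k") simp_all
  have "(\<Sum>\<alpha> | length \<alpha> \<le> k. \<Sum>I | length I = p. A \<alpha> x I * partials \<alpha> (\<lambda>y. P y I) x)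
     = (\<Sum>\<alpha> | length \<alpha> \<le> l. \<Sum>I | length I = p. ?A \<alpha> x I * partials \<alpha> (\<lambda>y. P y I) x)" for x P
  proof (rule sum.mono_neutral_cong_left)
    show "{\<alpha>. length \<alpha> \<le> k} \<subseteq> {\<alpha>. length \<alpha> \<le> l}" using assms(2) by auto
  qed (simp_all add: finite_words)
  then show ?thesis
    by (intro diff_formI[of ?A] sm) (simp add: A)
qed

lemma sum_delta2:
  fixes h :: "'a \<Rightarrow> 'b \<Rightarrow> real"
  assumes "finite S" "finite T" "a \<in> S" "b \<in> T"
  shows "(\<Sum>x\<in>S. \<Sum>y\<in>T. (if x = a \<and> y = b then 1 else 0) * h x y) = h a b"
proof -
  have "(\<Sum>y\<in>T. (if x = a \<and> y = b then 1 else 0) * h x y) = (\<Sum>y\<in>T. if y = b then (if x = a then h x y else 0) else 0)" for x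
    by (rule sum.cong) simp_all
  also have "\<dots> x = (if x = a then h x b else 0)" for x
    using assms by simp
  finally show ?thesis using assms by simp
qed

lemma diff_form_partials_component:
  fixes I :: "'m::finite list"
  assumes "length \<alpha> \<le> k" shows "diff_form k p (\<lambda>P. partials \<alpha> (\<lambda>y. P y I))"
proof (cases "length I = p")
  case True
  show ?thesis
  proof (rule diff_formI)
    show "smooth (\<lambda>x :: real^'m. if \<beta> = \<alpha> \<and> I' = I then 1 else 0)" for \<beta> I' by simp
    fix P :: "'m tfield" and x
    show "partials \<alpha> (\<lambda>y. P y I) x = (\<Sum>\<beta> | length \<beta> \<le> k. \<Sum>I' | length I' = p.
        (if \<beta> = \<alpha> \<and> I' = I then 1 else 0) * partials \<beta> (\<lambda>y. P y I') x)"
      by (rule sum_delta2[symmetric]) (use assms True in \<open>simp_all add: finite_words\<close>)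
  qed
next
  case False
  show ?thesis
  proof (rule diff_form_cong[OF _ diff_form_0])
    fix P :: "'m tfield" and x assume "P \<in> sym_tensor_fields p"
    then have "(\<lambda>y. P y I) = (\<lambda>y. 0)"
      using False sym_tensorsD(1) unfolding sym_tensor_fields_def by blast
    then show "partials \<alpha> (\<lambda>y. P y I) x = 0" by (simp add: partials_0)
  qed
qed

lemma diff_form_partial:
  assumes "diff_form k p Q" shows "diff_form (Suc k) p (\<lambda>P. partial i (Q P))"
proof -
  obtain A where A0: "(\<forall>\<alpha> I. smooth (\<lambda>x. A \<alpha> x I)) \<and>
      (\<forall>P \<in> sym_tensor_fields p. \<forall>x. Q P x = (\<Sum>\<alpha> | length \<alpha> \<le> k. \<Sum>I | length I = p. A \<alpha> x I * partials \<alpha> (\<lambda>y. P y I) x))"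
    using assms unfolding diff_form_def by (rule exE)
  note A = A0[THEN conjunct1, rule_format] A0[THEN conjunct2, rule_format]
  have "diff_form (Suc k) p (\<lambda>P x. \<Sum>\<alpha> | length \<alpha> \<le> k. \<Sum>I | length I = p.
      A \<alpha> x I * partials (i # \<alpha>) (\<lambda>y. P y I) x + partial i (\<lambda>x. A \<alpha> x I) x * partials \<alpha> (\<lambda>y. P y I) x)"
    by (intro diff_form_sum diff_form_add diff_form_mult smooth_partial A diff_form_partials_component) simp_all
  moreover have "partial i (Q P) x = (\<Sum>\<alpha> | length \<alpha> \<le> k. \<Sum>I | length I = p.
      A \<alpha> x I * partials (i # \<alpha>) (\<lambda>y. P y I) x + partial i (\<lambda>x. A \<alpha> x I) x * partials \<alpha> (\<lambda>y. P y I) x)"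
    if P: "P \<in> sym_tensor_fields p" for P x
  proof -
    have "Q P = (\<lambda>x. \<Sum>\<alpha> | length \<alpha> \<le> k. \<Sum>I | length I = p. A \<alpha> x I * partials \<alpha> (\<lambda>y. P y I) x)"
      by (rule ext) (rule A(2)[OF P])
    then show ?thesis
      by (simp add: partial_sum partial_mult smooth_sum smooth_mult A smooth_partials sym_tensor_fields_smooth[OF P])
  qed
  ultimately show ?thesis by (rule diff_form_cong[rotated])
qed

lemma diff_form_partials:
  "diff_form k p Q \<Longrightarrow> diff_form (length \<alpha> + k) p (\<lambda>P. partials \<alpha> (Q P))"
  by (induction \<alpha>) (simp_all add: diff_form_partial)

text \<open>The parts of order \<open>length \<alpha> + 1\<close> agree in both compositions. Each
  induction step adds only terms with a derivative of a component of \<open>X\<close> and a word of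
  the same length, so the action of \<open>X\<close> will not raise the order of operators.\<close>

lemma diff_form_commutator:
  assumes X: "smooth_field X"
  shows "diff_form (length \<alpha>) p (\<lambda>P x. along X (partials \<alpha> (\<lambda>y. P y I)) x - partials \<alpha> (along X (\<lambda>y. P y I)) x)"
proof (induction \<alpha>)
  case Nil
  then show ?case by (simp add: diff_form_0)
next
  case (Cons a \<alpha>)
  show ?case
  proof (rule diff_form_cong)
    show "diff_form (length (a # \<alpha>)) p (\<lambda>P x.
        partial a (\<lambda>x. along X (partials \<alpha> (\<lambda>y. P y I)) x - partials \<alpha> (along X (\<lambda>y. P y I)) x) x
        - (\<Sum>i\<in>UNIV. partial a (\<lambda>x. X x $ i) x * partials (i # \<alpha>) (\<lambda>y. P y I) x))"
      by (intro diff_form_diff diff_form_sum diff_form_mult diff_form_partials_component smooth_partial smooth_fieldD X)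
        (use diff_form_partial[OF Cons] in simp_all)
    fix P :: "'a tfield" and x assume P: "P \<in> sym_tensor_fields p"
    let ?g = "partials \<alpha> (\<lambda>y. P y I)"
    have sm: "smooth (\<lambda>y. P y I)" "smooth ?g" "smooth (partial i ?g)" for i
      using sym_tensor_fields_smooth[OF P] by (simp_all add: smooth_partials smooth_partial)
    have "along X (partial a ?g) x = partial a (along X ?g) x - (\<Sum>i\<in>UNIV. partial a (\<lambda>x. X x $ i) x * partial i ?g x)"
      unfolding along_real[abs_def]
      by (simp add: partial_sum partial_mult smooth_mult sm smooth_fieldD[OF X] sum.distrib partial_commute[OF sm(2), of a])
    then show "along X (partials (a # \<alpha>) (\<lambda>y. P y I)) x - partials (a # \<alpha>) (along X (\<lambda>y. P y I)) x
      = partial a (\<lambda>x. along X (partials \<alpha> (\<lambda>y. P y I)) x - partials \<alpha> (along X (\<lambda>y. P y I)) x) x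
        - (\<Sum>i\<in>UNIV. partial a (\<lambda>x. X x $ i) x * partials (i # \<alpha>) (\<lambda>y. P y I) x)"
      by (simp add: partial_diff along_smooth[OF X] sm smooth_partials)
  qed
qed

section \<open>Operators between tensor fields and the action of vector fields on them\<close>

lemma subspace_sym_tensor_fields: "subspace (sym_tensor_fields k)"
  unfolding subspace_def
proof (intro conjI ballI allI)
  show "0 \<in> sym_tensor_fields k"
    by (simp add: sym_tensor_fields_def subspace_0[OF subspace_sym_tensors])
  show "P + Q \<in> sym_tensor_fields k" if "P \<in> sym_tensor_fields k" "Q \<in> sym_tensor_fields k" for P Q
    using that by (simp add: sym_tensor_fields_def subspace_add[OF subspace_sym_tensors] smooth_add)
  show "c *\<^sub>R P \<in> sym_tensor_fields k" if "P \<in> sym_tensor_fields k" for c P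
    using that by (simp add: sym_tensor_fields_def subspace_scale[OF subspace_sym_tensors] scaleR_fun_apply smooth_cmult)
qed

lemma diff_ops_le_mono: "k \<le> l \<Longrightarrow> diff_ops_le k p q \<subseteq> diff_ops_le l p q"
proof
  fix D :: "'a tfield \<Rightarrow> 'a tfield" assume kl: "k \<le> l" and D: "D \<in> diff_ops_le k p q"
  show "D \<in> diff_ops_le l p q"
    by (rule diff_ops_leI) (use diff_ops_leD[OF D] diff_form_mono[OF diff_ops_leD(3)[OF D] kl] in blast)+
qed

lemma subspace_diff_ops_le: "subspace (diff_ops_le k p q)"
  unfolding subspace_def
proof (intro conjI ballI allI)
  note S = subspace_sym_tensor_fields[of q]
  show "0 \<in> diff_ops_le k p q"
    by (rule diff_ops_leI) (simp_all add: subspace_0[OF S] diff_form_0)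
  show "D + D' \<in> diff_ops_le k p q" if D: "D \<in> diff_ops_le k p q" "D' \<in> diff_ops_le k p q" for D D'
    by (rule diff_ops_leI)
      (simp_all add: subspace_add[OF S] diff_form_add diff_ops_leD[OF D(1)] diff_ops_leD[OF D(2)])
  show "c *\<^sub>R D \<in> diff_ops_le k p q" if D: "D \<in> diff_ops_le k p q" for c D
    by (rule diff_ops_leI)
      (simp_all add: scaleR_fun_apply subspace_scale[OF S] diff_form_mult diff_ops_leD[OF D])
qed

definition mul_op :: "(real^'m \<Rightarrow> real) \<Rightarrow> ('m::finite tfield \<Rightarrow> 'm tfield) \<Rightarrow> ('m tfield \<Rightarrow> 'm tfield)" where
  "mul_op f D = (\<lambda>P x J. f x * D P x J)"

lemma mul_op_diff_ops_le:
  assumes f: "smooth f" and D: "D \<in> diff_ops_le k p q" shows "mul_op f D \<in> diff_ops_le k p q"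
proof (rule diff_ops_leI)
  fix P :: "'a tfield" assume P: "P \<in> sym_tensor_fields p"
  have DP: "D P \<in> sym_tensor_fields q" by (rule diff_ops_leD(1)[OF D P])
  have "mul_op f D P x = f x *\<^sub>R D P x" for x
    by (simp add: mul_op_def fun_eq_iff scaleR_fun_apply)
  then have "mul_op f D P x \<in> sym_tensors q" for x
    using DP by (simp add: sym_tensor_fields_def subspace_scale[OF subspace_sym_tensors])
  then show "mul_op f D P \<in> sym_tensor_fields q"
    using smooth_mult[OF f sym_tensor_fields_smooth[OF DP]] by (simp add: sym_tensor_fields_def mul_op_def)
next
  fix P :: "'a tfield" assume "P \<notin> sym_tensor_fields p"
  then show "mul_op f D P = 0" by (simp add: mul_op_def diff_ops_leD(2)[OF D] fun_eq_iff)
next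
  fix J :: "'a list" assume "length J = q"
  then show "diff_form k p (\<lambda>P x. mul_op f D P x J)"
    unfolding mul_op_def by (intro diff_form_mult f diff_ops_leD(3)[OF D])
qed

lemma linear_mul_op: "linear (mul_op f)"
  by (rule linearI) (simp_all add: mul_op_def fun_eq_iff scaleR_fun_apply algebra_simps)

lemma diff_ops_lin:
  assumes D: "D \<in> diff_ops_le k p q" and P: "P \<in> sym_tensor_fields p" and Q: "Q \<in> sym_tensor_fields p"
  shows "D (a *\<^sub>R P + b *\<^sub>R Q) = a *\<^sub>R D P + b *\<^sub>R D Q"
proof (intro ext)
  fix x J
  have S: "a *\<^sub>R P + b *\<^sub>R Q \<in> sym_tensor_fields p"
    using P Q by (intro subspace_add[OF subspace_sym_tensor_fields] subspace_scale[OF subspace_sym_tensor_fields])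
  show "D (a *\<^sub>R P + b *\<^sub>R Q) x J = (a *\<^sub>R D P + b *\<^sub>R D Q) x J"
  proof (cases "length J = q")
    case True
    obtain A where A0: "(\<forall>\<alpha> J I. smooth (\<lambda>x. A \<alpha> x J I)) \<and>
      (\<forall>P \<in> sym_tensor_fields p. \<forall>x J. length J = q \<longrightarrow>
        D P x J = (\<Sum>\<alpha> | length \<alpha> \<le> k. \<Sum>I | length I = p. A \<alpha> x J I * partials \<alpha> (\<lambda>y. P y I) x))"
      using diff_ops_coeffs[OF D] by (rule exE)
    note A = A0[THEN conjunct2, rule_format]
    show ?thesis
      using sym_tensor_fields_smooth[OF P] sym_tensor_fields_smooth[OF Q]
      by (simp add: A[OF S True] A[OF P True] A[OF Q True] scaleR_fun_apply partials_add partials_cmult smooth_cmult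
          sum.distrib sum_distrib_left algebra_simps)
  next
    case False
    have "D R x J = 0" if "R \<in> sym_tensor_fields p" for R
      using sym_tensorsD(1)[of "D R x" q J] diff_ops_leD(1)[OF D that] False by (simp add: sym_tensor_fields_def)
    then show ?thesis using S P Q by (simp add: scaleR_fun_apply)
  qed
qed

text \<open>Either composition alone may have order \<open>k + 1\<close>; the bound \<open>k\<close>
  holds for their difference.\<close>

lemma op_action_diff_ops_le:
  assumes X: "smooth_field X" and D: "D \<in> diff_ops_le k p q"
  shows "op_action \<delta> p X D \<in> diff_ops_le k p q"
proof (rule diff_ops_leI)
  fix P :: "'a tfield" assume P: "P \<in> sym_tensor_fields p"
  then show "op_action \<delta> p X D P \<in> sym_tensor_fields q"
    unfolding op_action_def
    by (simp add: subspace_diff[OF subspace_sym_tensor_fields] lie_deriv_sym_tensor_fields X diff_ops_leD(1)[OF D])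
next
  fix P :: "'a tfield" assume "P \<notin> sym_tensor_fields p"
  then show "op_action \<delta> p X D P = 0" by (simp add: op_action_def)
next
  fix J :: "'a list" assume J: "length J = q"
  obtain A where A0: "(\<forall>\<alpha> J I. smooth (\<lambda>x. A \<alpha> x J I)) \<and>
      (\<forall>P \<in> sym_tensor_fields p. \<forall>x J. length J = q \<longrightarrow>
        D P x J = (\<Sum>\<alpha> | length \<alpha> \<le> k. \<Sum>I | length I = p. A \<alpha> x J I * partials \<alpha> (\<lambda>y. P y I) x))"
    using diff_ops_coeffs[OF D] by (rule exE)
  note A = A0[THEN conjunct1, rule_format] A0[THEN conjunct2, rule_format]
  let ?tr = "\<lambda>x. trace (jacobian X (at x))"
  let ?gl = "\<lambda>P I x. gl_rep (jacobian X (at x)) (P x) I"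
  \<comment> \<open>The terms in which \<open>X\<close> differentiates derivatives of
    \<open>P\<close> are paired into commutators, so that \<open>diff_form_commutator\<close> bounds
    them by order \<open>k\<close>. The remaining terms need no cancellation.\<close>
  define R where "R = (\<lambda>(P :: 'a tfield) x.
      (\<Sum>\<alpha> | length \<alpha> \<le> k. \<Sum>I | length I = p.
        A \<alpha> x J I * (along X (partials \<alpha> (\<lambda>y. P y I)) x - partials \<alpha> (along X (\<lambda>y. P y I)) x)
        + along X (\<lambda>x. A \<alpha> x J I) x * partials \<alpha> (\<lambda>y. P y I) x
        + A \<alpha> x J I * partials \<alpha> (?gl P I) x
        - A \<alpha> x J I * partials \<alpha> (\<lambda>x. \<delta> * ?tr x * P x I) x)
      - ?gl (D P) J x + \<delta> * ?tr x * D P x J)"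
  have gl: "diff_form l p (\<lambda>P. ?gl (Q P) I)" if "\<And>I. length I = n \<Longrightarrow> diff_form l p (\<lambda>P x. Q P x I)" "length I = n" for Q l I n
    unfolding gl_rep_def using that by (intro diff_form_sum diff_form_mult smooth_jacobian X) simp
  have id: "diff_form 0 p (\<lambda>P x. P x I)" for I
    using diff_form_partials_component[of "[]" 0 p I] by simp
  have str: "smooth (\<lambda>x. \<delta> * ?tr x)"
    by (intro smooth_cmult smooth_trace_jacobian X)
  have pa: "diff_form k p (\<lambda>P. partials \<alpha> (Q P))" if "diff_form 0 p Q" "length \<alpha> \<le> k" for \<alpha> Q
    using diff_form_mono[OF diff_form_partials[OF that(1)], of \<alpha> k] that(2) by simp
  have c1: "diff_form k p (\<lambda>P x. along X (partials \<alpha> (\<lambda>y. P y I)) x - partials \<alpha> (along X (\<lambda>y. P y I)) x)"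
    if "length \<alpha> \<le> k" for \<alpha> I
    by (rule diff_form_mono[OF diff_form_commutator[OF X] that])
  have c2: "diff_form k p (\<lambda>P. partials \<alpha> (?gl P I))" if "length \<alpha> \<le> k" for \<alpha> I
    by (intro pa gl[OF id refl] that)
  have c3: "diff_form k p (\<lambda>P. partials \<alpha> (\<lambda>x. \<delta> * ?tr x * P x I))" if "length \<alpha> \<le> k" for \<alpha> I
    by (intro pa diff_form_mult id str that)
  have "diff_form k p (\<lambda>P x. A \<alpha> x J I * (along X (partials \<alpha> (\<lambda>y. P y I)) x - partials \<alpha> (along X (\<lambda>y. P y I)) x)
        + along X (\<lambda>x. A \<alpha> x J I) x * partials \<alpha> (\<lambda>y. P y I) x
        + A \<alpha> x J I * partials \<alpha> (?gl P I) x
        - A \<alpha> x J I * partials \<alpha> (\<lambda>x. \<delta> * ?tr x * P x I) x)" if "\<alpha> \<in> {\<alpha>. length \<alpha> \<le> k}" for \<alpha> I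
    using that A(1) along_smooth[OF X A(1)] diff_form_partials_component[of \<alpha> k p I] c1[of \<alpha> I] c2[of \<alpha> I] c3[of \<alpha> I]
    by (intro diff_form_diff[OF diff_form_add[OF diff_form_add]] diff_form_mult) simp_all
  from diff_form_sum[OF diff_form_sum[OF this]]
  have "diff_form k p R"
    unfolding R_def
    by (intro diff_form_add[OF diff_form_diff] diff_form_mult[OF str] gl[OF diff_ops_leD(3)[OF D] J] diff_ops_leD(3)[OF D J])
  then show "diff_form k p (\<lambda>P x. op_action \<delta> p X D P x J)"
  proof (rule diff_form_cong[rotated])
    fix P :: "'a tfield" and x assume P: "P \<in> sym_tensor_fields p"
    have sm: "smooth (\<lambda>y. P y I)" "smooth (along X (\<lambda>y. P y I))" "smooth (?gl P I)"
      "smooth (\<lambda>x. \<delta> * ?tr x * P x I)" for I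
      using sym_tensor_fields_smooth[OF P]
      by (auto intro!: along_smooth gl_rep_smooth smooth_mult smooth_jacobian smooth_trace_jacobian X)
    have L: "lie_deriv \<delta> X P \<in> sym_tensor_fields p" by (rule lie_deriv_sym_tensor_fields[OF X P])
    have "D (lie_deriv \<delta> X P) x J = (\<Sum>\<alpha> | length \<alpha> \<le> k. \<Sum>I | length I = p. A \<alpha> x J I *
        (partials \<alpha> (along X (\<lambda>y. P y I)) x - partials \<alpha> (?gl P I) x + partials \<alpha> (\<lambda>x. \<delta> * ?tr x * P x I) x))"
      unfolding A(2)[OF L J] by (simp add: lie_deriv_def partials_add partials_diff smooth_diff sm)
    moreover have "along X (\<lambda>y. D P y J) x = (\<Sum>\<alpha> | length \<alpha> \<le> k. \<Sum>I | length I = p.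
        A \<alpha> x J I * along X (partials \<alpha> (\<lambda>y. P y I)) x + along X (\<lambda>x. A \<alpha> x J I) x * partials \<alpha> (\<lambda>y. P y I) x)"
      by (simp add: A(2)[OF P J] along_sum along_mult smooth_sum smooth_mult A(1) smooth_partials sm)
    ultimately show "op_action \<delta> p X D P x J = R P x"
      using P by (simp add: op_action_def R_def lie_deriv_def[of \<delta> X "D P"] sum.distrib sum_subtractf algebra_simps)
  qed
qed

text \<open>Only the outer Lie derivative meets the factor \<open>f\<close>. The second summand is
  the defect \<open>\<nu>\<close> required by \<open>d_smul\<close>.\<close>

lemma op_action_mul_op:
  assumes f: "smooth f" and D: "D \<in> diff_ops_le k p q"
  shows "op_action \<delta> p X (mul_op f D) = mul_op f (op_action \<delta> p X D) + mul_op (along X f) D"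
proof
  fix P :: "'a tfield"
  show "op_action \<delta> p X (mul_op f D) P = (mul_op f (op_action \<delta> p X D) + mul_op (along X f) D) P"
  proof (cases "P \<in> sym_tensor_fields p")
    case True
    have "lie_deriv \<delta> X (mul_op f D P) = (\<lambda>x I. f x * lie_deriv \<delta> X (D P) x I + along X f x * D P x I)"
      unfolding mul_op_def by (rule lie_deriv_mult[OF f]) (rule sym_tensor_fields_smooth[OF diff_ops_leD(1)[OF D True]])
    then show ?thesis
      using True by (simp add: op_action_def mul_op_def fun_eq_iff algebra_simps)
  next
    case False
    then show ?thesis using diff_ops_leD(2)[OF D False] by (simp add: op_action_def mul_op_def fun_eq_iff)
  qed
qed

lemma op_action_lin_left:
  assumes "smooth_field X" "smooth_field Y" "D \<in> diff_ops_le k p q"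
  shows "op_action \<delta> p (a *\<^sub>R X + b *\<^sub>R Y) D = a *\<^sub>R op_action \<delta> p X D + b *\<^sub>R op_action \<delta> p Y D"
proof
  fix P :: "'a tfield"
  show "op_action \<delta> p (a *\<^sub>R X + b *\<^sub>R Y) D P = (a *\<^sub>R op_action \<delta> p X D + b *\<^sub>R op_action \<delta> p Y D) P"
    using assms diff_ops_lin[OF assms(3), of "lie_deriv \<delta> X P" "lie_deriv \<delta> Y P" a b]
    by (cases "P \<in> sym_tensor_fields p")
      (simp_all add: op_action_def scaleR_fun_apply lie_deriv_lin_left lie_deriv_sym_tensor_fields algebra_simps)
qed

lemma op_action_lin:
  assumes D: "D \<in> diff_ops_le k p q" "D' \<in> diff_ops_le k p q"
  shows "op_action \<delta> p X (a *\<^sub>R D + b *\<^sub>R D') = a *\<^sub>R op_action \<delta> p X D + b *\<^sub>R op_action \<delta> p X D'"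
proof
  fix P :: "'a tfield"
  show "op_action \<delta> p X (a *\<^sub>R D + b *\<^sub>R D') P = (a *\<^sub>R op_action \<delta> p X D + b *\<^sub>R op_action \<delta> p X D') P"
  proof (cases "P \<in> sym_tensor_fields p")
    case True
    have "lie_deriv \<delta> X (a *\<^sub>R D P + b *\<^sub>R D' P) = a *\<^sub>R lie_deriv \<delta> X (D P) + b *\<^sub>R lie_deriv \<delta> X (D' P)"
      by (intro lie_deriv_lin sym_tensor_fields_smooth[OF diff_ops_leD(1)[OF D(1) True]]
          sym_tensor_fields_smooth[OF diff_ops_leD(1)[OF D(2) True]])
    then show ?thesis using True by (simp add: op_action_def scaleR_fun_apply algebra_simps)
  qed (simp add: op_action_def scaleR_fun_apply)
qed

lemma op_action_lie_bracket:
  assumes X: "smooth_field X" and Y: "smooth_field Y" and D: "D \<in> diff_ops_le k p q"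
  shows "op_action \<delta> p (lie_bracket X Y) D
    = op_action \<delta> p X (op_action \<delta> p Y D) - op_action \<delta> p Y (op_action \<delta> p X D)"
proof
  fix P :: "'a tfield"
  let ?L = "lie_deriv \<delta>"
  show "op_action \<delta> p (lie_bracket X Y) D P
    = (op_action \<delta> p X (op_action \<delta> p Y D) - op_action \<delta> p Y (op_action \<delta> p X D)) P"
  proof (cases "P \<in> sym_tensor_fields p")
    case P: True
    have LP: "?L X Q \<in> sym_tensor_fields r" if "smooth_field X" "Q \<in> sym_tensor_fields r" for X Q r
      using that by (rule lie_deriv_sym_tensor_fields)
    have DP: "D Q \<in> sym_tensor_fields q" if "Q \<in> sym_tensor_fields p" for Q
      using diff_ops_leD(1)[OF D that] .
    have sm: "smooth (\<lambda>x. Q x I)" if "Q \<in> sym_tensor_fields r" for Q r I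
      using that by (rule sym_tensor_fields_smooth)
    have sub: "?L X (Q - R) = ?L X Q - ?L X R" if "Q \<in> sym_tensor_fields r" "R \<in> sym_tensor_fields r" for X Q R r
      using lie_deriv_lin[of Q R \<delta> X 1 "-1"] sm[OF that(1)] sm[OF that(2)] by simp
    have br: "?L (lie_bracket X Y) Q = ?L X (?L Y Q) - ?L Y (?L X Q)" if "Q \<in> sym_tensor_fields r" for Q r
      using lie_deriv_lie_bracket[OF X Y sm[OF that]] .
    have Dsub: "D (Q - R) = D Q - D R" if "Q \<in> sym_tensor_fields p" "R \<in> sym_tensor_fields p" for Q R
      using diff_ops_lin[OF D that, of 1 "-1"] by simp
    \<comment> \<open>The two middle terms are together symmetric in \<open>X\<close> and
      \<open>Y\<close> and disappear from the commutator.\<close>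
    have 1: "op_action \<delta> p X (op_action \<delta> p Y D) P = ?L X (?L Y (D P)) - ?L X (D (?L Y P)) - ?L Y (D (?L X P)) + D (?L Y (?L X P))"
      if X: "smooth_field X" and Y: "smooth_field Y" for X Y
    proof -
      have "?L X (?L Y (D P) - D (?L Y P)) = ?L X (?L Y (D P)) - ?L X (D (?L Y P))"
        by (rule sub[of _ q]) (intro LP DP X Y P)+
      then show ?thesis using LP[OF X P] P by (simp add: op_action_def)
    qed
    have "D (?L (lie_bracket X Y) P) = D (?L X (?L Y P)) - D (?L Y (?L X P))"
      unfolding br[OF P] by (rule Dsub) (intro LP P X Y)+
    moreover have "op_action \<delta> p (lie_bracket X Y) D P = ?L (lie_bracket X Y) (D P) - D (?L (lie_bracket X Y) P)"
      using P by (simp add: op_action_def)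
    ultimately show ?thesis
      by (simp add: 1 X Y br[OF DP[OF P]])
  qed (simp add: op_action_def)
qed

text \<open>At each point \<open>x\<close> this is the action of the Euler field centred at
  \<open>x\<close>. It is not the action of a single field, since the centre moves with the point of
  evaluation.\<close>

definition euler_op :: "real \<Rightarrow> nat \<Rightarrow> ('m::finite tfield \<Rightarrow> 'm tfield) \<Rightarrow> ('m tfield \<Rightarrow> 'm tfield)" where
  "euler_op \<delta> p D = op_action \<delta> p euler_field D
     - (\<Sum>i\<in>UNIV. mul_op (\<lambda>x. x $ i) (op_action \<delta> p (coord_field i) D))"

section \<open>Eigenvalues of the centred Euler field on symbols\<close>

lemma smooth_euler_field: "smooth_field euler_field"
  by (simp add: euler_field_quad smooth_field_quad)

lemma smooth_coord_field: "smooth_field (coord_field i)"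
  by (simp add: coord_field_quad smooth_field_quad)

lemma along_euler: "along euler_field f x = (\<Sum>i\<in>UNIV. x $ i * partial i f x)" for f :: "real^'m::finite \<Rightarrow> real"
  by (simp add: along_real euler_field_eq)

lemma lie_deriv_euler:
  "lie_deriv \<delta> euler_field P x I = along euler_field (\<lambda>y. P y I) x
     + (\<delta> * real CARD('m) - real (length I)) * P x I"
  for P :: "'m::finite tfield"
proof -
  have "jacobian euler_field (at x) = (mat 1 :: real^'m^'m)"
    by (simp add: vec_eq_iff jacobian_partial smooth_euler_field mat_def) (simp add: euler_field_eq partial_coord)
  then show ?thesis
    by (simp add: lie_deriv_def gl_rep_mat_1 trace_I algebra_simps)
qed

lemma lie_deriv_coord: "lie_deriv \<delta> (coord_field i) P x I = partial i (\<lambda>y. P y I) x"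
proof -
  have "jacobian (coord_field i) (at x) = 0"
    by (simp add: vec_eq_iff jacobian_partial smooth_coord_field) (simp add: coord_field_def partial_const)
  moreover have "along (coord_field i) (\<lambda>y. P y I) x = partial i (\<lambda>y. P y I) x"
    by (simp add: along_real coord_field_def axis_def if_distrib if_distribR cong: if_cong)
  ultimately show ?thesis
    by (simp add: lie_deriv_def gl_rep_def trace_def)
qed

lemma euler_op_diff_ops_le: "D \<in> diff_ops_le k p q \<Longrightarrow> euler_op \<delta> p D \<in> diff_ops_le k p q"
  unfolding euler_op_def
  by (intro subspace_diff[OF subspace_diff_ops_le] subspace_sum[OF subspace_diff_ops_le]
      mul_op_diff_ops_le op_action_diff_ops_le smooth_euler_field smooth_coord_field smooth_coord)

text \<open>A summand with the word \<open>\<alpha>\<close> is multiplied by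
  \<open>p - q - length \<alpha>\<close>: the value contributes \<open>- q\<close>, the argument
  \<open>p\<close>, each derivative \<open>- 1\<close>, and the density terms cancel. The added
  multiple of \<open>D\<close> shifts this to \<open>k - length \<alpha>\<close>, which is 0 in the
  top order.\<close>

lemma euler_op_symbol:
  assumes D: "D \<in> diff_ops_le k p q"
  shows "\<exists>A. (\<forall>\<alpha> J I. smooth (\<lambda>x. A \<alpha> x J I)) \<and>
    (\<forall>P \<in> sym_tensor_fields p. \<forall>x J. length J = q \<longrightarrow>
      euler_op \<delta> p D P x J + (real k - real p + real q) * D P x J
      = (\<Sum>\<alpha> | length \<alpha> \<le> k. \<Sum>I | length I = p. (real k - real (length \<alpha>)) * A \<alpha> x J I * partials \<alpha> (\<lambda>y. P y I) x))"
proof -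
  obtain A where A0: "(\<forall>\<alpha> J I. smooth (\<lambda>x. A \<alpha> x J I)) \<and>
      (\<forall>P \<in> sym_tensor_fields p. \<forall>x J. length J = q \<longrightarrow>
        D P x J = (\<Sum>\<alpha> | length \<alpha> \<le> k. \<Sum>I | length I = p. A \<alpha> x J I * partials \<alpha> (\<lambda>y. P y I) x))"
    using diff_ops_coeffs[OF D] by (rule exE)
  note A = A0[THEN conjunct1, rule_format] A0[THEN conjunct2, rule_format]
  show ?thesis
  proof (intro exI[of _ A] conjI allI ballI impI A(1))
    fix P :: "'a tfield" and x and J :: "'a list"
    assume P: "P \<in> sym_tensor_fields p" and J: "length J = q"
    let ?c = "\<delta> * real CARD('a)"
    have sm: "smooth (\<lambda>y. P y I)" for I by (rule sym_tensor_fields_smooth[OF P])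
    have LE: "D (lie_deriv \<delta> euler_field P) x J = (\<Sum>\<alpha> | length \<alpha> \<le> k. \<Sum>I | length I = p. A \<alpha> x J I *
      ((\<Sum>i\<in>UNIV. x $ i * partial i (partials \<alpha> (\<lambda>y. P y I)) x) + (real (length \<alpha>) + ?c - real p) * partials \<alpha> (\<lambda>y. P y I) x))"
    proof -
      have "partials \<alpha> (\<lambda>y. lie_deriv \<delta> euler_field P y I) x
        = (\<Sum>i\<in>UNIV. x $ i * partial i (partials \<alpha> (\<lambda>y. P y I)) x) + (real (length \<alpha>) + ?c - real p) * partials \<alpha> (\<lambda>y. P y I) x"
        if "length I = p" for \<alpha> I
      proof -
        have "(\<lambda>y. lie_deriv \<delta> euler_field P y I) = (\<lambda>y. along euler_field (\<lambda>y. P y I) y + (?c - real p) * P y I)"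
          using that by (simp add: lie_deriv_euler)
        then show ?thesis
          using sm by (simp add: partials_add partials_cmult smooth_cmult
            along_smooth[OF smooth_euler_field] partials_euler) (simp add: algebra_simps)
      qed
      then show ?thesis
        unfolding A(2)[OF lie_deriv_sym_tensor_fields[OF smooth_euler_field P] J] by simp
    qed
    have LC: "D (lie_deriv \<delta> (coord_field i) P) x J = (\<Sum>\<alpha> | length \<alpha> \<le> k. \<Sum>I | length I = p.
        A \<alpha> x J I * partial i (partials \<alpha> (\<lambda>y. P y I)) x)" for i
      unfolding A(2)[OF lie_deriv_sym_tensor_fields[OF smooth_coord_field P] J]
      using sm by (simp add: lie_deriv_coord[abs_def] partials_partial)
    \<comment> \<open>The translations, weighted by \<open>x $ i\<close>, produce exactly the
      transport terms of \<open>LE\<close>; these cancel in the final computation.\<close>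
    have sw: "(\<Sum>i\<in>UNIV. x $ i * D (lie_deriv \<delta> (coord_field i) P) x J)
      = (\<Sum>\<alpha> | length \<alpha> \<le> k. \<Sum>I | length I = p. A \<alpha> x J I * (\<Sum>i\<in>UNIV. x $ i * partial i (partials \<alpha> (\<lambda>y. P y I)) x))"
      unfolding LC sum_distrib_left
      by (subst sum.swap, rule sum.cong[OF refl], subst sum.swap, rule sum.cong[OF refl]) (simp add: mult_ac)
    define S where "S \<alpha> I = (\<Sum>i\<in>UNIV. x $ i * partial i (partials \<alpha> (\<lambda>y. P y I)) x)" for \<alpha> I
    \<comment> \<open>The derivatives of \<open>D P\<close> along the Euler field and along its
      value at \<open>x\<close> cancel, so no coefficient of \<open>D\<close> is differentiated; the
      value contributes only its weight.\<close>
    have "euler_op \<delta> p D P x J = (?c - real q) * D P x J - D (lie_deriv \<delta> euler_field P) x J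
        + (\<Sum>i\<in>UNIV. x $ i * D (lie_deriv \<delta> (coord_field i) P) x J)"
      using P J by (simp add: euler_op_def sum_fun_apply mul_op_def op_action_def lie_deriv_euler lie_deriv_coord
          right_diff_distrib sum_subtractf along_euler left_diff_distrib)
    then have "euler_op \<delta> p D P x J + (real k - real p + real q) * D P x J
      = (real k - real p + ?c) * D P x J - D (lie_deriv \<delta> euler_field P) x J
        + (\<Sum>i\<in>UNIV. x $ i * D (lie_deriv \<delta> (coord_field i) P) x J)"
      by (simp add: algebra_simps)
    also have "\<dots> = (\<Sum>\<alpha> | length \<alpha> \<le> k. \<Sum>I | length I = p. (real k - real (length \<alpha>)) * A \<alpha> x J I * partials \<alpha> (\<lambda>y. P y I) x)"
      unfolding sw[folded S_def] LE[folded S_def] A(2)[OF P J] sum_distrib_left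
      by (simp add: sum.distrib[symmetric] sum_subtractf[symmetric] algebra_simps)
    finally show "euler_op \<delta> p D P x J + (real k - real p + real q) * D P x J
      = (\<Sum>\<alpha> | length \<alpha> \<le> k. \<Sum>I | length I = p. (real k - real (length \<alpha>)) * A \<alpha> x J I * partials \<alpha> (\<lambda>y. P y I) x)" .
  qed
qed

text \<open>Order below \<open>k\<close>. The case \<open>k = 0\<close> is separate because
  truncated subtraction would give order 0 there, while the descent has to end at the zero
  operator.\<close>

definition diff_ops_less :: "nat \<Rightarrow> nat \<Rightarrow> nat \<Rightarrow> ('m::finite tfield \<Rightarrow> 'm tfield) set" where
  "diff_ops_less k p q = (if k = 0 then {0} else diff_ops_le (k - 1) p q)"

text \<open>The factors \<open>real k - real (length \<alpha>)\<close> from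
  \<open>euler_op_symbol\<close> vanish on all words of length \<open>k\<close>; for
  \<open>k = 0\<close> nothing else is left.\<close>

lemma euler_op_lower:
  assumes D: "D \<in> diff_ops_le k p q"
  shows "euler_op \<delta> p D + (real k - real p + real q) *\<^sub>R D \<in> diff_ops_less k p q" (is "?V \<in> _")
proof -
  have V: "?V \<in> diff_ops_le k p q"
    by (intro subspace_add[OF subspace_diff_ops_le] subspace_scale[OF subspace_diff_ops_le] euler_op_diff_ops_le D)
  obtain A where A0: "(\<forall>\<alpha> J I. smooth (\<lambda>x. A \<alpha> x J I)) \<and>
    (\<forall>P \<in> sym_tensor_fields p. \<forall>x J. length J = q \<longrightarrow>
      euler_op \<delta> p D P x J + (real k - real p + real q) * D P x J = (\<Sum>\<alpha> | length \<alpha> \<le> k. \<Sum>I | length I = p. (real k - real (length \<alpha>)) * A \<alpha> x J I * partials \<alpha> (\<lambda>y. P y I) x))"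
    using euler_op_symbol[OF D, of \<delta>] by (rule exE)
  have A: "?V P x J = (\<Sum>\<alpha> | length \<alpha> \<le> k. \<Sum>I | length I = p. (real k - real (length \<alpha>)) * A \<alpha> x J I * partials \<alpha> (\<lambda>y. P y I) x)"
    if "P \<in> sym_tensor_fields p" "length J = q" for P x J
    using A0[THEN conjunct2, rule_format, OF that] by (simp add: scaleR_fun_apply)
  show ?thesis
  proof (cases k)
    case 0
    have "?V P x J = 0" for P x J
    proof (cases "P \<in> sym_tensor_fields p")
      case P: True
      show ?thesis
      proof (cases "length J = q")
        case True
        then show ?thesis unfolding A[OF P True] by (simp add: 0)
      next
        case False
        then show ?thesis
          using sym_tensorsD(1)[of "?V P x" q J] diff_ops_leD(1)[OF V P] unfolding sym_tensor_fields_def by blast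
      qed
    next
      case False
      then show ?thesis using diff_ops_leD(2)[OF V False] by simp
    qed
    then have "?V = 0" by (intro ext) simp
    then show ?thesis by (simp add: diff_ops_less_def 0)
  next
    case (Suc l)
    have "?V \<in> diff_ops_le l p q"
    proof (rule diff_ops_leI)
      fix J :: "'a list" assume J: "length J = q"
      show "diff_form l p (\<lambda>P x. ?V P x J)"
      proof (rule diff_form_cong)
        show "diff_form l p (\<lambda>P x. \<Sum>\<alpha> | length \<alpha> \<le> l. \<Sum>I | length I = p.
            ((real k - real (length \<alpha>)) * A \<alpha> x J I) * partials \<alpha> (\<lambda>y. P y I) x)"
          by (intro diff_form_sum diff_form_mult diff_form_partials_component smooth_cmult A0[THEN conjunct1, rule_format]) simp
        fix P :: "'a tfield" and x assume P: "P \<in> sym_tensor_fields p"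
        show "?V P x J = (\<Sum>\<alpha> | length \<alpha> \<le> l. \<Sum>I | length I = p.
            ((real k - real (length \<alpha>)) * A \<alpha> x J I) * partials \<alpha> (\<lambda>y. P y I) x)"
          unfolding A[OF P J] unfolding Suc
          by (rule sum.mono_neutral_cong_right) (auto simp: finite_words le_Suc_eq)
      qed
    qed (use diff_ops_leD[OF V] in blast)+
    then show ?thesis by (simp add: diff_ops_less_def Suc)
  qed
qed

section \<open>The homotopy\<close>

lemma (in ce_module) submodule:
  assumes "V \<subseteq> W" "subspace V" "\<And>X w. X \<in> g \<Longrightarrow> w \<in> V \<Longrightarrow> act X w \<in> V"
  shows "ce_module g br act V"
  by unfold_locales
    (intro assms g_subspace br_closed br_lin br_antisym jacobi act_lin_left act_lin act_br subsetD[OF assms(1)]; assumption)+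

lemma diff_opsE:
  assumes "D \<in> diff_ops p q" obtains k where "D \<in> diff_ops_le k p q"
  using assms unfolding diff_ops_def by (rule UN_E)

lemma diff_opsI: "D \<in> diff_ops_le k p q \<Longrightarrow> D \<in> diff_ops p q"
  unfolding diff_ops_def by (rule UN_I[OF UNIV_I])

lemma diff_ops_common:
  assumes "D \<in> diff_ops p q" "D' \<in> diff_ops p q"
  obtains k where "D \<in> diff_ops_le k p q" "D' \<in> diff_ops_le k p q"
proof -
  obtain k where k: "D \<in> diff_ops_le k p q" using assms(1) by (rule diff_opsE)
  obtain k' where k': "D' \<in> diff_ops_le k' p q" using assms(2) by (rule diff_opsE)
  show ?thesis
    by (rule that[of "max k k'"])
      (rule subsetD[OF diff_ops_le_mono k] subsetD[OF diff_ops_le_mono k'], simp)+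
qed

lemma subspace_diff_ops: "subspace (diff_ops p q :: ('m::finite tfield \<Rightarrow> 'm tfield) set)"
  unfolding subspace_def
proof (intro conjI ballI allI)
  fix D D' :: "'m tfield \<Rightarrow> 'm tfield" and c :: real
  show "(0 :: 'm tfield \<Rightarrow> 'm tfield) \<in> diff_ops p q"
    by (rule diff_opsI[of _ 0]) (rule subspace_0[OF subspace_diff_ops_le])
  assume D: "D \<in> diff_ops p q"
  then obtain k where "D \<in> diff_ops_le k p q" by (rule diff_opsE)
  then show "c *\<^sub>R D \<in> diff_ops p q"
    by (intro diff_opsI[of _ k] subspace_scale[OF subspace_diff_ops_le])
  assume "D' \<in> diff_ops p q"
  with D show "D + D' \<in> diff_ops p q"
    by (rule diff_ops_common) (rule diff_opsI, rule subspace_add[OF subspace_diff_ops_le])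
qed

lemma ce_module_diff_ops: "ce_module sl_fields lie_bracket (op_action \<delta> p) (diff_ops p q)"
proof
  note sm = smooth_field_sl
  fix X Y Z :: "'a vfield" and a b :: real and w w' :: "'a tfield \<Rightarrow> 'a tfield"
  show "subspace (sl_fields :: 'a vfield set)" by (rule subspace_sl)
  show "subspace (diff_ops p q :: ('a tfield \<Rightarrow> 'a tfield) set)" by (rule subspace_diff_ops)
  assume X: "X \<in> sl_fields"
  show "op_action \<delta> p X w \<in> diff_ops p q" if "w \<in> diff_ops p q"
    by (rule diff_opsE[OF that]) (rule diff_opsI, rule op_action_diff_ops_le[OF sm[OF X]])
  show "op_action \<delta> p X (a *\<^sub>R w + b *\<^sub>R w') = a *\<^sub>R op_action \<delta> p X w + b *\<^sub>R op_action \<delta> p X w'"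
    if "w \<in> diff_ops p q" "w' \<in> diff_ops p q"
    by (rule diff_ops_common[OF that]) (rule op_action_lin)
  assume Y: "Y \<in> sl_fields"
  show "lie_bracket X Y \<in> sl_fields" by (rule lie_bracket_sl[OF X Y])
  show "lie_bracket X Y = - lie_bracket Y X" by (rule lie_bracket_antisym)
  show "op_action \<delta> p (a *\<^sub>R X + b *\<^sub>R Y) w = a *\<^sub>R op_action \<delta> p X w + b *\<^sub>R op_action \<delta> p Y w"
    if "w \<in> diff_ops p q"
    by (rule diff_opsE[OF that]) (rule op_action_lin_left[OF sm[OF X] sm[OF Y]])
  show "op_action \<delta> p (lie_bracket X Y) w = op_action \<delta> p X (op_action \<delta> p Y w) - op_action \<delta> p Y (op_action \<delta> p X w)"
    if "w \<in> diff_ops p q"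
    by (rule diff_opsE[OF that]) (rule op_action_lie_bracket[OF sm[OF X] sm[OF Y]])
  assume Z: "Z \<in> sl_fields"
  show "lie_bracket (a *\<^sub>R X + b *\<^sub>R Y) Z = a *\<^sub>R lie_bracket X Z + b *\<^sub>R lie_bracket Y Z"
    by (rule lie_bracket_lin[OF X Y Z])
  show "lie_bracket (lie_bracket X Y) Z = lie_bracket X (lie_bracket Y Z) - lie_bracket Y (lie_bracket X Z)"
    by (rule lie_bracket_jacobi[OF sm[OF X] sm[OF Y] sm[OF Z]])
qed

lemma ce_module_diff_ops_le: "ce_module sl_fields lie_bracket (op_action \<delta> p) (diff_ops_le k p q)"
  by (rule ce_module.submodule[OF ce_module_diff_ops[of \<delta> p q]])
    (use diff_opsI in blast, rule subspace_diff_ops_le, intro op_action_diff_ops_le smooth_field_sl)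

lemma ce_module_diff_ops_less: "ce_module sl_fields lie_bracket (op_action \<delta> p) (diff_ops_less k p q)"
proof (cases "k = 0")
  case True
  interpret ce_module sl_fields lie_bracket "op_action \<delta> p" "diff_ops p q" by (rule ce_module_diff_ops)
  have "ce_module sl_fields lie_bracket (op_action \<delta> p) {0}"
    by (rule submodule) (auto simp: subspace_0[OF subspace_diff_ops] act_0)
  then show ?thesis by (simp add: diff_ops_less_def True)
next
  case False
  then show ?thesis by (simp add: diff_ops_less_def ce_module_diff_ops_le)
qed

lemma ce_cochains_comp:
  assumes c: "c \<in> ce_cochains g W u"
    and W: "\<And>w. w \<in> W \<Longrightarrow> \<mu> w \<in> V" and zero: "\<mu> 0 = 0"
    and lin: "\<And>a b w w'. w \<in> W \<Longrightarrow> w' \<in> W \<Longrightarrow> \<mu> (a *\<^sub>R w + b *\<^sub>R w') = a *\<^sub>R \<mu> w + b *\<^sub>R \<mu> w'"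
  shows "\<mu> \<circ> c \<in> ce_cochains g V u"
  unfolding ce_cochains_def o_def
proof (intro CollectI conjI allI impI; (elim conjE)?)
  fix Xs assume "length Xs = u" "set Xs \<subseteq> g"
  then show "\<mu> (c Xs) \<in> V" by (intro W ce_cochains_in[OF c])
next
  fix Xs assume "\<not> (length Xs = u \<and> set Xs \<subseteq> g)"
  then show "\<mu> (c Xs) = 0" using ce_cochains_outside[OF c] zero by simp
next
  fix Xs i a b Y Z
  assume A: "length Xs = u" "set Xs \<subseteq> g" "i < u" "Y \<in> g" "Z \<in> g"
  have "c (Xs[i := Y]) \<in> W" if "Y \<in> g" for Y
    by (rule ce_cochains_in[OF c]) (use A that set_update_subset_insert[of Xs i Y] in auto)
  then show "\<mu> (c (Xs[i := a *\<^sub>R Y + b *\<^sub>R Z])) = a *\<^sub>R \<mu> (c (Xs[i := Y])) + b *\<^sub>R \<mu> (c (Xs[i := Z]))"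
    using A by (simp add: ce_cochains_lin[OF c] lin)
next
  fix Xs i j
  assume "length Xs = u" "set Xs \<subseteq> g" "i < j" "j < u" "Xs ! i = Xs ! j"
  then show "\<mu> (c Xs) = 0" using ce_cochains_alt[OF c] zero by simp
qed

text \<open>
  Contraction with the Euler field centred at the point of evaluation, \<open>E - \<Sum>i. x\<^sub>i \<partial>\<^sub>i\<close>; it vanishes
  at that point, so this is contraction with an element of the isotropy algebra.
\<close>

definition centred_contraction ::
  "('m::finite vfield list \<Rightarrow> ('m tfield \<Rightarrow> 'm tfield)) \<Rightarrow> 'm vfield list \<Rightarrow> ('m tfield \<Rightarrow> 'm tfield)" where
  "centred_contraction c = ce_insert euler_field c
     - (\<Sum>i\<in>UNIV. mul_op (\<lambda>x. x $ i) \<circ> ce_insert (coord_field i) c)"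

lemma mul_op_comp_cochains:
  assumes "c \<in> ce_cochains g W u" "\<And>w. w \<in> W \<Longrightarrow> mul_op f w \<in> W"
  shows "mul_op f \<circ> c \<in> ce_cochains g W u"
  by (rule ce_cochains_comp[OF assms(1)])
    (simp_all add: assms(2) linear_0[OF linear_mul_op] linear_add[OF linear_mul_op] linear_scale[OF linear_mul_op])

text \<open>Stated for any module closed under multiplication by coordinates, because it serves both
  the operators of order at most \<open>k\<close> and those of lower order.\<close>

lemma centred_contraction_cochains:
  assumes c: "c \<in> ce_cochains sl_fields W (Suc u)" and W: "subspace W"
    and mul: "\<And>i w. w \<in> W \<Longrightarrow> mul_op (\<lambda>x. x $ i) w \<in> W"
  shows "centred_contraction c \<in> ce_cochains sl_fields W u"
  unfolding centred_contraction_def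
  by (intro subspace_diff[OF ce_cochains_subspace[OF W]] subspace_sum[OF ce_cochains_subspace[OF W]]
      mul_op_comp_cochains ce_cochains_SucD(3)[OF c] euler_field_sl coord_field_sl mul)

lemma sum_linear_on:
  fixes \<phi> :: "'g::real_vector \<Rightarrow> real"
  assumes g: "subspace g" and lin: "\<And>a b Y Z. Y \<in> g \<Longrightarrow> Z \<in> g \<Longrightarrow> \<phi> (a *\<^sub>R Y + b *\<^sub>R Z) = a * \<phi> Y + b * \<phi> Z"
    and Y: "\<And>i. i \<in> I \<Longrightarrow> Y i \<in> g" and I: "finite I"
  shows "\<phi> (\<Sum>i\<in>I. c i *\<^sub>R Y i) = (\<Sum>i\<in>I. c i * \<phi> (Y i))"
  using I Y
proof (induction I rule: finite_induct)
  case empty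
  show ?case using lin[of 0 0 0 0] subspace_0[OF g] by simp
next
  case (insert i I)
  have "(\<Sum>i\<in>I. c i *\<^sub>R Y i) \<in> g"
    using insert by (intro subspace_sum[OF g] subspace_scale[OF g]) auto
  then show ?case
    using insert lin[of "Y i" "\<Sum>i\<in>I. c i *\<^sub>R Y i" "c i" 1] by simp
qed

text \<open>Once \<open>P\<close>, \<open>x\<close> and \<open>J\<close> are fixed, the coordinates
  of \<open>x\<close> are scalars and can be moved into an argument of the cochain. Before
  evaluation they are functions, which do not act on \<open>sl_fields\<close>.\<close>

lemma ce_cochains_quad_part:
  fixes b :: "'m::finite vfield list \<Rightarrow> ('m tfield \<Rightarrow> 'm tfield)"
  assumes b: "b \<in> ce_cochains sl_fields W u" and Xs: "length Xs = u" "set Xs \<subseteq> sl_fields" and j: "j < u"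
    and X: "X \<in> sl_fields"
  shows "b (Xs[j := quad_part x X]) P x J
    = b (Xs[j := lie_bracket euler_field X]) P x J
      - (\<Sum>i\<in>UNIV. x $ i * b (Xs[j := lie_bracket (coord_field i) X]) P x J)
      + (\<Sum>i\<in>UNIV. X x $ i * b (Xs[j := coord_field i]) P x J)"
proof -
  define \<phi> where "\<phi> Z = b (Xs[j := Z]) P x J" for Z
  have lin: "\<phi> (a *\<^sub>R Y + c *\<^sub>R Z) = a * \<phi> Y + c * \<phi> Z" if "Y \<in> sl_fields" "Z \<in> sl_fields" for a c Y Z
    using ce_cochains_lin[OF b Xs j that, of a c] by (simp add: \<phi>_def scaleR_fun_apply)
  have add: "\<phi> (Y + Z) = \<phi> Y + \<phi> Z" "\<phi> (Y - Z) = \<phi> Y - \<phi> Z" if "Y \<in> sl_fields" "Z \<in> sl_fields" for Y Z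
    using lin[OF that, of 1 1] lin[OF that, of 1 "-1"] by simp_all
  note sub = subspace_diff[OF subspace_sl] subspace_sum[OF subspace_sl] subspace_scale[OF subspace_sl]
  note sl = lie_bracket_sl euler_field_sl coord_field_sl X
  have 1: "\<phi> (\<Sum>i\<in>UNIV. x $ i *\<^sub>R lie_bracket (coord_field i) X) = (\<Sum>i\<in>UNIV. x $ i * \<phi> (lie_bracket (coord_field i) X))"
    by (rule sum_linear_on[where \<phi> = \<phi>, OF subspace_sl lin]) (simp_all add: sl)
  have 2: "\<phi> (\<Sum>i\<in>UNIV. X x $ i *\<^sub>R coord_field i) = (\<Sum>i\<in>UNIV. X x $ i * \<phi> (coord_field i))"
    by (rule sum_linear_on[where \<phi> = \<phi>, OF subspace_sl lin]) (simp_all add: sl)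
  have "\<phi> (quad_part x X) = \<phi> (lie_bracket euler_field X)
      - \<phi> (\<Sum>i\<in>UNIV. x $ i *\<^sub>R lie_bracket (coord_field i) X) + \<phi> (\<Sum>i\<in>UNIV. X x $ i *\<^sub>R coord_field i)"
    unfolding quad_part_def by (subst add | intro sub sl | rule refl)+
  then show ?thesis unfolding 1 2 unfolding \<phi>_def .
qed

lemma euler_op_lin:
  assumes D: "D \<in> diff_ops_le k p q" and D': "D' \<in> diff_ops_le k p q"
  shows "euler_op \<delta> p (a *\<^sub>R D + b *\<^sub>R D') = a *\<^sub>R euler_op \<delta> p D + b *\<^sub>R euler_op \<delta> p D'"
  unfolding euler_op_def op_action_lin[OF D D']
  by (simp add: linear_add[OF linear_mul_op] linear_scale[OF linear_mul_op] sum.distrib scaleR_sum_right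
      scaleR_diff_right scaleR_add_right)

text \<open>The summand "differential of the contraction" of the homotopy formula. In degree 0 there
  is no argument to contract, and the summand is 0.\<close>

definition bracket_out :: "real \<Rightarrow> nat \<Rightarrow> nat \<Rightarrow> ('m::finite vfield list \<Rightarrow> ('m tfield \<Rightarrow> 'm tfield)) \<Rightarrow> _" where
  "bracket_out \<delta> p u c = (if u = 0 then 0 else ce_diff sl_fields lie_bracket (op_action \<delta> p) (u - 1) (centred_contraction c))"

text \<open>Cartan's formula is taken for the Euler field and, weighted by \<open>x $ i\<close>, for
  the translations. The actions give \<open>euler_op\<close>, the brackets give two parts of
  \<open>quad_part\<close>, and the Leibniz terms of the weights give the third.\<close>

lemma centred_contraction_homotopy:
  fixes b :: "'m::finite vfield list \<Rightarrow> ('m tfield \<Rightarrow> 'm tfield)"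
  assumes b: "b \<in> ce_cochains sl_fields (diff_ops_le k p q) u"
    and Xs: "length Xs = u" "set Xs \<subseteq> sl_fields"
  shows "(euler_op \<delta> p (b Xs) - centred_contraction (ce_diff sl_fields lie_bracket (op_action \<delta> p) u b) Xs
      - bracket_out \<delta> p u b Xs) P x J = (\<Sum>j<u. b (Xs[j := quad_part x (Xs ! j)]) P x J)"
proof -
  interpret ce_module sl_fields lie_bracket "op_action \<delta> p" "diff_ops_le k p q :: ('m tfield \<Rightarrow> 'm tfield) set"
    by (rule ce_module_diff_ops_le)
  note E = euler_field_sl and c = coord_field_sl
  have app: "centred_contraction f Ys P x J = f (euler_field # Ys) P x J - (\<Sum>i\<in>UNIV. x $ i * f (coord_field i # Ys) P x J)"
    for f and Ys :: "'m vfield list"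
    by (simp add: centred_contraction_def sum_fun_apply mul_op_def ce_insert_def)
  have nth: "Xs ! j \<in> sl_fields" if "j < u" for j using Xs that nth_mem by blast
  have L: "L Y b Xs = op_action \<delta> p Y (b Xs) - (\<Sum>j<u. b (Xs[j := lie_bracket Y (Xs ! j)]))" if Y: "Y \<in> sl_fields" for Y
  proof -
    have "b (Xs[j := lie_bracket Y (Xs ! j)]) = (-1) ^ j *\<^sub>R b (lie_bracket Y (Xs ! j) # nths Xs (- {j}))" if "j < u" for j
      by (rule ce_update_eq_move[OF g_subspace b Xs that lie_bracket_sl[OF Y nth[OF that]]])
    then show ?thesis by (simp add: L_sum[OF b Xs Y])
  qed
  have eul: "euler_op \<delta> p (b Xs) P x J = op_action \<delta> p euler_field (b Xs) P x J
      - (\<Sum>i\<in>UNIV. x $ i * op_action \<delta> p (coord_field i) (b Xs) P x J)"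
    by (simp add: euler_op_def sum_fun_apply mul_op_def)
  have rhs: "(\<Sum>j<u. b (Xs[j := quad_part x (Xs ! j)]) P x J)
      = (\<Sum>j<u. b (Xs[j := lie_bracket euler_field (Xs ! j)]) P x J)
        - (\<Sum>i\<in>UNIV. x $ i * (\<Sum>j<u. b (Xs[j := lie_bracket (coord_field i) (Xs ! j)]) P x J))
        + (\<Sum>i\<in>UNIV. \<Sum>j<u. (Xs ! j) x $ i * b (Xs[j := coord_field i]) P x J)"
  proof -
    have sw: "(\<Sum>i\<in>UNIV. x $ i * (\<Sum>j<u. f i j)) = (\<Sum>j<u. \<Sum>i\<in>UNIV. x $ i * f i j)" for f
      unfolding sum_distrib_left by (rule sum.swap)
    have sw': "(\<Sum>i\<in>UNIV. \<Sum>j<u. f i j) = (\<Sum>j<u. \<Sum>i\<in>UNIV. f i j)" for f :: "'m \<Rightarrow> nat \<Rightarrow> real"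
      by (rule sum.swap)
    show ?thesis
      unfolding sw sw' by (simp add: ce_cochains_quad_part[OF b Xs] nth sum.distrib sum_subtractf)
  qed
  \<comment> \<open>The centred Lie derivative of the cochain. Compared with \<open>rhs\<close>,
    only the constant parts \<open>Xs ! j\<close> at \<open>x\<close> are still missing.\<close>
  have Leul: "L euler_field b Xs P x J - (\<Sum>i\<in>UNIV. x $ i * L (coord_field i) b Xs P x J)
    = euler_op \<delta> p (b Xs) P x J - (\<Sum>j<u. b (Xs[j := lie_bracket euler_field (Xs ! j)]) P x J)
        + (\<Sum>i\<in>UNIV. x $ i * (\<Sum>j<u. b (Xs[j := lie_bracket (coord_field i) (Xs ! j)]) P x J))"
    by (simp add: eul L[OF E] L[OF c] sum_fun_apply right_diff_distrib sum_subtractf)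
  show ?thesis
  proof (cases u)
    case 0
    have "d 0 b (Y # Xs) = L Y b Xs" if "Y \<in> sl_fields" for Y
      using fun_cong[OF ins_d_0[OF b[unfolded 0] that], of Xs] by (simp add: ce_insert_def)
    then show ?thesis
      using Leul by (simp add: app 0 bracket_out_def E c)
  next
    case (Suc v)
    note b' = b[unfolded Suc]
    have D: "d u b (Y # Xs) = L Y b Xs - d v (ins Y b) Xs" if "Y \<in> sl_fields" for Y
      using fun_cong[OF ins_d_Suc[OF b' that], of Xs] unfolding Suc by (simp add: ce_insert_def)
    have mulW: "mul_op (\<lambda>x. x $ i) w \<in> diff_ops_le k p q" if "w \<in> diff_ops_le k p q" for i and w :: "'m tfield \<Rightarrow> 'm tfield"
      by (rule mul_op_diff_ops_le[OF smooth_coord that])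
    have insC: "ins Y b \<in> C v" if "Y \<in> sl_fields" for Y by (rule ins_C[OF b' that])
    have mulC: "mul_op (\<lambda>x. x $ i) \<circ> ins (coord_field i) b \<in> C v" for i
      by (rule mul_op_comp_cochains[OF insC[OF c] mulW])
    have dsum: "d v (\<Sum>i\<in>I. h i) = (\<Sum>i\<in>I. d v (h i))" if "finite I" "\<And>i. i \<in> I \<Longrightarrow> h i \<in> C v" for I :: "'m set" and h
      using that by (induction I rule: finite_induct) (simp_all add: d_0 d_add subspace_sum[OF C_subspace])
    have "d v (centred_contraction b) = d v (ins euler_field b) - (\<Sum>i\<in>UNIV. d v (mul_op (\<lambda>x. x $ i) \<circ> ins (coord_field i) b))"
      unfolding centred_contraction_def
      by (simp add: d_diff[of _ v] dsum insC[OF E] mulC subspace_sum[OF C_subspace])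
    then have bo: "bracket_out \<delta> p u b Xs P x J = d v (ins euler_field b) Xs P x J
        - (\<Sum>i\<in>UNIV. d v (mul_op (\<lambda>x. x $ i) \<circ> ins (coord_field i) b) Xs P x J)"
      by (simp add: bracket_out_def Suc sum_fun_apply)
    \<comment> \<open>The missing constant parts: the derivative of the coordinate
      \<open>x $ i\<close> along the argument \<open>Xs ! j\<close> is the corresponding component
      of that argument.\<close>
    have sm: "d v (mul_op (\<lambda>x. x $ i) \<circ> ins (coord_field i) b) Xs P x J
      = x $ i * d v (ins (coord_field i) b) Xs P x J + (\<Sum>j<u. (Xs ! j) x $ i * b (Xs[j := coord_field i]) P x J)" for i
    proof -
      have "d v (mul_op (\<lambda>x. x $ i) \<circ> ins (coord_field i) b) Xs = mul_op (\<lambda>x. x $ i) (d v (ins (coord_field i) b) Xs)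
        + (\<Sum>j\<le>v. (-1) ^ j *\<^sub>R mul_op (along (Xs ! j) (\<lambda>x. x $ i)) (ins (coord_field i) b (nths Xs (- {j}))))"
        by (rule d_smul[OF insC[OF c]]) (use Xs Suc in \<open>simp_all add: op_action_mul_op[OF smooth_coord] linear_mul_op\<close>)
      moreover have "b (Xs[j := coord_field i]) = (-1) ^ j *\<^sub>R ins (coord_field i) b (nths Xs (- {j}))" if "j < u" for j
        using ce_update_eq_move[OF g_subspace b Xs that c] by (simp add: ce_insert_def)
      moreover have "along (Xs ! j) (\<lambda>x. x $ i) = (\<lambda>x. (Xs ! j) x $ i)" for j
        by (rule ext) (simp add: along_real partial_coord if_distrib if_distribR cong: if_cong)
      ultimately show ?thesis
        by (simp add: Suc lessThan_Suc_atMost sum_fun_apply mul_op_def scaleR_fun_apply mult_ac)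
    qed
    have "(euler_op \<delta> p (b Xs) - centred_contraction (d u b) Xs - bracket_out \<delta> p u b Xs) P x J
      = euler_op \<delta> p (b Xs) P x J - (L euler_field b Xs P x J - (\<Sum>i\<in>UNIV. x $ i * L (coord_field i) b Xs P x J))
        + (\<Sum>i\<in>UNIV. \<Sum>j<u. (Xs ! j) x $ i * b (Xs[j := coord_field i]) P x J)"
      by (simp add: app bo sm D[OF E] D[OF c] right_diff_distrib sum_subtractf sum.distrib)
    then show ?thesis unfolding Leul rhs by simp
  qed
qed

text \<open>
  A product of the factors \<open>N - s\<close>, where \<open>N\<close> is the derivation extending an idempotent \<open>T\<close>,
  kills multilinear forms: \<open>N\<close> counts the arguments in the range of \<open>T\<close>.
\<close>

lemma idempotent_derivation_vanishes:
  fixes \<beta> :: "nat \<Rightarrow> 'g::real_vector list \<Rightarrow> real"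
  assumes g: "subspace g" and T: "\<And>X. X \<in> g \<Longrightarrow> T X \<in> g" "\<And>X. X \<in> g \<Longrightarrow> T (T X) = T X"
    "\<And>X. X \<in> g \<Longrightarrow> T (X - T X) = 0"
    and lin: "\<And>s Xs i a b Y Z. length Xs = u \<Longrightarrow> set Xs \<subseteq> g \<Longrightarrow> i < u \<Longrightarrow> Y \<in> g \<Longrightarrow> Z \<in> g \<Longrightarrow>
      \<beta> s (Xs[i := a *\<^sub>R Y + b *\<^sub>R Z]) = a * \<beta> s (Xs[i := Y]) + b * \<beta> s (Xs[i := Z])"
    and rec: "\<And>s Xs. length Xs = u \<Longrightarrow> set Xs \<subseteq> g \<Longrightarrow>
      \<beta> (Suc s) Xs = (\<Sum>j<u. \<beta> s (Xs[j := T (Xs ! j)])) - real s * \<beta> s Xs"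
    and Xs: "length Xs = u" "set Xs \<subseteq> g"
  shows "\<beta> (Suc u) Xs = 0"
proof -
  have pure: "\<beta> (Suc u) Xs = 0"
    if Xs: "length Xs = u" "set Xs \<subseteq> g" and p: "\<And>j. j < u \<Longrightarrow> T (Xs ! j) = Xs ! j \<or> T (Xs ! j) = 0" for Xs
  proof -
    \<comment> \<open>On a list of eigenvectors of \<open>T\<close> the derivation is multiplication
      by the number of arguments that \<open>T\<close> fixes.\<close>
    define S where "S = {j. j < u \<and> T (Xs ! j) = Xs ! j}"
    have S: "S \<subseteq> {..<u}" "finite S" by (auto simp: S_def)
    have step: "\<beta> (Suc s) Xs = (real (card S) - real s) * \<beta> s Xs" for s
    proof -
      have "\<beta> s (Xs[j := T (Xs ! j)]) = (if j \<in> S then \<beta> s Xs else 0)" if j: "j < u" for j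
      proof (cases "j \<in> S")
        case True
        then show ?thesis by (simp add: S_def)
      next
        case False
        then have "T (Xs ! j) = 0" using p j by (auto simp: S_def)
        then show ?thesis using lin[OF Xs j subspace_0[OF g] subspace_0[OF g], of s 0 0] False by simp
      qed
      then have "(\<Sum>j<u. \<beta> s (Xs[j := T (Xs ! j)])) = (\<Sum>j<u. if j \<in> S then \<beta> s Xs else 0)"
        by (intro sum.cong) auto
      also have "\<dots> = real (card S) * \<beta> s Xs"
        using S by (simp add: sum.If_cases Int_absorb1)
      finally show ?thesis by (simp add: rec[OF Xs] left_diff_distrib)
    qed
    \<comment> \<open>The factor at \<open>s = card S\<close> is 0, and all later stages stay 0. As
      \<open>card S \<le> u\<close>, stage \<open>Suc u\<close> is among them.\<close>
    have "\<beta> (Suc (card S + m)) Xs = 0" for m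
      by (induction m) (simp_all add: step)
    moreover have "card S \<le> u" using card_mono[OF _ S(1)] by simp
    ultimately show ?thesis by (metis le_add_diff_inverse)
  qed
  \<comment> \<open>Induction on the number \<open>m\<close> of leading arguments not yet known to
    be eigenvectors. By linearity one argument \<open>X\<close> at a time is split into
    \<open>T X\<close> and \<open>X - T X\<close>.\<close>
  have "\<beta> (Suc u) Xs = 0"
    if "m \<le> u" "length Xs = u" "set Xs \<subseteq> g" "\<And>j. m \<le> j \<Longrightarrow> j < u \<Longrightarrow> T (Xs ! j) = Xs ! j \<or> T (Xs ! j) = 0" for m Xs
    using that
  proof (induction m arbitrary: Xs)
    case 0
    then show ?case using pure by simp
  next
    case (Suc m)
    have m: "m < u" and Xm: "Xs ! m \<in> g" using Suc.prems nth_mem by auto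
    let ?X = "Xs ! m"
    have TX: "T ?X \<in> g" "?X - T ?X \<in> g" using T Xm subspace_diff[OF g] by auto
    have IH: "\<beta> (Suc u) (Xs[m := Y]) = 0" if "Y \<in> g" "T Y = Y \<or> T Y = 0" for Y
    proof (rule Suc.IH)
      show "set (Xs[m := Y]) \<subseteq> g" using Suc.prems(3) that(1) set_update_subset_insert[of Xs m Y] by auto
      show "T (Xs[m := Y] ! j) = Xs[m := Y] ! j \<or> T (Xs[m := Y] ! j) = 0" if "m \<le> j" "j < u" for j
        using Suc.prems(2,4) that \<open>T Y = Y \<or> T Y = 0\<close> by (cases "j = m") auto
    qed (use Suc.prems in auto)
    have "\<beta> (Suc u) (Xs[m := 1 *\<^sub>R T ?X + 1 *\<^sub>R (?X - T ?X)]) = 0"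
      unfolding lin[OF Suc.prems(2,3) m TX] using IH[OF TX(1)] IH[OF TX(2)] T Xm by simp
    then show ?case by simp
  qed
  from this[of u Xs] Xs show ?thesis by simp
qed

text \<open>The hypothesis \<open>p < q + k\<close> says that \<open>\<mu> = k - (p - q)\<close> is
  positive, so none of the factors \<open>\<mu> + s\<close> met below vanishes. The differential of
  \<open>b\<close> may be nonzero of lower order, since injectivity in cohomology uses such
  cochains.\<close>

lemma reduce_order:
  fixes b :: "'m::finite vfield list \<Rightarrow> ('m tfield \<Rightarrow> 'm tfield)"
  assumes k: "p < q + k"
    and b: "b \<in> ce_cochains sl_fields (diff_ops_le k p q) u"
    and db: "ce_diff sl_fields lie_bracket (op_action \<delta> p) u b \<in> ce_cochains sl_fields (diff_ops_less k p q) (Suc u)"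
  shows "\<exists>e \<in> ce_coboundaries sl_fields lie_bracket (op_action \<delta> p) (diff_ops_le k p q) u.
    b - e \<in> ce_cochains sl_fields (diff_ops_less k p q) u"
proof -
  interpret W: ce_module sl_fields lie_bracket "op_action \<delta> p" "diff_ops_le k p q :: ('m tfield \<Rightarrow> 'm tfield) set"
    by (rule ce_module_diff_ops_le)
  interpret V: ce_module sl_fields lie_bracket "op_action \<delta> p" "diff_ops_less k p q :: ('m tfield \<Rightarrow> 'm tfield) set"
    by (rule ce_module_diff_ops_less)
  have VW: "(diff_ops_less k p q :: ('m tfield \<Rightarrow> 'm tfield) set) \<subseteq> diff_ops_le k p q"
    using subspace_0[OF subspace_diff_ops_le, of k p q] diff_ops_le_mono[of "k - 1" k p q]
    by (auto simp: diff_ops_less_def)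
  have VWC: "V.C n \<subseteq> W.C n" for n by (rule ce_cochains_mono[OF VW])
  have mulW: "mul_op (\<lambda>x. x $ i) w \<in> diff_ops_le k p q" if "w \<in> diff_ops_le k p q" for i and w :: "'m tfield \<Rightarrow> 'm tfield"
    by (rule mul_op_diff_ops_le[OF smooth_coord that])
  have mulV: "mul_op (\<lambda>x. x $ i) w \<in> diff_ops_less k p q" if "w \<in> diff_ops_less k p q" for i and w :: "'m tfield \<Rightarrow> 'm tfield"
    using that by (auto simp: diff_ops_less_def linear_0[OF linear_mul_op] intro: mul_op_diff_ops_le split: if_splits)
  define \<mu> where "\<mu> = real k - real p + real q"
  have \<mu>: "\<mu> > 0" using k by (simp add: \<mu>_def)
  define R where "R = {e + r | e r. e \<in> W.B u \<and> r \<in> V.C u}"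
  have R: "subspace R" unfolding R_def by (rule subspace_sums[OF W.B_subspace V.C_subspace])
  have VR: "r \<in> R" if "r \<in> V.C u" for r
    unfolding R_def by (rule CollectI, rule exI[of _ 0], rule exI[of _ r]) (simp add: that subspace_0[OF W.B_subspace])
  have BR: "e \<in> R" if "e \<in> W.B u" for e
    unfolding R_def by (rule CollectI, rule exI[of _ e], rule exI[of _ 0]) (simp add: that subspace_0[OF V.C_subspace])
  \<comment> \<open>By the homotopy formula, \<open>N c\<close> at the point \<open>x\<close> is the
    derivation with \<open>quad_part x\<close>. This expression for it shows that cochains of order
    \<open>k\<close> and coboundaries are not left.\<close>
  define N where "N c = (euler_op \<delta> p \<circ> c) - centred_contraction (W.d u c) - bracket_out \<delta> p u c" for c
  \<comment> \<open>What remains of \<open>N c + \<mu> *\<^sub>R c\<close> modulo coboundaries. It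
    has lower order: \<open>euler_op\<close> is \<open>- \<mu>\<close> in the top order, and the
    contracted differential of \<open>c\<close> has lower order by assumption.\<close>
  define lo where "lo c = ((\<lambda>w. euler_op \<delta> p w + \<mu> *\<^sub>R w) \<circ> c) - centred_contraction (W.d u c)" for c
  have Nlo: "N c = lo c - bracket_out \<delta> p u c - \<mu> *\<^sub>R c" for c
    by (simp add: N_def lo_def fun_eq_iff scaleR_fun_apply)
  have bo: "bracket_out \<delta> p u c \<in> W.B u" if "c \<in> W.C u" for c
    using that by (cases u) (auto simp: bracket_out_def intro!: centred_contraction_cochains W.W_subspace mulW)
  have lo: "lo c \<in> V.C u" if c: "c \<in> W.C u" "W.d u c \<in> V.C (Suc u)" for c
    unfolding lo_def
  proof (rule V.C_diff)
    show "(\<lambda>w. euler_op \<delta> p w + \<mu> *\<^sub>R w) \<circ> c \<in> V.C u"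
    proof (rule ce_cochains_comp[OF c(1)])
      fix w w' :: "'m tfield \<Rightarrow> 'm tfield" and r s :: real
      assume w: "w \<in> diff_ops_le k p q"
      show "euler_op \<delta> p w + \<mu> *\<^sub>R w \<in> diff_ops_less k p q"
        using euler_op_lower[OF w] by (simp add: \<mu>_def)
      assume w': "w' \<in> diff_ops_le k p q"
      show "euler_op \<delta> p (r *\<^sub>R w + s *\<^sub>R w') + \<mu> *\<^sub>R (r *\<^sub>R w + s *\<^sub>R w')
          = r *\<^sub>R (euler_op \<delta> p w + \<mu> *\<^sub>R w) + s *\<^sub>R (euler_op \<delta> p w' + \<mu> *\<^sub>R w')"
        by (simp add: euler_op_lin[OF w w'] algebra_simps)
    next
      show "euler_op \<delta> p 0 + \<mu> *\<^sub>R 0 = 0"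
        using euler_op_lin[where \<delta> = \<delta> and p = p and a = 0 and b = 0, OF subspace_0[OF subspace_diff_ops_le]
          subspace_0[OF subspace_diff_ops_le]]
        by simp
    qed
    show "centred_contraction (W.d u c) \<in> V.C u"
      by (rule centred_contraction_cochains[OF c(2) V.W_subspace mulV])
  qed
  \<comment> \<open>Stage \<open>s\<close> is the falling factorial
    \<open>N (N - 1) ... (N - (s - 1))\<close> applied to \<open>b\<close>.\<close>
  define bs where "bs = rec_nat b (\<lambda>s c. N c - real s *\<^sub>R c)"
  have bs: "bs 0 = b" "bs (Suc s) = N (bs s) - real s *\<^sub>R bs s" for s
    by (simp_all add: bs_def)
  have step: "bs (Suc s) = lo (bs s) - bracket_out \<delta> p u (bs s) - (\<mu> + real s) *\<^sub>R bs s" for s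
    unfolding bs Nlo by (simp add: scaleR_add_left diff_diff_eq)
  \<comment> \<open>The differential must stay of lower order at every stage, as \<open>lo\<close>
    depends on it. It does, because coboundaries are cocycles.\<close>
  have C: "bs s \<in> W.C u \<and> W.d u (bs s) \<in> V.C (Suc u)" for s
  proof (induction s)
    case 0
    then show ?case using b db by (simp add: bs)
  next
    case (Suc s)
    then have c: "bs s \<in> W.C u" and dc: "W.d u (bs s) \<in> V.C (Suc u)" by auto
    note l = lo[OF c dc]
    have lW: "lo (bs s) \<in> W.C u" using l VWC by blast
    note e = bo[OF c]
    have eq: "W.d u (bs (Suc s)) = W.d u (lo (bs s)) - (\<mu> + real s) *\<^sub>R W.d u (bs s)"
      unfolding step
      by (simp add: W.d_diff[of _ u] W.C_diff W.C_scale W.d_scale c lW W.B_C[OF e] W.B_cocycle[OF e])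
    have "W.d u (bs (Suc s)) \<in> V.C (Suc u)"
      unfolding eq by (intro V.C_diff V.C_scale dc V.d_C[OF l])
    moreover have "bs (Suc s) \<in> W.C u"
      unfolding step by (intro W.C_diff W.C_scale c lW W.B_C[OF e])
    ultimately show ?case by blast
  qed
  have "bs (Suc u) = 0"
  proof (intro ext)
    fix Xs P x J
    show "bs (Suc u) Xs P x J = 0 Xs P x J"
    proof (cases "length Xs = u \<and> set Xs \<subseteq> sl_fields")
      case True
      have "bs (Suc u) Xs P x J = 0"
      proof (rule idempotent_derivation_vanishes[where g = sl_fields and T = "quad_part x" and \<beta> = "\<lambda>s Xs. bs s Xs P x J"])
        fix s i a c and Y Z :: "'m vfield" and Xs :: "'m vfield list"
        assume Xs: "length Xs = u" "set Xs \<subseteq> sl_fields"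
        show "bs (Suc s) Xs P x J = (\<Sum>j<u. bs s (Xs[j := quad_part x (Xs ! j)]) P x J) - real s * bs s Xs P x J"
          using centred_contraction_homotopy[where b = "bs s" and \<delta> = \<delta> and P = P and x = x and J = J, OF C[THEN conjunct1] Xs]
          by (simp add: bs N_def scaleR_fun_apply)
        assume "i < u" "Y \<in> sl_fields" "Z \<in> sl_fields"
        from ce_cochains_lin[OF C[THEN conjunct1] Xs this]
        show "bs s (Xs[i := a *\<^sub>R Y + c *\<^sub>R Z]) P x J = a * bs s (Xs[i := Y]) P x J + c * bs s (Xs[i := Z]) P x J"
          by (simp add: scaleR_fun_apply)
      qed (use True in \<open>simp_all add: subspace_sl quad_part_sl quad_part_idem quad_part_diff\<close>)
      then show ?thesis by simp
    next
      case False
      then show ?thesis using ce_cochains_outside[OF C[THEN conjunct1]] by simp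
    qed
  qed
  then have top: "bs (Suc u) \<in> R" using subspace_0[OF R] by simp
  \<comment> \<open>Modulo \<open>R\<close>, stage \<open>Suc s\<close> is
    \<open>- (\<mu> + real s)\<close> times stage \<open>s\<close>. As this factor is not 0,
    membership in \<open>R\<close> passes from the vanishing last stage back to
    \<open>b\<close>.\<close>
  have down: "bs s \<in> R" if "bs (Suc s) \<in> R" for s
  proof -
    have "(\<mu> + real s) *\<^sub>R bs s = lo (bs s) - bracket_out \<delta> p u (bs s) - bs (Suc s)"
      unfolding step by simp
    also have "\<dots> \<in> R"
      by (intro subspace_diff[OF R] VR BR lo bo C[THEN conjunct1] C[THEN conjunct2] that)
    finally have "inverse (\<mu> + real s) *\<^sub>R ((\<mu> + real s) *\<^sub>R bs s) \<in> R"
      by (rule subspace_scale[OF R])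
    then show ?thesis using \<mu> by simp
  qed
  have "bs (Suc u - m) \<in> R" if "m \<le> Suc u" for m
    using that
  proof (induction m)
    case (Suc m)
    then show ?case using down[of "Suc u - Suc m"] by (simp add: Suc_diff_le)
  qed (simp add: top)
  from this[of "Suc u"] have "b \<in> R" by (simp add: bs)
  then obtain e r where "e \<in> W.B u" "r \<in> V.C u" "b = e + r" unfolding R_def by blast
  then show ?thesis by (intro bexI[of _ e]) simp_all
qed

section \<open>Passage to cohomology\<close>

lemma elt_set_plus_absorb:
  fixes B :: "'a::real_vector set"
  assumes B: "subspace B" and b: "b \<in> B" shows "b +o B = B"
proof
  show "b +o B \<subseteq> B"
    using subspace_add[OF B b] by (auto simp: elt_set_plus_def)
  show "B \<subseteq> b +o B"
  proof
    fix x assume "x \<in> B"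
    then have "x - b \<in> B" using b by (rule subspace_diff[OF B])
    then show "x \<in> b +o B" unfolding elt_set_plus_def by (intro CollectI bexI[of _ "x - b"]) simp_all
  qed
qed

lemma set_plus_subspace_absorb:
  fixes B :: "'a::real_vector set"
  assumes B: "subspace B" and B': "subspace B'" and sub: "B' \<subseteq> B" shows "B' + B = B"
proof
  show "B' + B \<subseteq> B"
    using subspace_add[OF B] sub by (auto elim!: set_plus_elim)
  show "B \<subseteq> B' + B"
    using set_zero_plus2[OF subspace_0[OF B']] .
qed

lemma coset_eq_iff:
  fixes B :: "'a::real_vector set"
  assumes B: "subspace B" shows "c +o B = c' +o B \<longleftrightarrow> c - c' \<in> B"
proof
  assume "c +o B = c' +o B"
  moreover have "c \<in> c +o B" using subspace_0[OF B] by (force simp: elt_set_plus_def)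
  ultimately obtain b where "b \<in> B" "c = c' + b" by (auto simp: elt_set_plus_def)
  then show "c - c' \<in> B" by simp
next
  assume "c - c' \<in> B"
  then have "c' +o ((c - c') +o B) = c' +o B" using elt_set_plus_absorb[OF B] by simp
  then show "c +o B = c' +o B" by (simp add: set_plus_rearrange2)
qed

lemma ce_coboundaries_mono:
  "V \<subseteq> W \<Longrightarrow> ce_coboundaries g br act V u \<subseteq> ce_coboundaries g br act W u"
  by (cases u) (auto dest: subsetD[OF ce_cochains_mono])

lemma (in ce_module) ce_cohomology_trivial:
  assumes exact: "\<And>u c. c \<in> C u \<Longrightarrow> d u c = 0 \<Longrightarrow> c \<in> B u"
  shows "ce_cohomology g br act W = {\<lambda>u. B u}"
proof
  show "ce_cohomology g br act W \<subseteq> {\<lambda>u. B u}"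
  proof
    fix h assume h: "h \<in> ce_cohomology g br act W"
    have "h u = B u" for u
    proof -
      obtain c where "c \<in> C u" "d u c = 0" "h u = c +o B u"
        using h unfolding ce_cohomology_def ce_cohomology_deg_def ce_cocycles_def by blast
      then show ?thesis using exact elt_set_plus_absorb[OF B_subspace] by simp
    qed
    then show "h \<in> {\<lambda>u. B u}" by auto
  qed
  have "B u \<in> ce_cohomology_deg g br act W u" for u
    unfolding ce_cohomology_deg_def ce_cocycles_def
    by (rule image_eqI[of _ _ 0]) (simp_all add: C_0 d_0)
  then show "{\<lambda>u. B u} \<subseteq> ce_cohomology g br act W"
    by (simp add: ce_cohomology_def)
qed

text \<open>\<open>red\<close> has two uses. For a cocycle with values in \<open>W\<close> it yields
  a cohomologous one with values in \<open>V\<close>: surjectivity. For a \<open>W\<close>-valued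
  primitive of a \<open>V\<close>-valued cochain it yields a primitive with values in
  \<open>V\<close>: injectivity.\<close>

lemma ce_inclusion_isoI:
  assumes W: "ce_module g br act W" and V: "ce_module g br act V" and VW: "V \<subseteq> W"
    and red: "\<And>u b. b \<in> ce_cochains g W u \<Longrightarrow> ce_diff g br act u b \<in> ce_cochains g V (Suc u) \<Longrightarrow>
      \<exists>e \<in> ce_coboundaries g br act W u. b - e \<in> ce_cochains g V u"
  shows "ce_inclusion_iso g br act V W"
proof -
  interpret W: ce_module g br act W by (rule W)
  interpret V: ce_module g br act V by (rule V)
  have VWC: "V.C u \<subseteq> W.C u" for u by (rule ce_cochains_mono[OF VW])
  have VWB: "V.B u \<subseteq> W.B u" for u by (rule ce_coboundaries_mono[OF VW])
  have BB: "W.B u + W.B u = W.B u" for u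
    by (rule set_plus_subspace_absorb[OF W.B_subspace W.B_subspace order_refl])
  have VB: "V.B u + W.B u = W.B u" for u
    by (rule set_plus_subspace_absorb[OF W.B_subspace V.B_subspace VWB])
  let ?Phi = "ce_inclusion_map g br act W"
  have co: "(c +o V.B u) + W.B u = c +o W.B u" for c u
    by (simp add: set_plus_rearrange2 set_plus_rearrange3 VB flip: set_plus_rearrange2)
  have cls: "\<exists>c. c \<in> V.C u \<and> W.d u c = 0 \<and> h u = c +o V.B u" if "h \<in> ce_cohomology g br act V" for h u
    using that unfolding ce_cohomology_def ce_cohomology_deg_def ce_cocycles_def by blast
  have into: "?Phi h \<in> ce_cohomology g br act W" if h: "h \<in> ce_cohomology g br act V" for h
  proof -
    have "?Phi h u \<in> ce_cohomology_deg g br act W u" for u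
    proof -
      obtain c where c: "c \<in> V.C u" "W.d u c = 0" "h u = c +o V.B u" using cls[OF h] by blast
      have "?Phi h u = c +o W.B u" by (simp add: ce_inclusion_map_def c(3) co)
      then show ?thesis
        unfolding ce_cohomology_deg_def ce_cocycles_def using c VWC by blast
    qed
    moreover have "{u. ?Phi h u \<noteq> W.B u} \<subseteq> {u. h u \<noteq> V.B u}"
      by (auto simp: ce_inclusion_map_def VB)
    then have "finite {u. ?Phi h u \<noteq> W.B u}"
      using h unfolding ce_cohomology_def by (auto intro: finite_subset)
    ultimately show ?thesis by (simp add: ce_cohomology_def)
  qed
  have inj: "inj_on ?Phi (ce_cohomology g br act V)"
  proof (rule inj_onI, rule ext)
    fix h h' u
    assume h: "h \<in> ce_cohomology g br act V" and h': "h' \<in> ce_cohomology g br act V" and eq: "?Phi h = ?Phi h'"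
    obtain c where c: "c \<in> V.C u" "W.d u c = 0" "h u = c +o V.B u" using cls[OF h] by blast
    obtain c' where c': "c' \<in> V.C u" "W.d u c' = 0" "h' u = c' +o V.B u" using cls[OF h'] by blast
    have "c +o W.B u = c' +o W.B u"
      using fun_cong[OF eq, of u] by (simp add: ce_inclusion_map_def c(3) c'(3) co)
    then have cc: "c - c' \<in> W.B u" by (simp add: coset_eq_iff[OF W.B_subspace])
    have "c - c' \<in> V.B u"
    proof (cases u)
      case 0
      then show ?thesis using cc by simp
    next
      case (Suc v)
      then obtain b where b: "b \<in> W.C v" "c - c' = W.d v b" using cc by auto
      have "W.d v b \<in> V.C (Suc v)"
        using V.C_diff[OF c(1) c'(1)] b Suc by simp
      then obtain e where e: "e \<in> W.B v" "b - e \<in> V.C v" using red[OF b(1)] by blast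
      have "W.d v (b - e) = c - c'"
        using b e by (simp add: W.d_diff[of _ v] W.B_C W.B_cocycle)
      then show ?thesis using e(2) Suc by (metis ce_coboundaries.simps(2) image_eqI)
    qed
    then show "h u = h' u" by (simp add: c(3) c'(3) coset_eq_iff[OF V.B_subspace])
  qed
  have surj: "\<exists>h \<in> ce_cohomology g br act V. ?Phi h = k" if k: "k \<in> ce_cohomology g br act W" for k
  proof -
    \<comment> \<open>The zero class is represented by 0, so that the preimage again vanishes in all
      but finitely many degrees.\<close>
    have "\<exists>c. c \<in> V.C u \<and> W.d u c = 0 \<and> k u = c +o W.B u \<and> (k u = W.B u \<longrightarrow> c = 0)" for u
    proof (cases "k u = W.B u")
      case True
      then show ?thesis
        by (intro exI[of _ 0]) (simp add: V.C_0 W.d_0)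
    next
      case False
      obtain c where c: "c \<in> W.C u" "W.d u c = 0" "k u = c +o W.B u"
        using k unfolding ce_cohomology_def ce_cohomology_deg_def ce_cocycles_def by blast
      obtain e where e: "e \<in> W.B u" "c - e \<in> V.C u"
        using red[OF c(1)] c(2) V.C_0 by auto
      have "W.d u (c - e) = 0" using c e by (simp add: W.d_diff[of _ u] W.B_C W.B_cocycle)
      moreover have "k u = (c - e) +o W.B u" using e by (simp add: c(3) coset_eq_iff[OF W.B_subspace])
      ultimately show ?thesis using e(2) False by blast
    qed
    then obtain f where f: "\<And>u. f u \<in> V.C u" "\<And>u. W.d u (f u) = 0" "\<And>u. k u = f u +o W.B u"
      "\<And>u. k u = W.B u \<Longrightarrow> f u = 0" by metis
    define h where "h = (\<lambda>u. f u +o V.B u)"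
    have "h u \<in> ce_cohomology_deg g br act V u" for u
      using f unfolding h_def ce_cohomology_deg_def ce_cocycles_def by blast
    moreover have "{u. h u \<noteq> V.B u} \<subseteq> {u. k u \<noteq> W.B u}"
      using f(4) by (auto simp: h_def)
    then have "finite {u. h u \<noteq> V.B u}"
      using k unfolding ce_cohomology_def by (auto intro: finite_subset)
    ultimately have "h \<in> ce_cohomology g br act V" by (simp add: ce_cohomology_def)
    moreover have "?Phi h = k" by (rule ext) (simp add: ce_inclusion_map_def h_def co f(3))
    ultimately show ?thesis by blast
  qed
  have "bij_betw ?Phi (ce_cohomology g br act V) (ce_cohomology g br act W)"
    unfolding bij_betw_def using inj into surj by blast
  moreover have "?Phi (h + k) = ?Phi h + ?Phi k" for h k
  proof
    fix u
    have "(h u + W.B u) + (k u + W.B u) = (h u + k u) + (W.B u + W.B u)"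
      by (simp only: ac_simps)
    then show "?Phi (h + k) u = (?Phi h + ?Phi k) u" by (simp add: ce_inclusion_map_def BB)
  qed
  moreover have "?Phi (ce_scale g br act V a h) = ce_scale g br act W a (?Phi h)" for a h
  proof
    fix u
    \<comment> \<open>For \<open>a = 0\<close> scaling collapses the coboundaries to 0; the added
      copy of \<open>W.B u\<close> restores the full coset for every \<open>a\<close>.\<close>
    have "(\<lambda>c. a *\<^sub>R c) ` (h u + W.B u) + W.B u = (\<lambda>c. a *\<^sub>R c) ` h u + ((\<lambda>c. a *\<^sub>R c) ` W.B u + W.B u)"
    proof -
      have "(\<lambda>c. a *\<^sub>R c) ` (h u + W.B u) = (\<lambda>c. a *\<^sub>R c) ` h u + (\<lambda>c. a *\<^sub>R c) ` W.B u"
        unfolding set_plus_image by (force simp: scaleR_add_right image_iff)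
      then show ?thesis by (simp only: add.assoc)
    qed
    also have "(\<lambda>c. a *\<^sub>R c) ` W.B u + W.B u = W.B u"
    proof (rule set_plus_subspace_absorb[OF W.B_subspace])
      show "subspace ((\<lambda>c. a *\<^sub>R c) ` W.B u)"
        by (rule linear_subspace_image[OF _ W.B_subspace]) (rule linearI, simp_all add: scaleR_add_right)
      show "(\<lambda>c. a *\<^sub>R c) ` W.B u \<subseteq> W.B u" using subspace_scale[OF W.B_subspace] by blast
    qed
    finally show "?Phi (ce_scale g br act V a h) u = ce_scale g br act W a (?Phi h) u"
      by (simp add: ce_inclusion_map_def ce_scale_def add.assoc VB)
  qed
  ultimately show ?thesis
    unfolding ce_inclusion_iso_def Let_def using VW by blast
qed

text \<open>By multilinearity the values on lists from the finite spanning set \<open>G\<close>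
  generate all values. Their finitely many orders are bounded by their sum \<open>k\<close>.\<close>

lemma ce_cochains_diff_ops_bounded:
  fixes b :: "'m::finite vfield list \<Rightarrow> ('m tfield \<Rightarrow> 'm tfield)"
  assumes b: "b \<in> ce_cochains sl_fields (diff_ops p q) u"
  shows "\<exists>k. b \<in> ce_cochains sl_fields (diff_ops_le k p q) u"
proof -
  define G :: "'m vfield set" where "G = {coord_field i | i. True} \<union>
      {\<lambda>x. x $ j *\<^sub>R coord_field i x | i j. True} \<union> {\<lambda>x. x $ j *\<^sub>R euler_field x | j. True}"
  have sl: "sl_fields = span G" by (simp add: sl_fields_def G_def)
  have Gsl: "G \<subseteq> sl_fields" unfolding sl by (rule span_superset)
  have "finite {\<lambda>x. x $ j *\<^sub>R coord_field i x | i j :: 'm. True}"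
  proof -
    have "{\<lambda>x. x $ j *\<^sub>R coord_field i x | i j :: 'm. True} = (\<lambda>(i, j) x. x $ j *\<^sub>R coord_field i x) ` UNIV"
      by auto
    then show ?thesis by simp
  qed
  then have finG: "finite G" unfolding G_def by (simp add: full_SetCompr_eq)
  let ?L = "{Xs. set Xs \<subseteq> G \<and> length Xs = u}"
  have finL: "finite ?L" by (rule finite_lists_length_eq[OF finG])
  have "\<forall>Xs \<in> ?L. \<exists>k. b Xs \<in> diff_ops_le k p q"
  proof
    fix Xs assume "Xs \<in> ?L"
    then have "b Xs \<in> diff_ops p q" using Gsl by (intro ce_cochains_in[OF b]) auto
    then show "\<exists>k. b Xs \<in> diff_ops_le k p q" by (rule diff_opsE) (rule exI)
  qed
  then obtain K where K: "\<And>Xs. Xs \<in> ?L \<Longrightarrow> b Xs \<in> diff_ops_le (K Xs) p q" by (rule bchoice[THEN exE]) blast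
  define k where "k = (\<Sum>Xs\<in>?L. K Xs)"
  have base: "b Xs \<in> diff_ops_le k p q" if "set Xs \<subseteq> G" "length Xs = u" for Xs
  proof -
    have "K Xs \<le> k" unfolding k_def by (rule member_le_sum[OF _ _ finL]) (use that in auto)
    then show ?thesis using subsetD[OF diff_ops_le_mono K] that by blast
  qed
  \<comment> \<open>Only the first \<open>m\<close> arguments may lie outside \<open>G\<close>; the
    induction frees them one at a time, by linearity in that slot.\<close>
  have ext: "b Xs \<in> diff_ops_le k p q"
    if "m \<le> u" "length Xs = u" "set Xs \<subseteq> sl_fields" "\<And>j. m \<le> j \<Longrightarrow> j < u \<Longrightarrow> Xs ! j \<in> G" for m Xs
    using that
  proof (induction m arbitrary: Xs)
    case 0
    then show ?case by (intro base) (auto simp: in_set_conv_nth)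
  next
    case (Suc m)
    have m: "m < u" using Suc.prems by simp
    have set_up: "set (Xs[m := Z]) \<subseteq> sl_fields" if "Z \<in> sl_fields" for Z
      using Suc.prems(3) that set_update_subset_insert[of Xs m Z] by auto
    have "Z \<in> sl_fields \<and> b (Xs[m := Z]) \<in> diff_ops_le k p q" if "Z \<in> span G" for Z
      using that
    proof (induction rule: span_induct_alt)
      case base
      have "b (Xs[m := 0 *\<^sub>R 0 + 0 *\<^sub>R 0]) = 0 *\<^sub>R b (Xs[m := 0]) + 0 *\<^sub>R b (Xs[m := 0])"
        using ce_cochains_lin[OF b Suc.prems(2,3) m] subspace_0[OF subspace_sl] by blast
      then have "b (Xs[m := 0]) = 0" by simp
      then show ?case by (simp only: subspace_0[OF subspace_diff_ops_le] subspace_0[OF subspace_sl])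
    next
      case (step c Y Z)
      have Y: "Y \<in> sl_fields" and Z: "Z \<in> sl_fields" using step(1,2) Gsl by auto
      have "b (Xs[m := Y]) \<in> diff_ops_le k p q"
      proof (rule Suc.IH)
        show "set (Xs[m := Y]) \<subseteq> sl_fields" by (rule set_up[OF Y])
        show "Xs[m := Y] ! j \<in> G" if "m \<le> j" "j < u" for j
          using Suc.prems(2,4) that step(1) by (cases "j = m") auto
      qed (use Suc.prems in auto)
      moreover have "b (Xs[m := c *\<^sub>R Y + 1 *\<^sub>R Z]) = c *\<^sub>R b (Xs[m := Y]) + 1 *\<^sub>R b (Xs[m := Z])"
        by (rule ce_cochains_lin[OF b Suc.prems(2,3) m Y Z])
      ultimately have "c *\<^sub>R Y + Z \<in> sl_fields \<and> b (Xs[m := c *\<^sub>R Y + Z]) \<in> diff_ops_le k p q"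
        using step(2) subspace_add[OF subspace_sl subspace_scale[OF subspace_sl Y, of c] Z]
        by (simp add: subspace_add[OF subspace_diff_ops_le] subspace_scale[OF subspace_diff_ops_le])
      then show ?case .
    qed
    moreover have "Xs ! m \<in> span G"
      using subsetD[OF Suc.prems(3) nth_mem[of m Xs]] Suc.prems(2) m unfolding sl by simp
    ultimately have "b (Xs[m := Xs ! m]) \<in> diff_ops_le k p q" by blast
    then show ?case by simp
  qed
  have "b \<in> ce_cochains sl_fields (diff_ops_le k p q) u"
    unfolding ce_cochains_def
  proof (intro CollectI conjI allI impI; (elim conjE)?)
    fix Xs :: "'m vfield list"
    assume "length Xs = u" "set Xs \<subseteq> sl_fields"
    then show "b Xs \<in> diff_ops_le k p q" by (intro ext[of u]) auto
  qed (use ce_cochains_outside[OF b] ce_cochains_lin[OF b] ce_cochains_alt[OF b] in blast)+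
  then show ?thesis by blast
qed

section \<open>Descent through the orders and conclusion\<close>

lemma diff_ops_le_sub: "diff_ops_le k p q \<subseteq> diff_ops p q"
  by (rule subsetI) (rule diff_opsI)

text \<open>One induction for both cases: \<open>V\<close> is \<open>{0}\<close> for
  \<open>p < q\<close> and the operators of order at most \<open>p - q\<close> otherwise. Inclusion
  of \<open>V\<close> in every lower-order module met on the way keeps the hypothesis on the
  differential available for \<open>reduce_order\<close>.\<close>

lemma reduce_order_repeatedly:
  fixes b :: "'m::finite vfield list \<Rightarrow> ('m tfield \<Rightarrow> 'm tfield)"
  assumes V: "\<And>k. p < q + k \<Longrightarrow> V \<subseteq> diff_ops_less k p q"
    and stop: "\<And>k. \<not> p < q + k \<Longrightarrow> diff_ops_le k p q \<subseteq> V"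
    and zero: "p < q \<Longrightarrow> V = {0}"
    and Vmod: "ce_module sl_fields lie_bracket (op_action \<delta> p) V"
  shows "b \<in> ce_cochains sl_fields (diff_ops_le k p q) u \<Longrightarrow>
    ce_diff sl_fields lie_bracket (op_action \<delta> p) u b \<in> ce_cochains sl_fields V (Suc u) \<Longrightarrow>
    \<exists>e \<in> ce_coboundaries sl_fields lie_bracket (op_action \<delta> p) (diff_ops p q) u. b - e \<in> ce_cochains sl_fields V u"
proof (induction k arbitrary: b rule: less_induct)
  case (less k)
  interpret D: ce_module sl_fields lie_bracket "op_action \<delta> p" "diff_ops p q :: ('m tfield \<Rightarrow> 'm tfield) set"
    by (rule ce_module_diff_ops)
  have bD: "b \<in> D.C u" using less.prems(1) ce_cochains_mono[OF diff_ops_le_sub] by blast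
  show ?case
  proof (cases "p < q + k")
    case False
    then have "b - 0 \<in> ce_cochains sl_fields V u"
      using less.prems(1) ce_cochains_mono[OF stop] by auto
    then show ?thesis using subspace_0[OF D.B_subspace] by blast
  next
    case True
    have "D.d u b \<in> ce_cochains sl_fields (diff_ops_less k p q) (Suc u)"
      using less.prems(2) ce_cochains_mono[OF V[OF True]] by blast
    then obtain e where e: "e \<in> ce_coboundaries sl_fields lie_bracket (op_action \<delta> p) (diff_ops_le k p q) u"
      "b - e \<in> ce_cochains sl_fields (diff_ops_less k p q) u"
      using reduce_order[OF True less.prems(1)] by blast
    have eD: "e \<in> D.B u" using e(1) ce_coboundaries_mono[OF diff_ops_le_sub] by blast
    show ?thesis
    proof (cases k)
      case 0
      \<comment> \<open>Order 0 is reduced further only for \<open>p < q\<close>; the next lower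
        module is then \<open>{0}\<close>, which is \<open>V\<close>.\<close>
      then have "V = {0}" using zero True by simp
      then have "b - e \<in> ce_cochains sl_fields V u" using e(2) 0 by (simp add: diff_ops_less_def)
      then show ?thesis using eD by blast
    next
      case (Suc l)
      \<comment> \<open>Subtracting a coboundary leaves the differential unchanged, so the induction
        hypothesis applies to \<open>b - e\<close>.\<close>
      have "D.d u (b - e) = D.d u b"
        by (simp add: D.d_diff[OF bD D.B_C[OF eD]] D.B_cocycle[OF eD])
      moreover have "b - e \<in> ce_cochains sl_fields (diff_ops_le l p q) u"
        using e(2) Suc by (simp add: diff_ops_less_def)
      ultimately have "\<exists>e' \<in> D.B u. b - e - e' \<in> ce_cochains sl_fields V u"
        by (intro less.IH[of l]) (simp_all only: less.prems(2) Suc lessI)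
      then obtain e' where e': "e' \<in> D.B u" "b - e - e' \<in> ce_cochains sl_fields V u" by blast
      then show ?thesis
        by (intro bexI[of _ "e + e'"] subspace_add[OF D.B_subspace eD]) (simp_all only: diff_diff_eq)
    qed
  qed
qed

theorem theorem6p5:
  fixes \<delta> :: real and p q :: nat
  shows "(p < q \<longrightarrow>
            ce_cohomology (sl_fields :: 'm::finite vfield set) lie_bracket (op_action \<delta> p) (diff_ops p q) =
              {\<lambda>u. ce_coboundaries (sl_fields :: 'm vfield set) lie_bracket (op_action \<delta> p) (diff_ops p q) u}) \<and>
         (p \<ge> q \<longrightarrow>
            ce_inclusion_iso (sl_fields :: 'm vfield set) lie_bracket (op_action \<delta> p)
              (diff_ops_le (p - q) p q) (diff_ops p q))"
proof (intro conjI impI)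
  interpret D: ce_module sl_fields lie_bracket "op_action \<delta> p" "diff_ops p q :: ('m tfield \<Rightarrow> 'm tfield) set"
    by (rule ce_module_diff_ops)
  {
    assume pq: "p < q"
    show "ce_cohomology (sl_fields :: 'm vfield set) lie_bracket (op_action \<delta> p) (diff_ops p q) = {\<lambda>u. D.B u}"
    proof (rule D.ce_cohomology_trivial)
      fix u and c :: "'m vfield list \<Rightarrow> ('m tfield \<Rightarrow> 'm tfield)"
      assume c: "c \<in> D.C u" "D.d u c = 0"
      obtain k where k: "c \<in> ce_cochains sl_fields (diff_ops_le k p q) u"
        using ce_cochains_diff_ops_bounded[OF c(1)] by blast
      have mod0: "ce_module sl_fields lie_bracket (op_action \<delta> p) ({0} :: ('m tfield \<Rightarrow> 'm tfield) set)"
        using ce_module_diff_ops_less[of \<delta> p 0 q] by (simp add: diff_ops_less_def)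
      have "\<exists>e \<in> D.B u. c - e \<in> ce_cochains sl_fields {0} u"
      proof (rule reduce_order_repeatedly[OF _ _ _ mod0 k])
        show "{0} \<subseteq> (diff_ops_less k p q :: ('m tfield \<Rightarrow> 'm tfield) set)" for k
          using subspace_0[OF ce_module.W_subspace[OF ce_module_diff_ops_less]] by blast
        show "D.d u c \<in> ce_cochains sl_fields {0} (Suc u)"
          using c(2) ce_module.C_0[OF mod0] by simp
      qed (use pq in auto)
      then obtain e where e: "e \<in> D.B u" "c - e \<in> ce_cochains sl_fields {0} u" by blast
      have "(c - e) Xs = 0" for Xs
        using ce_cochains_in[OF e(2), of Xs] ce_cochains_outside[OF e(2), of Xs]
        by (cases "length Xs = u \<and> set Xs \<subseteq> sl_fields") auto
      then have "c - e = 0" by (intro ext) simp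
      then show "c \<in> D.B u" using e(1) by simp
    qed
  }
  {
    assume pq: "q \<le> p"
    show "ce_inclusion_iso (sl_fields :: 'm vfield set) lie_bracket (op_action \<delta> p)
        (diff_ops_le (p - q) p q) (diff_ops p q)"
    proof (rule ce_inclusion_isoI[OF D.ce_module_axioms ce_module_diff_ops_le diff_ops_le_sub])
      fix u and b :: "'m vfield list \<Rightarrow> ('m tfield \<Rightarrow> 'm tfield)"
      assume b: "b \<in> D.C u" and db: "D.d u b \<in> ce_cochains sl_fields (diff_ops_le (p - q) p q) (Suc u)"
      obtain k where k: "b \<in> ce_cochains sl_fields (diff_ops_le k p q) u"
        using ce_cochains_diff_ops_bounded[OF b] by blast
      show "\<exists>e \<in> D.B u. b - e \<in> ce_cochains sl_fields (diff_ops_le (p - q) p q) u"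
      proof (rule reduce_order_repeatedly[OF _ _ _ ce_module_diff_ops_le k db])
        show "diff_ops_le (p - q) p q \<subseteq> (diff_ops_less k p q :: ('m tfield \<Rightarrow> 'm tfield) set)" if "p < q + k" for k
        proof -
          \<comment> \<open>The bound \<open>p < q + k\<close> forces \<open>k > p - q\<close>, so
            \<open>k - 1\<close> is a genuine predecessor that is still at least
            \<open>p - q\<close>.\<close>
          have k: "(k = 0) = False" and le: "p - q \<le> k - 1" using that pq by auto
          show ?thesis unfolding diff_ops_less_def k if_False by (rule diff_ops_le_mono[OF le])
        qed
        show "diff_ops_le k p q \<subseteq> (diff_ops_le (p - q) p q :: ('m tfield \<Rightarrow> 'm tfield) set)" if "\<not> p < q + k" for k
          using that by (intro diff_ops_le_mono) simp
      qed (use pq in auto)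
    qed
  }
qed

end
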